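(* Let $k\ge\ell\ge1$ be integers with $k+\ell\ge 6$. Then $\sup_G s_{k,\ell}(G)=\mathrm{OPT}(k,\ell)$, where the supremum is over all finite digraphs $G$.
   Context: Put $m=k+\ell$. Digraphs are finite, without loops; $xy$ denotes an arc from $x$ to $y$. The oriented star $S_{k,\ell}$ has a center $c$, a set $O$ of $k$ out-leaves and a set $I$ of $\ell$ in-leaves; its arcs are exactly $co$ ($o\in O$) and $ic$ ($i\in I$). For a digraph $G$ on $n$ vertices, let $\phi$ be a uniformly random map from $V(S_{k,\ell})$ to $V(G)$ (all $n^{m+1}$ maps equally likely), and let $\mathcal S$ be the set of maps $\phi$ that are isomorphisms from $S_{k,\ell}$ onto the induced subdigraph $G[\mathrm{Im}\,\phi]$ (in particular injective). Set $s_{k,\ell}(G)=\Pr[\phi\in\mathcal S]$. Define $\mathrm{OPT}(k,\ell)=2^{-2k}\max_{\alpha\in[0,1]}\{\alpha(1-\alpha)^{2k}+(1-\alpha)\alpha^{2k}\}$ if $k=\ell$, and, if $k>\ell$, $\mathrm{OPT}(k,\ell)=\max_{(\alpha,d)\in[0,\frac12]\times[0,\frac{k}{k+\ell}]}\{\alpha(1-\alpha)^{m}d^k(1-d)^\ell+\frac{(k-1)^{k-1}\ell^\ell}{(m-1)^{m-1}}(1-\alpha)\alpha^{m}(1-d)\}$. *)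

theory Defs
  imports Complex_Main "HOL-Library.FuncSet"
begin

text \<open>A finite digraph is represented (up to isomorphism) by a pair (n, E):
  vertex set {0..<n}, arc set E \<subseteq> {0..<n} x {0..<n}, without loops.
  We require n \<ge> 1 so that the random map is defined.\<close>

definition digraphs :: "(nat \<times> (nat \<times> nat) set) set" where
  "digraphs = {(n, E). n \<ge> 1 \<and> E \<subseteq> {0..<n} \<times> {0..<n} \<and> (\<forall>x. (x, x) \<notin> E)}"

definition star_verts :: "nat \<Rightarrow> nat \<Rightarrow> nat set" where
  "star_verts k l = {0..k+l}"

definition star_arc :: "nat \<Rightarrow> nat \<Rightarrow> nat \<Rightarrow> nat \<Rightarrow> bool" where
  "star_arc k l u v \<longleftrightarrow> (u = 0 \<and> 1 \<le> v \<and> v \<le> k) \<or> (k + 1 \<le> u \<and> u \<le> k + l \<and> v = 0)"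

definition star_iso :: "nat \<Rightarrow> nat \<Rightarrow> (nat \<times> nat) set \<Rightarrow> (nat \<Rightarrow> nat) \<Rightarrow> bool" where
  "star_iso k l E \<phi> \<longleftrightarrow> inj_on \<phi> (star_verts k l) \<and>
     (\<forall>u\<in>star_verts k l. \<forall>v\<in>star_verts k l. (\<phi> u, \<phi> v) \<in> E \<longleftrightarrow> star_arc k l u v)"

definition s_density :: "nat \<Rightarrow> nat \<Rightarrow> nat \<Rightarrow> (nat \<times> nat) set \<Rightarrow> real" where
  "s_density k l n E =
     real (card {\<phi> \<in> star_verts k l \<rightarrow>\<^sub>E {0..<n}. star_iso k l E \<phi>}) / real n ^ (k + l + 1)"

definition OPT :: "nat \<Rightarrow> nat \<Rightarrow> real" where
  "OPT k l =
    (if k = l then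
       (1 / 2 ^ (2 * k)) *
         (SUP \<alpha>\<in>{0..1::real}. \<alpha> * (1 - \<alpha>) ^ (2 * k) + (1 - \<alpha>) * \<alpha> ^ (2 * k))
     else
       (SUP p\<in>{0..1/2::real} \<times> {0..real k / real (k + l)}.
          (case p of (\<alpha>, d) \<Rightarrow>
             \<alpha> * (1 - \<alpha>) ^ (k + l) * d ^ k * (1 - d) ^ l
             + (real (k - 1) ^ (k - 1) * real l ^ l / real (k + l - 1) ^ (k + l - 1))
               * (1 - \<alpha>) * \<alpha> ^ (k + l) * (1 - d))))"

end

theory Submission
  imports Defs
begin

text \<open>
  Put \<open>m = k + l\<close>. For the upper bound, blowing up and then maximising over digraphs with a fixed large
  number of vertices, one may assume that every vertex lies in at least \<open>(m + 1) OPT n\<^sup>m\<close> stars: otherwise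
  replace a poor vertex by a twin of a rich one. A leaf \<open>v\<close> of a star excludes the neighbourhood of \<open>v\<close>
  from the other leaves, so a vertex of degree \<open>\<delta> n\<close> lies in at most about
  \<open>\<delta>\<^sup>m + e m \<delta> (1 - \<delta>) ^ (m - 1)\<close> (suitably normalised) stars. Hence every degree is either below
  \<open>n / 2\<close> or above \<open>(1 - \<nu>) n\<close> with \<open>\<nu>\<close> close to \<open>1 / (m + 1)\<close>, which splits the vertices into \<open>High\<close>
  and \<open>Low\<close>; moreover the degrees inside \<open>Low\<close> are at most \<open>\<nu> n\<close>, and almost all pairs between \<open>High\<close> and
  \<open>Low\<close> are adjacent. Every deviation from a complete bipartite orientation
  (missing pairs, edges in \<open>Low\<close>, edges in \<open>High\<close>) then destroys more stars than it creates.
  For a bipartite orientation with parts of density \<open>\<alpha>\<close> and \<open>1 - \<alpha>\<close>, stars with centre in \<open>Low\<close> are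
  counted by their first out-leaf \<open>a\<close>; this bound is linear in the in-density of \<open>a\<close>, so the total is
  a sum over \<open>a\<close> in \<open>High\<close> whose terms are at most \<open>OPT / \<alpha>\<close>.
  The only delicate case is \<open>l = 1\<close>, where edges between vertices that send arcs to almost all
  of \<open>High\<close> are not penalised; the set \<open>W\<close> of these vertices is so small that the stars inside \<open>W\<close> are
  outweighed by the stars with leaves in \<open>High\<close> which their centres miss.
\<close>

section \<open>Weighted means\<close>

text \<open>The coefficient \<open>bmax (k - 1) l\<close> in \<open>OPT\<close> comes from a tangent
  line: \<open>x^k (1 - x)^l <= bmax (k - 1) l * x\<close>, with equality at
  \<open>x = (k - 1) / (m - 1)\<close>. A centre in \<open>Low\<close> with out-density
  \<open>x\<close> towards \<open>High\<close> contributes \<open>x^k (1 - x)^l\<close>, while only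
  the mean of \<open>x\<close> is tied to the orientation seen from \<open>High\<close>. Mixing
  centres at the contact point with centres at 0 attains the line as long as the mean stays below
  the contact point. For \<open>k > l\<close> it does. For \<open>k = l\<close> the mean is near
  1/2, beyond the contact point, the line overshoots, and a separate argument with the constant
  \<open>bmax k k\<close> is needed.

  The upper bound uses no limit object. If a digraph beat \<open>OPT\<close>, the gap would absorb
  the O(1/n) loss of twinning in a large blow-up, so the bound on stars per vertex holds without
  error term; all later estimates count maps by products of sizes of candidate sets and hold for
  every \<open>n\<close>. The price is numerical: the degree dichotomy and all balances need
  explicit constants, and \<open>m = 6\<close> leaves little room.\<close>

lemma weighted_amgm:
  fixes u v :: real
  assumes "0 \<le> u" "0 \<le> v" "0 < p + q"
  shows "u ^ p * v ^ q \<le> ((real p * u + real q * v) / real (p + q)) ^ (p + q)"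
proof -
  define S where "S = (real p * u + real q * v) / real (p + q)"
  have S0: "0 \<le> S" using assms by (simp add: S_def)
  have S_eq: "real p * u + real q * v = S * real (p + q)" using assms by (simp add: S_def del: of_nat_add)
  show ?thesis
  proof (cases "S = 0")
    case True
    then have "real p * u = 0" "real q * v = 0"
      using S_eq assms by (simp_all add: add_nonneg_eq_0_iff)
    then have "u ^ p * v ^ q = 0" using assms(3) by auto
    moreover have "0 \<le> S ^ (p + q)" using S0 by simp
    ultimately show ?thesis unfolding S_def by linarith
  next
    case False
    then have S: "S > 0" using S0 by simp
    have lin: "real p * (u / S - 1) + real q * (v / S - 1) = (real p * u + real q * v) / S - real (p + q)"
      by (simp add: algebra_simps add_divide_distrib)
    \<comment> \<open>Each factor divided by the mean is bounded by \<open>x <= exp (x - 1)\<close>;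
      by the choice of \<open>S\<close> the exponents add up to 0.\<close>
    have "(u / S) ^ p * (v / S) ^ q \<le> exp (u / S - 1) ^ p * exp (v / S - 1) ^ q"
      using assms S exp_ge_add_one_self[of "u / S - 1"] exp_ge_add_one_self[of "v / S - 1"]
      by (intro mult_mono power_mono) auto
    also have "\<dots> = exp (real p * (u / S - 1) + real q * (v / S - 1))"
      by (simp add: exp_add exp_of_nat_mult)
    also have "real p * (u / S - 1) + real q * (v / S - 1) = 0"
      unfolding lin S_eq using S by simp
    finally have "u ^ p * v ^ q \<le> S ^ (p + q)"
      using S by (simp add: power_divide power_add field_simps)
    then show ?thesis by (simp add: S_def)
  qed
qed

text \<open>The maximum of \<open>x\<^sup>p (1 - x)\<^sup>q\<close> on the unit interval; note \<open>0 ^ 0 = 1\<close>.\<close>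

definition bmax :: "nat \<Rightarrow> nat \<Rightarrow> real" where
  "bmax p q = real p ^ p * real q ^ q / real (p + q) ^ (p + q)"

lemma bmax_pos: "bmax p q > 0"
  unfolding bmax_def by (intro divide_pos_pos mult_pos_pos) (auto simp: zero_less_power_eq)

text \<open>Weighted AM-GM for \<open>x / p\<close> and \<open>y / q\<close>, kept homogeneous so
  that densities with any sum \<open>x + y\<close> can be inserted. Zero exponents are treated apart
  because of the division.\<close>

lemma bmax_bound:
  fixes x y :: real
  assumes "0 \<le> x" "0 \<le> y"
  shows "x ^ p * y ^ q \<le> bmax p q * (x + y) ^ (p + q)"
proof -
  consider "p = 0" | "q = 0" | "p > 0" "q > 0" by auto
  then show ?thesis
  proof cases
    case 1
    have "y ^ q \<le> (x + y) ^ q" using assms by (intro power_mono) auto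
    then show ?thesis using 1 by (cases "q = 0") (simp_all add: bmax_def)
  next
    case 2
    have "x ^ p \<le> (x + y) ^ p" using assms by (intro power_mono) auto
    then show ?thesis using 2 by (cases "p = 0") (simp_all add: bmax_def)
  next
    case 3
    then have "(x / p) ^ p * (y / q) ^ q \<le> ((x + y) / real (p + q)) ^ (p + q)"
      using weighted_amgm[of "x / p" "y / q" p q] assms by simp
    then have "real p ^ p * real q ^ q * ((x / p) ^ p * (y / q) ^ q)
      \<le> real p ^ p * real q ^ q * ((x + y) / real (p + q)) ^ (p + q)"
      by (intro mult_left_mono) auto
    then show ?thesis using 3 by (simp add: bmax_def power_divide)
  qed
qed

lemma bmax_le_1: "bmax p q \<le> 1"
proof -
  have "real p ^ p * real q ^ q \<le> real (p + q) ^ p * real (p + q) ^ q"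
    by (intro mult_mono power_mono) auto
  then show ?thesis unfolding bmax_def
    by (intro divide_le_eq_1[THEN iffD2]) (auto simp: power_add zero_less_power_eq)
qed

text \<open>For a prescribed leaf there are \<open>p\<close> slots, and \<open>p - 1\<close> free
  leaves of the same kind remain. The right-hand side is symmetric in \<open>p\<close> and
  \<open>q\<close>, so one constant serves out-leaves and in-leaves alike.\<close>

lemma bmax_decr_left:
  assumes "0 < p"
  shows "real p * bmax (p - 1) q \<le> real p ^ p * real q ^ q / real (p + q - 1) ^ (p + q - 1)"
proof -
  have "real p * real (p - 1) ^ (p - 1) \<le> real p * real p ^ (p - 1)"
    by (intro mult_left_mono power_mono) auto
  also have "\<dots> = real p ^ p" using assms by (simp flip: power_Suc)
  finally have "real p * real (p - 1) ^ (p - 1) * real q ^ q \<le> real p ^ p * real q ^ q"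
    by (intro mult_right_mono) auto
  moreover have "p - 1 + q = p + q - 1" using assms by simp
  ultimately show ?thesis by (simp add: bmax_def divide_right_mono mult.assoc)
qed

lemma bmax_commute: "bmax p q = bmax q p"
  by (simp add: bmax_def add.commute mult.commute)

lemma bmax_decr_right:
  assumes "0 < q"
  shows "real q * bmax p (q - 1) \<le> real p ^ p * real q ^ q / real (p + q - 1) ^ (p + q - 1)"
  using bmax_decr_left[OF assms, of p] by (simp add: bmax_commute[of p] add.commute mult.commute)

section \<open>Numerical estimates\<close>

text \<open>This quantity grows like \<open>e m\<close>; it is the ratio between the best bounds for the number of stars with
  a given centre through one prescribed leaf and without prescribed leaf.\<close>

definition em :: "nat \<Rightarrow> real" where
  "em m = real m ^ m / real (m - 1) ^ (m - 1)"

text \<open>\<open>theta m / (m + 1)\<close> is the maximum of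
  \<open>\<alpha> (1 - \<alpha>)^m\<close>, attained at \<open>\<alpha> = 1 / (m + 1)\<close>: the
  leading term of \<open>OPT k l / bmax k l\<close> for \<open>m = k + l\<close>.\<close>

definition theta :: "nat \<Rightarrow> real" where
  "theta m = (real m / real (m + 1)) ^ m"

text \<open>Five percent above \<open>1 / (m + 1)\<close>. Then \<open>(1 - nu m)^m\<close> is at
  most \<open>20/21 * theta m\<close>, and the difference \<open>theta m / 21\<close> pays for the
  error terms.\<close>

definition nu :: "nat \<Rightarrow> real" where
  "nu m = 21 / (20 * real (m + 1))"

lemma exp1_less: "exp 1 < (68 / 25 :: real)"
proof -
  obtain t :: real where t: "\<bar>t\<bar> \<le> \<bar>1\<bar>" "exp 1 = (\<Sum>m<7. 1 ^ m / fact m) + exp t / fact 7 * 1 ^ 7"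
    using Maclaurin_exp_le[of 1 7] by blast
  have "exp t \<le> 3" using t(1) exp_le order_trans[of "exp t" "exp 1" 3] by simp
  then show ?thesis using t(2) by (simp add: lessThan_nat_numeral fact_numeral)
qed

lemma one_plus_power_le_exp:
  fixes x :: real assumes "0 \<le> 1 + x" shows "(1 + x) ^ n \<le> exp (real n * x)"
proof -
  have "(1 + x) ^ n \<le> exp x ^ n" using assms by (intro power_mono exp_ge_add_one_self)
  then show ?thesis by (simp add: exp_of_nat_mult)
qed

text \<open>Multiply by Bernoulli's \<open>1 + n x <= (1 + x)^n\<close> and use
  \<open>(1 - x^2)^n <= 1\<close>.\<close>

lemma one_minus_power_le:
  fixes x :: real assumes "0 \<le> x" "x \<le> 1" shows "(1 - x) ^ n \<le> 1 / (1 + real n * x)"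
proof -
  have "(1 - x) ^ n * (1 + real n * x) \<le> (1 - x) ^ n * (1 + x) ^ n"
    using assms by (intro mult_left_mono Bernoulli_inequality) auto
  also have "\<dots> = (1 - x\<^sup>2) ^ n" by (simp add: power_mult_distrib[symmetric] algebra_simps power2_eq_square)
  also have "\<dots> \<le> 1" using assms by (intro power_le_one) (auto simp: power_le_one)
  moreover have "0 < 1 + real n * x" using assms by (simp add: add_pos_nonneg)
  ultimately show ?thesis by (simp add: pos_le_divide_eq)
qed

lemma em_nonneg: "0 \<le> em m" by (simp add: em_def)

lemma em_eq: "m \<ge> 2 \<Longrightarrow> em m = real m * (1 + 1 / real (m - 1)) ^ (m - 1)"
proof -
  assume m: "m \<ge> 2"
  have "real m ^ m = real m * real m ^ (m - 1)" using m by (simp flip: power_Suc)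
  moreover have "1 + 1 / real (m - 1) = real m / real (m - 1)" using m by (simp add: field_simps of_nat_diff)
  ultimately show ?thesis by (simp add: em_def power_divide)
qed

lemma em_le: assumes "m \<ge> 2" shows "em m \<le> 68 / 25 * real m"
proof -
  have "(1 + 1 / real (m - 1)) ^ (m - 1) \<le> exp (real (m - 1) * (1 / real (m - 1)))"
    by (rule one_plus_power_le_exp) simp
  also have "\<dots> = exp 1" using assms by simp
  finally have "(1 + 1 / real (m - 1)) ^ (m - 1) \<le> 68 / 25" using exp1_less by linarith
  then have "real m * (1 + 1 / real (m - 1)) ^ (m - 1) \<le> real m * (68 / 25)" by (intro mult_left_mono) auto
  then show ?thesis using em_eq[OF assms] by simp
qed

lemma em_ge: assumes "m \<ge> 2" shows "em m \<ge> 2 * real m"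
proof -
  have "1 + real (m - 1) * (1 / real (m - 1)) \<le> (1 + 1 / real (m - 1)) ^ (m - 1)"
    by (rule Bernoulli_inequality) (auto intro: order_trans[of _ 0])
  then have "2 \<le> (1 + 1 / real (m - 1)) ^ (m - 1)" using assms by simp
  then have "real m * 2 \<le> real m * (1 + 1 / real (m - 1)) ^ (m - 1)" by (intro mult_left_mono) auto
  then show ?thesis using em_eq[OF assms] by simp
qed

lemma theta_ge: assumes "m \<ge> 1" shows "theta m \<ge> 25 / 68"
proof -
  have "(1 + 1 / real m) ^ m \<le> exp (real m * (1 / real m))"
    by (rule one_plus_power_le_exp) simp
  then have "(1 + 1 / real m) ^ m \<le> 68 / 25" using exp1_less assms by simp
  moreover have "theta m * (1 + 1 / real m) ^ m = 1"
  proof -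
    have "1 + 1 / real m = real (m + 1) / real m" using assms by (simp add: add_divide_distrib)
    then have "real m / real (m + 1) * (1 + 1 / real m) = 1" using assms by simp
    then show ?thesis by (simp only: theta_def power_mult_distrib[symmetric] power_one)
  qed
  moreover have "0 \<le> theta m" by (simp add: theta_def)
  ultimately have "1 \<le> theta m * (68 / 25)" by (metis mult_left_mono)
  then show ?thesis by simp
qed

text \<open>Once the factor \<open>m / (m + 1)\<close> is split off, \<open>1 - t / m\<close>
  remains, whose power is at most \<open>1 / (1 + t)\<close>. Used with \<open>t = 1/20\<close>,
  which gives \<open>nu\<close>, and with \<open>t = 2/5\<close>.\<close>

lemma theta_scaled:
  assumes "m \<ge> 1" "0 \<le> t" "t \<le> real m"
  shows "(1 - (1 + t) / real (m + 1)) ^ m \<le> theta m / (1 + t)"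
proof -
  have "1 - (1 + t) / real (m + 1) = (real m / real (m + 1)) * (1 - t / real m)"
  proof -
    have "real m / real (m + 1) * (1 - t / real m) = (real (m + 1) - (1 + t)) / real (m + 1)"
      using assms by (simp add: right_diff_distrib flip: diff_divide_distrib)
    also have "\<dots> = real (m + 1) / real (m + 1) - (1 + t) / real (m + 1)" by (rule diff_divide_distrib)
    finally show ?thesis by simp
  qed
  then have "(1 - (1 + t) / real (m + 1)) ^ m = theta m * (1 - t / real m) ^ m"
    by (simp only: theta_def power_mult_distrib)
  also have "\<dots> \<le> theta m * (1 / (1 + real m * (t / real m)))"
    using assms by (intro mult_left_mono one_minus_power_le) (auto simp: theta_def)
  finally show ?thesis using assms by simp
qed

text \<open>From 7 on, one step multiplies \<open>m^j\<close> by at most \<open>(8/7)^j\<close>;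
  under the third assumption the sequence therefore does not increase and is bounded by its value at
  7.\<close>

lemma poly_geometric:
  fixes c :: real
  assumes "m \<ge> 7" "0 \<le> c" "(8 / 7) ^ j * c \<le> 1"
  shows "real m ^ j * c ^ (m - 7) \<le> 7 ^ j"
  using assms(1)
proof (induction m rule: dec_induct)
  case (step m)
  have "real (Suc m) ^ j \<le> (8 / 7 * real m) ^ j" using step.hyps by (intro power_mono) auto
  then have "real (Suc m) ^ j * c ^ (Suc m - 7) \<le> (8 / 7 * real m) ^ j * c ^ (Suc m - 7)"
    using assms(2) by (intro mult_right_mono) auto
  also have "\<dots> = ((8 / 7) ^ j * c) * (real m ^ j * c ^ (m - 7))"
    using step.hyps(1) by (simp only: power_mult_distrib Suc_diff_le power_Suc mult_ac)
  also have "\<dots> \<le> 1 * 7 ^ j" using step assms by (intro mult_mono) auto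
  finally show ?case by simp
qed simp

lemma poly_geometric':
  fixes c :: real
  assumes "m \<ge> 7" "0 \<le> c" "(8 / 7) ^ j * c \<le> 1" "i \<le> 7"
  shows "real m ^ j * c ^ (m - i) \<le> 7 ^ j * c ^ (7 - i)"
proof -
  have "m - i = (m - 7) + (7 - i)" using assms by simp
  then have "real m ^ j * c ^ (m - i) = real m ^ j * c ^ (m - 7) * c ^ (7 - i)" by (simp only: power_add mult.assoc)
  also have "\<dots> \<le> 7 ^ j * c ^ (7 - i)" using poly_geometric[OF assms(1-3)] assms by (intro mult_right_mono) auto
  finally show ?thesis .
qed

lemma nu_pos: "nu m > 0" by (simp add: nu_def)

lemma nu_le: "m \<ge> 6 \<Longrightarrow> nu m \<le> 3 / 20" by (simp add: nu_def field_simps)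

lemma nu_le7: "m \<ge> 7 \<Longrightarrow> nu m \<le> 21 / 160" by (simp add: nu_def field_simps)

lemma nu6: "nu 6 = 3 / 20" and theta6: "theta 6 = 46656 / 117649" and em6: "em 6 = 46656 / 3125"
  by (simp_all add: nu_def theta_def em_def power_divide)

lemma m_cases: "m \<ge> 6 \<Longrightarrow> m = 6 \<or> m \<ge> (7::nat)" by auto

lemma theta_nu: "m \<ge> 1 \<Longrightarrow> (1 - nu m) ^ m \<le> 20 / 21 * theta m"
  using theta_scaled[of m "1 / 20"] by (simp add: nu_def field_simps)

text \<open>The reciprocal of \<open>1 - nu m\<close> is \<open>1 + 21 / (20 m - 1)\<close>, so the
  reciprocal power is at most \<open>exp (1 + z)\<close> with \<open>z <= 1/17\<close>. The value
  1/3 becomes the share of the maximum \<open>bmax k l\<close> that every \<open>High\<close> vertex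
  is guaranteed to reach.\<close>

lemma nu_power_ge:
  assumes "m \<ge> 6" shows "(1 - nu m) ^ m \<ge> 1 / 3"
proof -
  define z where "z = (real m + 1) / (20 * real m - 1)"
  have m: "real m \<ge> 6" using assms by simp
  have z: "z \<le> 1 / 17" "0 \<le> z" using m by (auto simp: z_def field_simps)
  have "(1 + 21 / (20 * real m - 1)) ^ m \<le> exp (real m * (21 / (20 * real m - 1)))"
    using m by (intro one_plus_power_le_exp) (auto intro: add_nonneg_nonneg)
  also have "real m * (21 / (20 * real m - 1)) = 1 + z" using m by (simp add: z_def field_simps)
  also have "exp (1 + z) \<le> 3"
  proof -
    have "1 - z \<le> exp (- z)" using exp_ge_add_one_self[of "- z"] by simp
    then have "exp z \<le> 1 / (1 - z)" using z by (simp add: exp_minus field_simps)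
    also have "\<dots> \<le> 17 / 16" using z by (simp add: field_simps)
    finally have "exp 1 * exp z \<le> 68 / 25 * (17 / 16)" using exp1_less by (intro mult_mono) auto
    then show ?thesis by (simp add: exp_add)
  qed
  finally have 1: "(1 + 21 / (20 * real m - 1)) ^ m \<le> 3" .
  have "(1 - nu m) * (1 + 21 / (20 * real m - 1)) = 1" proof -
    have "20 * real m - 1 > 0" using m by simp
    then have "1 + 21 / (20 * real m - 1) = 20 * real (m + 1) / (20 * real m - 1)"
      by (simp add: field_simps)
    moreover have "1 - nu m = (20 * real m - 1) / (20 * real (m + 1))"
      using m by (simp add: nu_def field_simps)
    ultimately show ?thesis using m by simp
  qed
  then have "(1 - nu m) ^ m * (1 + 21 / (20 * real m - 1)) ^ m = 1" by (simp add: power_mult_distrib[symmetric])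
  moreover have "0 \<le> (1 - nu m) ^ m" using nu_le[OF assms] by simp
  ultimately have "1 \<le> (1 - nu m) ^ m * 3" using 1 by (metis mult_left_mono)
  then show ?thesis by simp
qed

section \<open>Inequalities behind the degree dichotomy\<close>

text \<open>In all numerical estimates the case \<open>m = 6\<close> is computed exactly, and for \<open>m \<ge> 7\<close> the
  geometrically small terms are estimated by their value at \<open>m = 7\<close>.\<close>

lemma num_high1:
  assumes "m \<ge> 6" shows "(1 - nu m) ^ m + 2 * em m * nu m ^ (m - 1) < theta m"
  using m_cases[OF assms]
proof
  assume "m = 6" then show ?thesis by (simp add: nu6 theta6 em6 power_divide)
next
  assume m: "m \<ge> 7"
  have "2 * em m * nu m ^ (m - 1) \<le> 2 * (68 / 25 * real m) * (21 / 160) ^ (m - 1)"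
    using m nu_le7[OF m] nu_pos[of m] em_nonneg[of m] by (intro mult_mono power_mono em_le) auto
  also have "\<dots> = 136 / 25 * (real m ^ 1 * (21 / 160) ^ (m - 1))" by simp
  also have "\<dots> \<le> 136 / 25 * (7 ^ 1 * (21 / 160) ^ (7 - 1))"
    by (intro mult_left_mono poly_geometric') (use m in auto)
  also have "\<dots> < 1 / 21 * (25 / 68)" by (simp add: power_divide)
  also have "\<dots> \<le> 1 / 21 * theta m" using theta_ge[of m] m by simp
  finally show ?thesis using theta_nu[of m] m by simp
qed

lemma mult_one_minus_mono:
  fixes x y :: real
  assumes "1 / 2 \<le> x" "x \<le> y" "y \<le> 1" "m \<ge> 2"
  shows "y * (1 - y) ^ (m - 1) \<le> x * (1 - x) ^ (m - 1)"
proof -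
  have "y * (1 - y) \<le> x * (1 - x)"
  proof -
    have "0 \<le> (y - x) * (x + y - 1)" using assms by (intro mult_nonneg_nonneg) auto
    then show ?thesis by (simp add: algebra_simps)
  qed
  then have "y * (1 - y) * (1 - y) ^ (m - 2) \<le> x * (1 - x) * (1 - x) ^ (m - 2)"
  proof (rule mult_mono)
    show "(1 - y) ^ (m - 2) \<le> (1 - x) ^ (m - 2)" using assms by (intro power_mono) auto
  qed (use assms in auto)
  moreover have "m - 1 = Suc (m - 2)" using assms by simp
  ultimately show ?thesis by (simp add: mult.assoc)
qed

lemma num_high2:
  assumes "m \<ge> 6" "1 / 2 \<le> \<delta>" "\<delta> \<le> 1 - nu m"
  shows "\<delta> ^ m + em m * (\<delta> * (1 - \<delta>) ^ (m - 1)) < theta m"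
proof -
  have em0: "0 \<le> em m" by (simp add: em_def)
  have d1: "\<delta> \<le> 1" using assms(3) nu_pos[of m] by simp
  show ?thesis
  \<comment> \<open>The first summand increases in \<open>\<delta>\<close> and the second decreases.
    Cutting the interval at 18/25 allows each summand to be taken at its worse end of the
    piece.\<close>
  proof (cases "\<delta> \<le> 18 / 25")
    case True
    have "\<delta> ^ m + em m * (\<delta> * (1 - \<delta>) ^ (m - 1)) \<le> (18/25) ^ m + em m * (1 / 2 * (1 - 1 / 2) ^ (m - 1))"
      using assms True d1 em0 by (intro add_mono power_mono mult_left_mono mult_one_minus_mono) auto
    also have "\<dots> < theta m" using m_cases[OF assms(1)]
    proof
      assume "m = 6" then show ?thesis by (simp add: theta6 em6 power_divide)
    next
      assume m: "m \<ge> 7"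
      have "(18/25) ^ m + em m * (1 / 2 * (1 - 1 / 2) ^ (m - 1)) \<le> (18/25) ^ m + (68 / 25 * real m) * (1 / 2 * (1 - 1 / 2) ^ (m - 1))"
        using m by (intro add_mono mult_right_mono em_le) auto
      also have "\<dots> = (real m ^ 0 * (18/25) ^ (m - 0)) + 34 / 25 * (real m ^ 1 * (1 / 2) ^ (m - 1))" by simp
      also have "\<dots> \<le> 7 ^ 0 * (18/25) ^ (7 - 0) + 34 / 25 * (7 ^ 1 * (1 / 2) ^ (7 - 1))"
        by (intro add_mono mult_left_mono poly_geometric') (use m in auto)
      also have "\<dots> < 25 / 68" by (simp add: power_divide)
      also have "\<dots> \<le> theta m" using theta_ge[of m] m by simp
      finally show ?thesis .
    qed
    finally show ?thesis .
  next
    case False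
    have "\<delta> ^ m + em m * (\<delta> * (1 - \<delta>) ^ (m - 1)) \<le> (1 - nu m) ^ m + em m * (18/25 * (1 - 18/25) ^ (m - 1))"
      using assms False d1 em0 by (intro add_mono power_mono mult_left_mono mult_one_minus_mono) auto
    also have "\<dots> < theta m" using m_cases[OF assms(1)]
    proof
      assume "m = 6" then show ?thesis by (simp add: theta6 em6 nu6 power_divide)
    next
      assume m: "m \<ge> 7"
      have "em m * (18/25 * (1 - 18/25) ^ (m - 1)) \<le> (68 / 25 * real m) * (18/25 * (1 - 18/25) ^ (m - 1))"
        using m by (intro mult_right_mono em_le) auto
      also have "\<dots> = 68 / 25 * (18/25) * (real m ^ 1 * (7/25) ^ (m - 1))" by simp
      also have "\<dots> \<le> 68 / 25 * (18/25) * (7 ^ 1 * (7/25) ^ (7 - 1))"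
        by (intro mult_left_mono poly_geometric') (use m in auto)
      also have "\<dots> < 1 / 21 * (25 / 68)" by (simp add: power_divide)
      also have "\<dots> \<le> 1 / 21 * theta m" using theta_ge[of m] m by simp
      finally show ?thesis using theta_nu[of m] m by simp
    qed
    finally show ?thesis .
  qed
qed

lemma num_low_piece:
  assumes "m \<ge> 6" "0 \<le> a" "a \<le> z" "z \<le> b" "b \<le> 1" "0 \<le> c"
  shows "c ^ m + em m * (z * c ^ (m - 1)) + (1 - z) ^ m \<le> c ^ m + em m * (b * c ^ (m - 1)) + (1 - a) ^ m"
  using assms by (intro add_mono order_refl mult_left_mono mult_right_mono power_mono) (auto simp: em_def)

text \<open>First round of a bootstrap: \<open>z\<close> is the degree of a \<open>Low\<close>
  vertex inside \<open>Low\<close>, and all degrees in \<open>Low\<close> are only known to be below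
  1/2. The range above \<open>7 / (5 (m + 1))\<close> is excluded.\<close>

lemma num_low1:
  assumes "m \<ge> 6" "7 / (5 * real (m + 1)) \<le> z" "z \<le> 1 / 2"
  shows "(1/2) ^ m + em m * (z * (1/2) ^ (m - 1)) + (1 - z) ^ m < theta m"
  using m_cases[OF assms(1)]
proof
  assume m: "m = 6"
  note * = num_low_piece[OF assms(1), where c = "1/2"]
  consider "1/5 \<le> z" "z \<le> 1/4" | "1/4 \<le> z" "z \<le> 7/20" | "7/20 \<le> z" "z \<le> 1/2" using assms(2,3) m by force
  then show ?thesis
  proof cases
    case 1 then show ?thesis using *[of "1/5" z "1/4"] by (simp add: m theta6 em6 power_divide)
  next
    case 2 then show ?thesis using *[of "1/4" z "7/20"] by (simp add: m theta6 em6 power_divide)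
  next
    case 3 then show ?thesis using *[of "7/20" z "1/2"] by (simp add: m theta6 em6 power_divide)
  qed
next
  assume m: "m \<ge> 7"
  have t: "25 / 68 \<le> theta m" using theta_ge[of m] m by simp
  have em: "em m \<le> 68 / 25 * real m" using em_le[of m] m by simp
  define h where "h = (1/2::real) ^ (m - 1)"
  have half: "(1/2::real) ^ m = 1/2 * h" using m by (simp add: h_def flip: power_Suc)
  have "real m ^ 1 * h \<le> 7 ^ 1 * (1/2) ^ (7 - 1)"
    unfolding h_def by (rule poly_geometric') (use m in auto)
  then have pg: "real m * h \<le> 7 / 64" by (simp add: power_divide)
  have "real m ^ 0 * h \<le> 7 ^ 0 * (1/2) ^ (7 - 1)"
    unfolding h_def by (rule poly_geometric') (use m in auto)
  then have pg0: "h \<le> 1 / 64" by (simp add: power_divide)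
  show ?thesis
  proof (cases "z \<le> 3/10")
    case True
    have "(1/2) ^ m + em m * (z * (1/2) ^ (m - 1)) + (1 - z) ^ m
      \<le> (1/2) ^ m + em m * (3/10 * (1/2) ^ (m - 1)) + (1 - 7 / (5 * real (m + 1))) ^ m"
      using assms True by (intro num_low_piece) auto
    moreover have "em m * (3/10 * (1/2) ^ (m - 1)) \<le> (68 / 25 * real m) * (3/10 * (1/2) ^ (m - 1))"
      by (intro mult_right_mono em) auto
    moreover have "(1 - 7 / (5 * real (m + 1))) ^ m \<le> 5 / 7 * theta m"
      using theta_scaled[of m "2/5"] m by (simp add: field_simps)
    ultimately show ?thesis using t pg pg0 unfolding h_def[symmetric] half by linarith
  next
    case False
    have "(1/2) ^ m + em m * (z * (1/2) ^ (m - 1)) + (1 - z) ^ m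
      \<le> (1/2) ^ m + em m * (1/2 * (1/2) ^ (m - 1)) + (1 - 3/10) ^ m"
      using assms False by (intro num_low_piece) auto
    moreover have "em m * (1/2 * (1/2) ^ (m - 1)) \<le> (68 / 25 * real m) * (1/2 * (1/2) ^ (m - 1))"
      by (intro mult_right_mono em) auto
    moreover have "(1 - 3/10 :: real) ^ m \<le> 1/10"
    proof -
      have "(7/10::real) ^ m \<le> (7/10) ^ 7" by (rule power_decreasing[OF m]) auto
      also have "\<dots> \<le> 1/10" by (simp add: power_divide)
      finally show ?thesis by simp
    qed
    ultimately show ?thesis using t pg pg0 unfolding h_def[symmetric] half by linarith
  qed
qed

text \<open>Second round: after the first, degrees in \<open>Low\<close> are at most
  \<open>nu m + 7 / (5 (m + 1)) = 49 / (20 (m + 1))\<close>, and this better bound excludes the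
  remaining range above \<open>nu m\<close>.\<close>

lemma num_low2:
  assumes "m \<ge> 6" "nu m \<le> z" "z \<le> 7 / (5 * real (m + 1))"
  shows "(49 / (20 * real (m + 1))) ^ m + em m * (z * (49 / (20 * real (m + 1))) ^ (m - 1)) + (1 - z) ^ m < theta m"
    (is "?c ^ m + _ + _ < _")
proof -
  have b: "7 / (5 * real (m + 1)) \<le> 1" using assms(1) by (simp add: field_simps)
  have 1: "?c ^ m + em m * (z * ?c ^ (m - 1)) + (1 - z) ^ m
      \<le> ?c ^ m + em m * (7 / (5 * real (m + 1)) * ?c ^ (m - 1)) + (1 - nu m) ^ m"
    by (rule num_low_piece) (use assms nu_pos[of m] b in auto)
  show ?thesis using m_cases[OF assms(1)]
  proof
    assume "m = 6" then show ?thesis using 1 by (simp add: nu6 theta6 em6 power_divide)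
  next
    assume m: "m \<ge> 7"
    have t: "25 / 68 \<le> theta m" using theta_ge[of m] m by simp
    have c: "?c \<le> 49 / 160" by (rule divide_left_mono) (use m in auto)
    have "em m * (7 / (5 * real (m + 1))) \<le> (68 / 25 * real m) * (7 / (5 * real (m + 1)))"
      using m by (intro mult_right_mono em_le) auto
    also have "\<dots> \<le> 4" using m by (simp add: field_simps)
    finally have "em m * (7 / (5 * real (m + 1))) * ?c ^ (m - 1) \<le> 4 * ?c ^ (m - 1)" by (intro mult_right_mono) auto
    moreover have "?c ^ m = ?c * ?c ^ (m - 1)" using m by (simp flip: power_Suc)
    moreover have "?c \<le> 1" using c by linarith
    then have "?c * ?c ^ (m - 1) \<le> 1 * ?c ^ (m - 1)" by (rule mult_right_mono) simp
    ultimately have "?c ^ m + em m * (7 / (5 * real (m + 1)) * ?c ^ (m - 1)) \<le> 5 * ?c ^ (m - 1)"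
      by (simp add: mult.assoc)
    also have "\<dots> \<le> 5 * (49/160) ^ (m - 1)" by (intro mult_left_mono power_mono c) (simp_all add: divide_nonneg_pos)
    also have "\<dots> = 5 * (real m ^ 0 * (49/160) ^ (m - 1))" by simp
    also have "\<dots> \<le> 5 * (7 ^ 0 * (49/160) ^ (7 - 1))"
      by (intro mult_left_mono poly_geometric') (use m in auto)
    also have "\<dots> < 1 / 21 * (25 / 68)" by (simp add: power_divide)
    finally show ?thesis using 1 t theta_nu[of m] m by linarith
  qed
qed

text \<open>On the left stands what stars with leaves on both sides can contribute per nonadjacent
  pair between \<open>High\<close> and \<open>Low\<close>; on the right a lower bound for the budget
  of such a pair, as \<open>bmax k l >= 2^-m\<close>.\<close>

lemma num_mixed:
  assumes "m \<ge> 6" shows "real m ^ 2 * nu m ^ (m - 2) \<le> (real m / 3 - 1 / 2) * (1 / 2) ^ m"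
  using m_cases[OF assms]
proof
  assume "m = 6" then show ?thesis by (simp add: nu6 power_divide)
next
  assume m: "m \<ge> 7"
  have half: "(1/2::real) ^ m = 1/4 * (1/2) ^ (m - 2)"
  proof -
    have "m = Suc (Suc (m - 2))" using m by simp
    then have "(1/2::real) ^ m = (1/2) ^ Suc (Suc (m - 2))" by metis
    then show ?thesis by simp
  qed
  have "real m ^ 2 * nu m ^ (m - 2) \<le> real m ^ 2 * (21/160) ^ (m - 2)"
    using nu_le7[OF m] nu_pos[of m] by (intro mult_left_mono power_mono) auto
  also have "(21/160::real) ^ (m - 2) = (21/80) ^ (m - 2) * (1/2) ^ (m - 2)" by (simp add: power_mult_distrib[symmetric])
  also have "real m ^ 2 * \<dots> = (real m ^ 2 * (21/80) ^ (m - 2)) * (1/2) ^ (m - 2)" by simp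
  also have "\<dots> \<le> (7 ^ 2 * (21/80) ^ (7 - 2)) * (1/2) ^ (m - 2)"
    by (intro mult_right_mono poly_geometric') (use m in \<open>auto simp: power2_eq_square\<close>)
  also have "\<dots> \<le> ((real m / 3 - 1 / 2) * (1/4)) * (1/2) ^ (m - 2)"
    using m by (intro mult_right_mono) (auto simp: power_divide)
  finally show ?thesis by (simp only: half mult.assoc)
qed

section \<open>Inequalities for the density of \<open>High\<close> and for the balances of gains and
  losses\<close>

lemma exp_window:
  fixes q :: real assumes "0 \<le> q" "q \<le> 1" shows "(1 - q) * exp q \<le> 1 - q\<^sup>2 / 2"
proof -
  let ?g = "\<lambda>q::real. (1 - q) * exp q + q\<^sup>2 / 2"
  have "?g q \<le> ?g 0"
  proof (rule DERIV_nonpos_imp_nonincreasing[OF assms(1)])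
    fix x :: real assume x: "0 \<le> x" "x \<le> q"
    have "(?g has_real_derivative (x - x * exp x)) (at x)"
      by (auto intro!: derivative_eq_intros simp: algebra_simps)
    moreover have "x - x * exp x \<le> 0" using x mult_left_mono[of 1 "exp x" x] by simp
    ultimately show "\<exists>y. (?g has_real_derivative y) (at x) \<and> y \<le> 0" by blast
  qed
  then show ?thesis by simp
qed

lemma nu_poly7:
  assumes "m \<ge> 7" shows "real m ^ 2 * real (m + 1) * nu m ^ (m - 1) \<le> 1 / 450"
proof -
  have "real m ^ 2 * real (m + 1) * nu m ^ (m - 1) \<le> real m ^ 2 * (8 / 7 * real m) * (21/160) ^ (m - 1)"
    using nu_le7[OF assms] nu_pos[of m] assms by (intro mult_mono power_mono) auto
  also have "\<dots> = 8 / 7 * (real m ^ 3 * (21/160) ^ (m - 1))" by (simp add: power3_eq_cube power2_eq_square)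
  also have "\<dots> \<le> 8 / 7 * (7 ^ 3 * (21/160) ^ (7 - 1))"
    by (intro mult_left_mono poly_geometric') (use assms in \<open>auto simp: power3_eq_cube\<close>)
  also have "\<dots> \<le> 1 / 450" by (simp add: power_divide)
  finally show ?thesis .
qed

lemma nu_power_pred: "m \<ge> 1 \<Longrightarrow> nu m ^ m = nu m * nu m ^ (m - 1)"
  by (simp flip: power_Suc)

text \<open>Bounds the density \<open>\<alpha>\<close> of \<open>High\<close> from below. With
  \<open>q\<close> the relative deficit of \<open>\<alpha>\<close> against
  \<open>1 / (m + 1)\<close>, the main term is at most \<open>(1 - q) exp q <= 1 - q^2 / 2\<close>
  times its maximum; this loss, of relative order \<open>1 / m^2\<close>, exceeds
  \<open>2 nu m ^ m\<close>.\<close>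

lemma num_window:
  assumes "m \<ge> 6" "0 \<le> \<alpha>" "\<alpha> < (1 - 1 / (3 * real m)) / real (m + 1)"
  shows "\<alpha> * (1 - \<alpha>) ^ m + 2 * nu m ^ m < theta m / real (m + 1)"
proof -
  define q where "q = 1 - \<alpha> * real (m + 1)"
  have "\<alpha> * real (m + 1) < 1 - 1 / (3 * real m)" using assms(3) by (simp only: pos_less_divide_eq of_nat_0_less_iff add_gr_0 zero_less_one simp_thms)
  then have q: "1 / (3 * real m) < q" "q \<le> 1" using assms(2) by (auto simp: q_def)
  then have q0: "0 < q" using assms(1) by (meson divide_pos_pos less_trans mult_pos_pos of_nat_0_less_iff zero_less_numeral zero_less_one less_le_trans)
  have a: "\<alpha> = (1 - q) / real (m + 1)" by (simp add: q_def)
  have "1 - \<alpha> = real m / real (m + 1) * (1 + q / real m)"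
  proof -
    have "real m / real (m + 1) * (1 + q / real m) = (real (m + 1) - (1 - q)) / real (m + 1)"
      using assms(1) by (simp add: distrib_left flip: add_divide_distrib)
    also have "\<dots> = real (m + 1) / real (m + 1) - \<alpha>" unfolding a by (rule diff_divide_distrib)
    finally show ?thesis by simp
  qed
  then have "(1 - \<alpha>) ^ m = theta m * (1 + q / real m) ^ m" by (simp only: theta_def power_mult_distrib)
  then have "\<alpha> * (1 - \<alpha>) ^ m = theta m / real (m + 1) * ((1 - q) * (1 + q / real m) ^ m)"
    by (simp add: a)
  also have "\<dots> \<le> theta m / real (m + 1) * ((1 - q) * exp (real m * (q / real m)))"
    using q q0 by (intro mult_left_mono one_plus_power_le_exp) (auto simp: theta_def intro: add_nonneg_nonneg)
  also have "real m * (q / real m) = q" using assms(1) by simp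
  also have "theta m / real (m + 1) * ((1 - q) * exp q) \<le> theta m / real (m + 1) * (1 - q\<^sup>2 / 2)"
    using q q0 by (intro mult_left_mono exp_window) (auto simp: theta_def)
  also have "\<dots> \<le> theta m / real (m + 1) * (1 - 1 / (18 * real m ^ 2))"
  proof -
    have "(1 / (3 * real m))\<^sup>2 \<le> q\<^sup>2" using q by (intro power_mono) auto
    then show ?thesis by (intro mult_left_mono) (auto simp: theta_def power_divide power_mult_distrib)
  qed
  also have "\<dots> < theta m / real (m + 1) - 2 * nu m ^ m"
  proof -
    have "2 * nu m ^ m < theta m / real (m + 1) * (1 / (18 * real m ^ 2))"
      using m_cases[OF assms(1)]
    proof
      assume "m = 6" then show ?thesis by (simp add: nu6 theta6 power_divide)
    next
      assume m: "m \<ge> 7"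
      have "real m ^ 2 * real (m + 1) * nu m ^ m = nu m * (real m ^ 2 * real (m + 1) * nu m ^ (m - 1))"
        using m by (simp add: nu_power_pred)
      also have "\<dots> \<le> 21 / 160 * (1 / 450)" using nu_poly7[OF m] nu_le7[OF m] nu_pos[of m] by (intro mult_mono) auto
      finally have "36 * (real m ^ 2 * real (m + 1) * nu m ^ m) < 25 / 68" by simp
      then have "36 * (real m ^ 2 * real (m + 1) * nu m ^ m) < theta m" using theta_ge[of m] m by simp
      moreover define M where "M = real (m + 1)"
      moreover have "M > 0" by (simp add: M_def)
      ultimately have "2 * nu m ^ m < theta m / (M * (18 * real m ^ 2))"
        using m by (subst pos_less_divide_eq) (auto simp: mult_ac)
      then show ?thesis by (simp add: M_def)
    qed
    then show ?thesis by (simp add: algebra_simps)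
  qed
  finally show ?thesis by simp
qed

lemma num_alpha:
  assumes "m \<ge> 6" shows "6 * nu m ^ (m - 1) \<le> (1 - 1 / (3 * real m)) / real (m + 1)"
  using m_cases[OF assms]
proof
  assume "m = 6" then show ?thesis by (simp add: nu6 power_divide)
next
  assume m: "m \<ge> 7"
  define M where "M = real (m + 1)"
  have M: "M > 0" by (simp add: M_def)
  have "1 * (M * nu m ^ (m - 1)) \<le> real m ^ 2 * (M * nu m ^ (m - 1))"
    using m nu_pos[of m] M by (intro mult_right_mono) auto
  also have "\<dots> \<le> 1 / 450" using nu_poly7[OF m] by (simp only: M_def mult.assoc)
  finally have "6 * (M * nu m ^ (m - 1)) \<le> 1 / 2" by simp
  also have "1 / 2 \<le> 1 - 1 / (3 * real m)" using m by (simp add: field_simps)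
  finally show ?thesis using M unfolding M_def[symmetric] by (simp add: pos_le_divide_eq mult_ac)
qed

lemma num_spread:
  assumes "m \<ge> 6" shows "54 * real m ^ 2 * nu m ^ m \<le> (1 - 1 / (3 * real m)) / real (m + 1) / 3"
  using m_cases[OF assms]
proof
  assume "m = 6" then show ?thesis by (simp add: nu6 power_divide)
next
  assume m: "m \<ge> 7"
  define M where "M = real (m + 1)"
  have M: "M > 0" by (simp add: M_def)
  have "real m ^ 2 * real (m + 1) * nu m ^ m = nu m * (real m ^ 2 * real (m + 1) * nu m ^ (m - 1))"
    using m by (simp add: nu_power_pred)
  also have "\<dots> \<le> 21 / 160 * (1 / 450)" using nu_poly7[OF m] nu_le7[OF m] nu_pos[of m] by (intro mult_mono) auto
  finally have "54 * 3 * (real m ^ 2 * real (m + 1) * nu m ^ m) \<le> 1 / 2" by simp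
  also have "1 / 2 \<le> 1 - 1 / (3 * real m)" using m by (simp add: field_simps)
  finally have "54 * 3 * (real m ^ 2 * M * nu m ^ m) \<le> 1 - 1 / (3 * real m)" unfolding M_def .
  then show ?thesis using M unfolding M_def[symmetric] by (simp add: pos_le_divide_eq mult_ac)
qed

lemma num_ratio:
  assumes "m \<ge> 6"
  shows "(1 + 1 / (3 * real m ^ 2)) * (1 + 1 / (2 * real m))
    \<le> (1 + 7 / (6 * real m)) * (1 - 1 / (6 * real m)) * (1 - 1 / (3 * real m))"
proof -
  define x where "x = 1 / real m"
  have x: "0 < x" "x \<le> 1 / 6" using assms by (auto simp: x_def)
  have "0 \<le> x * (1 / 6 - x * (31 / 36) - x\<^sup>2 * (11 / 108))"
  proof (intro mult_nonneg_nonneg)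
    have "x * (31/36) \<le> 1 / 6 * (31/36)" "x\<^sup>2 \<le> (1/6)\<^sup>2" using x by (auto intro: power_mono)
    then show "0 \<le> 1 / 6 - x * (31 / 36) - x\<^sup>2 * (11 / 108)" by (simp add: power2_eq_square)
  qed (use x in auto)
  then have "(1 + x\<^sup>2 / 3) * (1 + x / 2) \<le> (1 + 7 * x / 6) * (1 - x / 6) * (1 - x / 3)"
    by (simp add: field_simps power2_eq_square)
  then show ?thesis by (simp add: x_def power_divide mult.commute)
qed

lemma num_W:
  assumes "m \<ge> 6"
  shows "(1 + 7 / (6 * real m)) ^ m / em m \<le> 1 / 2 * (1 - (1 + em (m - 1)) / (6 * real m))"
  using m_cases[OF assms]
proof
  assume "m = 6" then show ?thesis by (simp add: em_def power_divide)
next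
  assume m: "m \<ge> 7"
  have "(1 + 7 / (6 * real m)) ^ m \<le> exp (real m * (7 / (6 * real m)))"
    by (rule one_plus_power_le_exp) simp
  also have "\<dots> = exp 1 * exp (1 / 6)" using m by (simp add: exp_add[symmetric])
  also have "exp (1 / 6 :: real) \<le> 6 / 5"
  proof -
    have "1 - 1 / 6 \<le> exp (- (1 / 6 :: real))" using exp_ge_add_one_self[of "- (1/6) :: real"] by simp
    then show ?thesis by (simp add: exp_minus field_simps)
  qed
  then have "exp 1 * exp (1 / 6) \<le> 68 / 25 * (6 / 5 :: real)" using exp1_less by (intro mult_mono) auto
  finally have 1: "(1 + 7 / (6 * real m)) ^ m \<le> 408 / 125" by simp
  have "(1 + 7 / (6 * real m)) ^ m / em m \<le> (408 / 125) / (2 * real m)"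
    using 1 em_ge[of m] m by (intro frac_le) auto
  also have "\<dots> \<le> (408 / 125) / 14" using m by (intro divide_left_mono) auto
  also have "\<dots> \<le> 1 / 2 * (1 - 68 / 150)" by simp
  also have "\<dots> \<le> 1 / 2 * (1 - (1 + em (m - 1)) / (6 * real m))"
  proof -
    have "em (m - 1) \<le> 68 / 25 * real (m - 1)" by (rule em_le) (use m in simp)
    then have "1 + em (m - 1) \<le> 68 / 25 * real m" using m by (simp add: of_nat_diff)
    then have "(1 + em (m - 1)) / (6 * real m) \<le> 68 / 150" using m by (simp add: field_simps)
    then show ?thesis by simp
  qed
  finally show ?thesis .
qed

lemma num_outside_W:
  assumes "m \<ge> 6"
  shows "(1 + 1 / em m) * nu m ^ (m - 1)
    \<le> (1 - nu m) ^ m * (1 / em m) * ((1 - 1 / (3 * real m)) / real (m + 1)) * (1 / (6 * real m))"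
  using m_cases[OF assms]
proof
  assume "m = 6" then show ?thesis by (simp add: nu6 em6 power_divide)
next
  assume m: "m \<ge> 7"
  define M where "M = real (m + 1)"
  have M: "M > 0" by (simp add: M_def)
  have em: "2 * real m \<le> em m" "em m \<le> 68 / 25 * real m" using em_ge[of m] em_le[of m] m by auto
  then have em0: "0 < em m" using m by simp
  have "(em m + 1) * real m * M * nu m ^ (m - 1) \<le> (3 * real m) * real m * M * nu m ^ (m - 1)"
    using em m nu_pos[of m] M by (intro mult_right_mono) auto
  also have "\<dots> = 3 * (real m ^ 2 * M * nu m ^ (m - 1))" by (simp add: power2_eq_square)
  also have "\<dots> \<le> 1 / 150" using nu_poly7[OF m] unfolding M_def[symmetric] by simp
  also have "\<dots> \<le> 1 / 6 * (1 / 3 * (1 / 2))" by simp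
  also have "\<dots> \<le> 1 / 6 * ((1 - nu m) ^ m * (1 - 1 / (3 * real m)))"
  proof (intro mult_left_mono mult_mono)
    show "1 / 2 \<le> 1 - 1 / (3 * real m)" using m by (simp add: field_simps)
    show "1 / 3 \<le> (1 - nu m) ^ m" using nu_power_ge[OF assms] .
  qed (use nu_le[OF assms] in auto)
  finally have "(em m + 1) * real m * M * nu m ^ (m - 1) \<le> 1 / 6 * ((1 - nu m) ^ m * (1 - 1 / (3 * real m)))" .
  then have "(em m + 1) * nu m ^ (m - 1) \<le> 1 / 6 * ((1 - nu m) ^ m * (1 - 1 / (3 * real m))) / (real m * M)"
    using m M by (simp add: pos_le_divide_eq mult_ac)
  then have "(em m + 1) * nu m ^ (m - 1) / em m \<le> 1 / 6 * ((1 - nu m) ^ m * (1 - 1 / (3 * real m))) / (real m * M) / em m"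
    using em0 by (intro divide_right_mono) auto
  moreover have "(1 + 1 / em m) * nu m ^ (m - 1) = (em m + 1) * nu m ^ (m - 1) / em m" using em0 by (simp add: field_simps)
  ultimately show ?thesis unfolding M_def[symmetric] by (simp add: mult_ac)
qed

text \<open>Only the average of the defect \<open>1 - w exp (1 - w)\<close> will be known, so a
  bound for \<open>w\<close> that is linear in the defect is required. Just above
  \<open>w = 1\<close> the defect is quadratic in \<open>w - 1\<close>; completing a square trades
  it for a linear bound at the price \<open>1 / (6 M)\<close>.\<close>

lemma num_spread_exp:
  fixes w M :: real
  assumes "0 \<le> w" "w \<le> M" "1 \<le> M"
  shows "w \<le> 1 + 1 / (6 * M) + 9 * M * (1 - w * exp (1 - w))"
proof (cases "w \<le> 1")
  case True
  have "w * exp (1 - w) \<le> 1"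
  proof -
    have "w \<le> exp (w - 1)" using exp_ge_add_one_self[of "w - 1"] by simp
    then show ?thesis by (simp add: exp_diff field_simps)
  qed
  then have "0 \<le> 9 * M * (1 - w * exp (1 - w))" using assms by (intro mult_nonneg_nonneg) auto
  moreover have "0 \<le> 1 / (6 * M)" using assms by simp
  ultimately show ?thesis using True by linarith
next
  case False
  define u where "u = w - 1"
  have u: "0 < u" "w = 1 + u" using False by (auto simp: u_def)
  have e: "1 + u + u\<^sup>2 / 2 \<le> exp u" using exp_lower_Taylor_quadratic[of u] u by simp
  have "w * exp (1 - w) = (1 + u) / exp u" by (simp add: u exp_minus field_simps)
  also have "\<dots> \<le> (1 + u) / (1 + u + u\<^sup>2 / 2)" using e u by (intro divide_left_mono) (auto intro!: mult_pos_pos add_pos_pos)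
  also have "\<dots> = ((1 + u + u\<^sup>2 / 2) - u\<^sup>2 / 2) / (1 + u + u\<^sup>2 / 2)" by simp
  also have "\<dots> = 1 - (u\<^sup>2 / 2) / (1 + u + u\<^sup>2 / 2)"
    using u by (subst diff_divide_distrib) (simp add: add_pos_pos less_imp_neq[symmetric])
  finally have 1: "1 - w * exp (1 - w) \<ge> (u\<^sup>2 / 2) / (1 + u + u\<^sup>2 / 2)" by linarith
  show ?thesis
  proof (cases "u \<le> 1")
    case True
    have "u\<^sup>2 \<le> 1" using True u by (simp add: power_le_one)
    then have "(u\<^sup>2 / 2) / (5 / 2) \<le> (u\<^sup>2 / 2) / (1 + u + u\<^sup>2 / 2)"
      using u True by (intro divide_left_mono) (auto intro!: mult_pos_pos add_pos_pos)
    then have "(u\<^sup>2 / 2) / (5 / 2) \<le> 1 - w * exp (1 - w)" using 1 by linarith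
    then have "u\<^sup>2 / 5 \<le> 1 - w * exp (1 - w)" by simp
    then have "9 * M * (u\<^sup>2 / 5) \<le> 9 * M * (1 - w * exp (1 - w))"
      using assms(3) by (intro mult_left_mono) auto
    moreover have "u \<le> 1 / (6 * M) + 9 * M * (u\<^sup>2 / 5)"
    proof -
      have "0 \<le> (u - 1 / (3 * M))\<^sup>2 * (3 * M / 2)" using assms by simp
      also have "\<dots> = 3 * M / 2 * u\<^sup>2 - u + 1 / (6 * M)"
        using assms by (simp add: power2_eq_square field_simps)
      also have "\<dots> \<le> 9 * M * (u\<^sup>2 / 5) - u + 1 / (6 * M)" using assms by simp
      finally show ?thesis by simp
    qed
    ultimately show ?thesis using u by linarith
  next
    case False
    have "1 / 9 \<le> (u\<^sup>2 / 2) / (1 + u + u\<^sup>2 / 2)"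
    proof -
      have "u \<le> u\<^sup>2" using False by (simp add: power2_eq_square)
      moreover have "1 \<le> u\<^sup>2" using False by simp
      ultimately have "1 + u + u\<^sup>2 / 2 \<le> 9 * (u\<^sup>2 / 2)" by simp
      then show ?thesis using u by (simp add: pos_le_divide_eq add_pos_pos)
    qed
    then have "1 / 9 \<le> 1 - w * exp (1 - w)" using 1 by linarith
    then have "9 * M * (1 / 9) \<le> 9 * M * (1 - w * exp (1 - w))" using assms by (intro mult_left_mono) auto
    then have "M \<le> 9 * M * (1 - w * exp (1 - w))" by simp
    moreover have "0 \<le> 1 / (6 * M)" using assms by simp
    ultimately show ?thesis using assms by linarith
  qed
qed

section \<open>Counting stars\<close>

lemma prod_split:
  fixes g :: "nat \<Rightarrow> real" and k l :: nat
  shows "(\<Prod>i\<in>{0..k+l}. g i) = g 0 * (\<Prod>i\<in>{1..k}. g i) * (\<Prod>i\<in>{k+1..k+l}. g i)"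
proof -
  have "{0..k+l} = insert 0 ({1..k} \<union> {k+1..k+l})" by auto
  then have "(\<Prod>i\<in>{0..k+l}. g i) = (\<Prod>i\<in>insert 0 ({1..k} \<union> {k+1..k+l}). g i)" by metis
  also have "\<dots> = g 0 * (\<Prod>i\<in>{1..k} \<union> {k+1..k+l}. g i)" by (subst prod.insert) auto
  also have "\<dots> = g 0 * ((\<Prod>i\<in>{1..k}. g i) * (\<Prod>i\<in>{k+1..k+l}. g i))"
    by (subst prod.union_disjoint) auto
  finally show ?thesis by (simp add: mult.assoc)
qed

locale star_graph =
  fixes k l n :: nat and E :: "(nat \<times> nat) set"
  assumes kl: "l \<le> k" "1 \<le> l" "6 \<le> k + l"
    and n_pos: "1 \<le> n"
    and E_sub: "E \<subseteq> {0..<n} \<times> {0..<n}"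
    and loopless: "\<And>x. (x, x) \<notin> E"
begin

definition nb :: "nat \<Rightarrow> nat set" where
  "nb v = {u. (u, v) \<in> E \<or> (v, u) \<in> E}"

text \<open>Pairs joined in both directions are excluded: the copy of the star is induced, so no
  2-cycle joins its centre to a leaf. \<open>nb\<close> keeps them, since they too prevent two
  vertices from being leaves of the same star.\<close>

definition Out :: "nat \<Rightarrow> nat set" where
  "Out v = {u. (v, u) \<in> E \<and> (u, v) \<notin> E}"

definition In :: "nat \<Rightarrow> nat set" where
  "In v = {u. (u, v) \<in> E \<and> (v, u) \<notin> E}"

definition stars :: "(nat \<Rightarrow> nat) set" where
  "stars = {\<phi> \<in> star_verts k l \<rightarrow>\<^sub>E {0..<n}. star_iso k l E \<phi>}"

definition dens :: "nat set \<Rightarrow> real" where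
  "dens S = real (card S) / real n"

definition cstars :: "nat \<Rightarrow> nat set \<Rightarrow> real" where
  "cstars c Z = real (card {\<phi> \<in> stars. \<phi> 0 = c \<and> (\<forall>i\<in>{1..k+l}. \<phi> i \<in> Z)}) / real n ^ (k + l)"

lemma nb_sub: "nb v \<subseteq> {0..<n}"
  and Out_sub: "Out v \<subseteq> nb v" and In_sub: "In v \<subseteq> nb v"
  and Out_In_disj: "Out v \<inter> In v = {}"
  and nb_sym: "u \<in> nb v \<longleftrightarrow> v \<in> nb u"
  and Out_iff_In: "u \<in> Out v \<longleftrightarrow> v \<in> In u"
  using E_sub by (auto simp: nb_def Out_def In_def)

lemma finite_nb [simp]: "finite (nb v)"
  using finite_subset[OF nb_sub] by blast

lemma finite_Out [simp]: "finite (Out v)" and finite_In [simp]: "finite (In v)"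
  using finite_subset[OF Out_sub] finite_subset[OF In_sub] by auto

lemma finite_stars: "finite stars"
  by (rule finite_subset[of _ "star_verts k l \<rightarrow>\<^sub>E {0..<n}"])
    (auto simp: stars_def star_verts_def intro!: finite_PiE)

lemma stars_PiE: "\<phi> \<in> stars \<Longrightarrow> \<phi> \<in> {0..k+l} \<rightarrow>\<^sub>E {0..<n}"
  by (auto simp: stars_def star_verts_def)

lemma stars_V: "\<phi> \<in> stars \<Longrightarrow> i \<le> k + l \<Longrightarrow> \<phi> i \<in> {0..<n}"
  using stars_PiE by fastforce

lemma stars_arc:
  assumes "\<phi> \<in> stars" "u \<le> k + l" "v \<le> k + l"
  shows "(\<phi> u, \<phi> v) \<in> E \<longleftrightarrow> star_arc k l u v"
  using assms by (auto simp: stars_def star_iso_def star_verts_def)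

lemma stars_inj: "\<phi> \<in> stars \<Longrightarrow> inj_on \<phi> {0..k+l}"
  by (auto simp: stars_def star_iso_def star_verts_def)

lemma stars_Out:
  assumes "\<phi> \<in> stars" "i \<in> {1..k}" shows "\<phi> i \<in> Out (\<phi> 0)"
  using assms stars_arc[of \<phi> 0 i] stars_arc[of \<phi> i 0] by (auto simp: Out_def star_arc_def)

lemma stars_In:
  assumes "\<phi> \<in> stars" "i \<in> {k+1..k+l}" shows "\<phi> i \<in> In (\<phi> 0)"
  using assms stars_arc[of \<phi> 0 i] stars_arc[of \<phi> i 0] by (auto simp: In_def star_arc_def)

lemma stars_nb:
  assumes "\<phi> \<in> stars" "i \<in> {1..k+l}" shows "\<phi> i \<in> nb (\<phi> 0)"
  using stars_Out[OF assms(1), of i] stars_In[OF assms(1), of i] assms(2) Out_sub In_sub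
  by (cases "i \<le> k") (auto simp: subset_iff)

lemma stars_leaf:
  assumes "\<phi> \<in> stars" "i \<in> {1..k+l}" "j \<in> {1..k+l}"
  shows "\<phi> i \<notin> nb (\<phi> j)"
  using assms stars_arc[of \<phi> i j] stars_arc[of \<phi> j i] by (auto simp: nb_def star_arc_def)

lemma card_le_prod:
  fixes A :: "nat \<Rightarrow> nat set"
  assumes "F \<subseteq> stars" "\<And>\<phi> i. \<phi> \<in> F \<Longrightarrow> i \<le> k + l \<Longrightarrow> \<phi> i \<in> A i" "\<And>i. i \<le> k + l \<Longrightarrow> finite (A i)"
  shows "real (card F) \<le> (\<Prod>i\<in>{0..k+l}. real (card (A i)))"
proof -
  have "F \<subseteq> Pi\<^sub>E {0..k+l} A"
    using assms(1,2) stars_PiE by (fastforce simp: PiE_iff)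
  then have "card F \<le> card (Pi\<^sub>E {0..k+l} A)"
    by (intro card_mono finite_PiE) (use assms(3) in auto)
  then show ?thesis by (simp add: card_PiE flip: of_nat_prod)
qed

text \<open>Nonadjacency of the leaves is dropped, so that the leaves are chosen
  independently.\<close>

lemma cstars0:
  assumes "finite Z"
  shows "cstars c Z \<le> dens (Out c \<inter> Z) ^ k * dens (In c \<inter> Z) ^ l"
proof -
  define A where "A i = (if i = 0 then {c} else if i \<le> k then Out c \<inter> Z else In c \<inter> Z)" for i :: nat
  let ?F = "{\<phi> \<in> stars. \<phi> 0 = c \<and> (\<forall>i\<in>{1..k+l}. \<phi> i \<in> Z)}"
  have "real (card ?F) \<le> (\<Prod>i\<in>{0..k+l}. real (card (A i)))"
  proof (rule card_le_prod)
    fix \<phi> i assume *: "\<phi> \<in> ?F" "i \<le> k + l"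
    then show "\<phi> i \<in> A i" using stars_Out[of \<phi> i] stars_In[of \<phi> i] by (auto simp: A_def)
  qed (use assms in \<open>auto simp: A_def\<close>)
  also have "\<dots> = real (card (Out c \<inter> Z)) ^ k * real (card (In c \<inter> Z)) ^ l"
    unfolding prod_split by (simp add: A_def)
  finally show ?thesis
    using n_pos by (simp add: cstars_def dens_def power_divide power_add divide_right_mono)
qed

text \<open>Fixing one leaf removes its neighbourhood from the choices for the other leaves.\<close>

lemma card_fix_leaf:
  assumes "F \<subseteq> stars" "finite Z" "i0 \<in> {1..k+l}"
    and "\<And>\<phi>. \<phi> \<in> F \<Longrightarrow> \<phi> 0 = c \<and> \<phi> i0 = b \<and> (\<forall>i\<in>{1..k+l}. \<phi> i \<in> Z)"
  shows "real (card F) / real n ^ (k + l - 1) \<le>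
    (if i0 \<le> k then dens (Out c \<inter> Z - nb b) ^ (k - 1) * dens (In c \<inter> Z - nb b) ^ l
     else dens (Out c \<inter> Z - nb b) ^ k * dens (In c \<inter> Z - nb b) ^ (l - 1))"
proof -
  define A where "A i = (if i = 0 then {c} else if i = i0 then {b} else if i \<le> k then Out c \<inter> Z - nb b
    else In c \<inter> Z - nb b)" for i :: nat
  have 1: "real (card F) \<le> (\<Prod>i\<in>{0..k+l}. real (card (A i)))"
  proof (rule card_le_prod)
    fix \<phi> i assume *: "\<phi> \<in> F" "i \<le> k + l"
    then have "\<phi> \<in> stars" using assms(1) by auto
    then show "\<phi> i \<in> A i"
      using assms(4)[OF *(1)] * stars_Out[of \<phi> i] stars_In[of \<phi> i] stars_leaf[of \<phi> i i0] assms(3)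
      by (auto simp: A_def)
  qed (use assms in \<open>auto simp: A_def\<close>)
  have s: "{1..k} = insert i0 ({1..k} - {i0})" if "i0 \<le> k" using that assms(3) by auto
  have s': "{k+1..k+l} = insert i0 ({k+1..k+l} - {i0})" if "\<not> i0 \<le> k" using that assms(3) by auto
  show ?thesis
  proof (cases "i0 \<le> k")
    case True
    have "(\<Prod>i\<in>{1..k}. real (card (A i))) = real (card (A i0)) * (\<Prod>i\<in>{1..k}-{i0}. real (card (A i)))"
      by (subst s[OF True], subst prod.insert) auto
    also have "\<dots> = real (card (Out c \<inter> Z - nb b)) ^ (k - 1)"
      using assms(3) True by (simp add: A_def)
    finally have "real (card F) \<le> real (card (Out c \<inter> Z - nb b)) ^ (k - 1) * real (card (In c \<inter> Z - nb b)) ^ l"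
      using 1 unfolding prod_split using True assms(3) by (simp add: A_def)
    moreover have "k + l - 1 = (k - 1) + l" using kl by auto
    ultimately show ?thesis using True n_pos
      by (simp add: dens_def power_divide power_add divide_right_mono)
  next
    case False
    have "(\<Prod>i\<in>{k+1..k+l}. real (card (A i))) = real (card (A i0)) * (\<Prod>i\<in>{k+1..k+l}-{i0}. real (card (A i)))"
      by (subst s'[OF False], subst prod.insert) auto
    also have "\<dots> = real (card (In c \<inter> Z - nb b)) ^ (l - 1)"
      using assms(3) False by (simp add: A_def)
    finally have "real (card F) \<le> real (card (Out c \<inter> Z - nb b)) ^ k * real (card (In c \<inter> Z - nb b)) ^ (l - 1)"
      using 1 unfolding prod_split using False assms(3) by (simp add: A_def)
    moreover have "k + l - 1 = k + (l - 1)" using kl by auto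
    ultimately show ?thesis using False n_pos
      by (simp add: dens_def power_divide power_add divide_right_mono)
  qed
qed

lemma card_UN_real:
  assumes "finite I" "F \<subseteq> (\<Union>i\<in>I. G i)" "\<And>i. i \<in> I \<Longrightarrow> finite (G i)" "\<And>i. i \<in> I \<Longrightarrow> real (card (G i)) \<le> g i"
  shows "real (card F) \<le> (\<Sum>i\<in>I. g i)"
proof -
  have "card F \<le> card (\<Union>i\<in>I. G i)" using assms by (intro card_mono) auto
  also have "\<dots> \<le> (\<Sum>i\<in>I. card (G i))" by (rule card_UN_le[OF assms(1)])
  finally have "real (card F) \<le> (\<Sum>i\<in>I. real (card (G i)))" by (metis of_nat_le_iff of_nat_sum)
  also have "\<dots> \<le> (\<Sum>i\<in>I. g i)" by (intro sum_mono assms)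
  finally show ?thesis .
qed

lemma n_pow: "real n ^ (k + l) = real n * real n ^ (k + l - 1)"
  using kl by (simp flip: power_Suc)

lemma cstars_first:
  assumes "finite Z" "i0 \<in> {1..k+l}" "B = (if i0 \<le> k then Out c \<inter> Z else In c \<inter> Z)"
  shows "cstars c Z \<le> (\<Sum>b\<in>B.
    if i0 \<le> k then dens (Out c \<inter> Z - nb b) ^ (k - 1) * dens (In c \<inter> Z - nb b) ^ l
     else dens (Out c \<inter> Z - nb b) ^ k * dens (In c \<inter> Z - nb b) ^ (l - 1)) / real n"
    (is "_ \<le> (\<Sum>b\<in>B. ?g b) / _")
proof -
  let ?F = "{\<phi> \<in> stars. \<phi> 0 = c \<and> (\<forall>i\<in>{1..k+l}. \<phi> i \<in> Z)}"
  let ?G = "\<lambda>b. {\<phi> \<in> stars. \<phi> 0 = c \<and> \<phi> i0 = b \<and> (\<forall>i\<in>{1..k+l}. \<phi> i \<in> Z)}"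
  have "real (card ?F) \<le> (\<Sum>b\<in>B. ?g b * real n ^ (k + l - 1))"
  proof (rule card_UN_real)
    show "finite B" using assms by auto
    show "?F \<subseteq> (\<Union>b\<in>B. ?G b)"
      using assms(2) stars_Out[of _ i0] stars_In[of _ i0] by (auto simp: assms(3))
    show "finite (?G b)" for b by (rule finite_subset[OF _ finite_stars]) auto
    show "real (card (?G b)) \<le> ?g b * real n ^ (k + l - 1)" for b
    proof -
      have "real (card (?G b)) / real n ^ (k + l - 1) \<le> ?g b"
        by (rule card_fix_leaf) (use assms in auto)
      then show ?thesis using n_pos by (simp only: pos_divide_le_eq zero_less_power of_nat_0_less_iff)
    qed
  qed
  also have "\<dots> = (\<Sum>b\<in>B. ?g b) * real n ^ (k + l - 1)" by (simp add: sum_distrib_right)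
  finally show ?thesis using n_pos unfolding cstars_def n_pow
    by (simp add: field_simps)
qed

lemma cstars_out_first:
  assumes "finite Z"
  shows "cstars c Z \<le> (\<Sum>b\<in>Out c \<inter> Z. dens (Out c \<inter> Z - nb b) ^ (k - 1) * dens (In c \<inter> Z - nb b) ^ l) / real n"
  using cstars_first[OF assms, of 1 "Out c \<inter> Z" c] kl by simp

lemma cstars_in_first:
  assumes "finite Z"
  shows "cstars c Z \<le> (\<Sum>b\<in>In c \<inter> Z. dens (Out c \<inter> Z - nb b) ^ k * dens (In c \<inter> Z - nb b) ^ (l - 1)) / real n"
  using cstars_first[OF assms, of "k+1" "In c \<inter> Z" c] kl by simp

text \<open>Bounds the stars with given centre and given leaf: the number of slots for this leaf
  times the best distribution of the others. It equals \<open>bmax k l * em (k + l)\<close>.\<close>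

definition leafc :: real where
  "leafc = real k ^ k * real l ^ l / real (k + l - 1) ^ (k + l - 1)"

lemma leafc_pos: "leafc > 0"
  using kl by (simp add: leafc_def)

lemma dens_nonneg [simp]: "0 \<le> dens S"
  by (simp add: dens_def)

lemma dens_mono: "S \<subseteq> T \<Longrightarrow> finite T \<Longrightarrow> dens S \<le> dens T"
  using n_pos by (simp add: dens_def divide_right_mono card_mono)

lemma dens_Un_disj: "finite S \<Longrightarrow> finite T \<Longrightarrow> S \<inter> T = {} \<Longrightarrow> dens (S \<union> T) = dens S + dens T"
  by (simp add: dens_def card_Un_disjoint add_divide_distrib)

lemma dens_le_1: "S \<subseteq> {0..<n} \<Longrightarrow> dens S \<le> 1"
  using n_pos card_mono[of "{0..<n}" S] by (simp add: dens_def)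

lemma dens_Out_In_minus:
  "dens (Out c \<inter> Z - W) + dens (In c \<inter> Z - W) \<le> dens (nb c \<inter> Z - W)"
proof -
  have "dens (Out c \<inter> Z - W) + dens (In c \<inter> Z - W) = dens ((Out c \<inter> Z - W) \<union> (In c \<inter> Z - W))"
    using Out_In_disj[of c] by (subst dens_Un_disj) auto
  also have "\<dots> \<le> dens (nb c \<inter> Z - W)"
    using Out_sub[of c] In_sub[of c] by (intro dens_mono) auto
  finally show ?thesis .
qed

lemma cstars_le:
  assumes "finite Z"
  shows "cstars c Z \<le> bmax k l * dens (nb c \<inter> Z) ^ (k + l)"
proof -
  have "cstars c Z \<le> bmax k l * (dens (Out c \<inter> Z) + dens (In c \<inter> Z)) ^ (k + l)"
    by (rule order_trans[OF cstars0[OF assms] bmax_bound]) auto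
  also have "\<dots> \<le> bmax k l * dens (nb c \<inter> Z) ^ (k + l)"
    using dens_Out_In_minus[of c Z "{}"] bmax_pos[of k l] by (intro mult_left_mono power_mono) auto
  finally show ?thesis .
qed

lemma card_leaf_in:
  assumes "finite Z"
  shows "real (card {\<phi> \<in> stars. \<phi> 0 = c \<and> (\<forall>i\<in>{1..k+l}. \<phi> i \<in> Z) \<and> (\<exists>i\<in>{1..k+l}. \<phi> i \<in> P)})
      / real n ^ (k + l)
    \<le> (\<Sum>a\<in>nb c \<inter> P \<inter> Z. leafc * dens (nb c \<inter> Z - nb a) ^ (k + l - 1)) / real n"
    (is "real (card ?F) / _ \<le> (\<Sum>a\<in>_. ?g a) / _")
proof -
  let ?G = "\<lambda>a i. {\<phi> \<in> stars. \<phi> 0 = c \<and> \<phi> i = a \<and> (\<forall>i\<in>{1..k+l}. \<phi> i \<in> Z)}"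
  let ?H = "\<lambda>a. {\<phi> \<in> stars. \<phi> 0 = c \<and> (\<exists>i\<in>{1..k+l}. \<phi> i = a) \<and> (\<forall>i\<in>{1..k+l}. \<phi> i \<in> Z)}"
  have "real (card ?F) \<le> (\<Sum>a\<in>nb c \<inter> P \<inter> Z. ?g a * real n ^ (k + l - 1))"
  proof (rule card_UN_real)
    show "finite (nb c \<inter> P \<inter> Z)" by auto
    show "?F \<subseteq> (\<Union>a\<in>nb c \<inter> P \<inter> Z. ?H a)"
    proof
      fix \<phi> assume p: "\<phi> \<in> ?F"
      then obtain i where i: "i \<in> {1..k+l}" "\<phi> i \<in> P" by auto
      have "\<phi> i \<in> nb c \<inter> P \<inter> Z" using stars_nb[of \<phi> i] p i by auto
      moreover have "\<phi> \<in> ?H (\<phi> i)" using p i by auto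
      ultimately show "\<phi> \<in> (\<Union>a\<in>nb c \<inter> P \<inter> Z. ?H a)" by blast
    qed
    show "finite (?H a)" for a by (rule finite_subset[OF _ finite_stars]) auto
    fix a assume a: "a \<in> nb c \<inter> P \<inter> Z"
    define x y where "x = dens (Out c \<inter> Z - nb a)" and "y = dens (In c \<inter> Z - nb a)"
    have xy: "0 \<le> x" "0 \<le> y" "x + y \<le> dens (nb c \<inter> Z - nb a)"
      using dens_Out_In_minus[of c Z "nb a"] by (auto simp: x_def y_def)
    have fixed: "real (card (?G a i)) \<le>
        (if i \<le> k then x ^ (k - 1) * y ^ l else x ^ k * y ^ (l - 1)) * real n ^ (k + l - 1)"
      if "i \<in> {1..k+l}" for i
    proof -
      have "real (card (?G a i)) / real n ^ (k + l - 1) \<le>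
          (if i \<le> k then x ^ (k - 1) * y ^ l else x ^ k * y ^ (l - 1))"
        unfolding x_def y_def by (rule card_fix_leaf) (use assms that in auto)
      then show ?thesis using n_pos by (simp only: pos_divide_le_eq zero_less_power of_nat_0_less_iff)
    qed
    have fin: "finite (?G a i)" for i by (rule finite_subset[OF _ finite_stars]) auto
    \<comment> \<open>\<open>Out c\<close> and \<open>In c\<close> are disjoint, so \<open>a\<close>
      can fill only the \<open>k\<close> out-slots or only the \<open>l\<close> in-slots, never all
      \<open>k + l\<close>; \<open>leafc\<close> covers either case.\<close>
    consider (out) "a \<notin> In c" | (inn) "a \<notin> Out c" using Out_In_disj[of c] by auto
    then have "real (card (?H a)) \<le> leafc * (x + y) ^ (k + l - 1) * real n ^ (k + l - 1)"
    proof cases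
      case out
      have "real (card (?H a)) \<le> (\<Sum>i\<in>{1..k}. x ^ (k - 1) * y ^ l * real n ^ (k + l - 1))"
      proof (rule card_UN_real)
        show "?H a \<subseteq> (\<Union>i\<in>{1..k}. ?G a i)"
        proof
          fix \<phi> assume p: "\<phi> \<in> ?H a"
          then obtain i where i: "i \<in> {1..k+l}" "\<phi> i = a" by auto
          then have "i \<le> k" using stars_In[of \<phi> i] p out by force
          then show "\<phi> \<in> (\<Union>i\<in>{1..k}. ?G a i)" using p i by auto
        qed
        show "real (card (?G a i)) \<le> x ^ (k - 1) * y ^ l * real n ^ (k + l - 1)" if "i \<in> {1..k}" for i
          using fixed[of i] that by auto
      qed (use fin in auto)
      also have "\<dots> = real k * (x ^ (k - 1) * y ^ l) * real n ^ (k + l - 1)" by simp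
      also have "\<dots> \<le> real k * (bmax (k - 1) l * (x + y) ^ (k - 1 + l)) * real n ^ (k + l - 1)"
        by (intro mult_right_mono mult_left_mono bmax_bound xy) auto
      also have "\<dots> = (real k * bmax (k - 1) l) * (x + y) ^ (k + l - 1) * real n ^ (k + l - 1)"
        using kl by (simp add: mult.assoc)
      also have "\<dots> \<le> leafc * (x + y) ^ (k + l - 1) * real n ^ (k + l - 1)"
        unfolding leafc_def using kl xy by (intro mult_right_mono bmax_decr_left) auto
      finally show ?thesis .
    next
      case inn
      have "real (card (?H a)) \<le> (\<Sum>i\<in>{k+1..k+l}. x ^ k * y ^ (l - 1) * real n ^ (k + l - 1))"
      proof (rule card_UN_real)
        show "?H a \<subseteq> (\<Union>i\<in>{k+1..k+l}. ?G a i)"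
        proof
          fix \<phi> assume p: "\<phi> \<in> ?H a"
          then obtain i where i: "i \<in> {1..k+l}" "\<phi> i = a" by auto
          then have "\<not> i \<le> k" using stars_Out[of \<phi> i] p inn by force
          then show "\<phi> \<in> (\<Union>i\<in>{k+1..k+l}. ?G a i)" using p i by auto
        qed
        show "real (card (?G a i)) \<le> x ^ k * y ^ (l - 1) * real n ^ (k + l - 1)" if "i \<in> {k+1..k+l}" for i
          using fixed[of i] that by auto
      qed (use fin in auto)
      also have "\<dots> = real l * (x ^ k * y ^ (l - 1)) * real n ^ (k + l - 1)" by simp
      also have "\<dots> \<le> real l * (bmax k (l - 1) * (x + y) ^ (k + (l - 1))) * real n ^ (k + l - 1)"
        by (intro mult_right_mono mult_left_mono bmax_bound xy) auto
      also have "\<dots> = (real l * bmax k (l - 1)) * (x + y) ^ (k + l - 1) * real n ^ (k + l - 1)"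
        using kl by (simp add: mult.assoc)
      also have "\<dots> \<le> leafc * (x + y) ^ (k + l - 1) * real n ^ (k + l - 1)"
        unfolding leafc_def using kl xy by (intro mult_right_mono bmax_decr_right) auto
      finally show ?thesis .
    qed
    also have "\<dots> \<le> ?g a * real n ^ (k + l - 1)"
      using leafc_pos xy by (intro mult_right_mono mult_left_mono power_mono) auto
    finally show "real (card (?H a)) \<le> ?g a * real n ^ (k + l - 1)" .
  qed
  also have "\<dots> = (\<Sum>a\<in>nb c \<inter> P \<inter> Z. ?g a) * real n ^ (k + l - 1)" by (simp add: sum_distrib_right)
  finally show ?thesis using n_pos unfolding n_pow by (simp add: field_simps)
qed

text \<open>Choose the centre, a leaf \<open>a\<close> in \<open>H\<close>, a leaf \<open>b\<close>
  in \<open>L\<close> not adjacent to \<open>a\<close>, and their two slots; every other leaf avoids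
  \<open>nb a\<close>, which leaves at most \<open>\<nu> n\<close> vertices. The count is thus
  proportional to the number of nonadjacent pairs.\<close>

lemma card_mixed:
  assumes "H \<inter> L = {}" "H \<subseteq> {0..<n}" "L \<subseteq> {0..<n}"
    and "\<And>a. a \<in> H \<Longrightarrow> dens ({0..<n} - nb a) \<le> \<nu>"
  shows "real (card {\<phi> \<in> stars. (\<exists>i\<in>{1..k+l}. \<phi> i \<in> H) \<and> (\<exists>i\<in>{1..k+l}. \<phi> i \<in> L)})
      / real n ^ (k + l + 1)
    \<le> real (k + l) ^ 2 * \<nu> ^ (k + l - 2) * ((\<Sum>a\<in>H. dens (L - nb a)) / real n)"
    (is "real (card ?F) / _ \<le> _")
proof -
  let ?J = "{(i, j). i \<in> {1..k+l} \<and> j \<in> {1..k+l} \<and> i \<noteq> j}"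
  let ?I = "({0..<n} \<times> (SIGMA a:H. L - nb a)) \<times> ?J"
  let ?G = "\<lambda>((c, (a, b)), (i, j)). {\<phi> \<in> stars. \<phi> 0 = c \<and> \<phi> i = a \<and> \<phi> j = b}"
  have finH: "finite H" "finite L" using assms finite_subset[of _ "{0..<n}"] by auto
  have finJ: "finite ?J" by (rule finite_subset[of _ "{1..k+l} \<times> {1..k+l}"]) auto
  have cardJ: "real (card ?J) \<le> real (k + l) ^ 2"
  proof -
    have "card ?J \<le> card ({1..k+l} \<times> {1..k+l})" by (rule card_mono) auto
    then have "card ?J \<le> (k + l) ^ 2" by (simp add: power2_eq_square)
    then show ?thesis using of_nat_mono[of "card ?J" "(k + l) ^ 2", where 'a=real] by simp
  qed
  have "real (card ?F) \<le> (\<Sum>t\<in>?I. (\<nu> * real n) ^ (k + l - 2))"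
  proof (rule card_UN_real)
    show "finite ?I" using finJ finH by (intro finite_cartesian_product finite_SigmaI) auto
    show "?F \<subseteq> (\<Union>t\<in>?I. ?G t)"
    proof
      fix \<phi> assume "\<phi> \<in> ?F"
      then obtain i j where *: "\<phi> \<in> stars" "i \<in> {1..k+l}" "j \<in> {1..k+l}" "\<phi> i \<in> H" "\<phi> j \<in> L" by auto
      then have "((\<phi> 0, (\<phi> i, \<phi> j)), (i, j)) \<in> ?I"
        using stars_leaf[of \<phi> j i] stars_V[of \<phi> 0] assms(1) by auto
      then show "\<phi> \<in> (\<Union>t\<in>?I. ?G t)" using *(1) by (intro UN_I) auto
    qed
    show "finite (?G t)" for t by (rule finite_subset[OF _ finite_stars]) auto
    fix t assume "t \<in> ?I"
    then obtain c a b i j where t: "t = ((c, (a, b)), (i, j))" "a \<in> H" "i \<in> {1..k+l}" "j \<in> {1..k+l}" "i \<noteq> j"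
      by auto
    define A where "A r = (if r = 0 then {c} else if r = i then {a} else if r = j then {b} else {0..<n} - nb a)"
      for r :: nat
    have "real (card (?G t)) \<le> (\<Prod>r\<in>{0..k+l}. real (card (A r)))"
    proof (rule card_le_prod)
      fix \<phi> r assume "\<phi> \<in> ?G t" "r \<le> k + l"
      then show "\<phi> r \<in> A r" using t stars_V[of \<phi> r] stars_leaf[of \<phi> r i] by (auto simp: A_def)
    qed (auto simp: t A_def)
    also have "{0..k+l} = insert 0 (insert i (insert j ({1..k+l} - {i, j})))" using t by auto
    also have "(\<Prod>r\<in>\<dots>. real (card (A r))) = (\<Prod>r\<in>{1..k+l} - {i, j}. real (card (A r)))"
      using t by (simp add: A_def)
    also have "\<dots> = real (card ({0..<n} - nb a)) ^ card ({1..k+l} - {i, j})"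
      by (simp add: A_def)
    also have "card ({1..k+l} - {i, j}) = k + l - 2" using t by (simp add: card_Diff_subset)
    also have "real (card ({0..<n} - nb a)) ^ (k + l - 2) \<le> (\<nu> * real n) ^ (k + l - 2)"
      using assms(4)[OF t(2)] n_pos by (intro power_mono) (auto simp: dens_def field_simps)
    finally show "real (card (?G t)) \<le> (\<nu> * real n) ^ (k + l - 2)" .
  qed
  also have "\<dots> = real (card ?I) * (\<nu> * real n) ^ (k + l - 2)" by simp
  also have "real (card ?I) = real n * (\<Sum>a\<in>H. real (card (L - nb a))) * real (card ?J)"
    using finH by (simp add: card_cartesian_product del: card_eq_0_iff)
  also have "\<dots> = real n * (real n * (\<Sum>a\<in>H. dens (L - nb a))) * real (card ?J)"
    using n_pos by (simp add: dens_def flip: sum_divide_distrib)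
  also have "\<dots> * (\<nu> * real n) ^ (k + l - 2) \<le> real n * (real n * (\<Sum>a\<in>H. dens (L - nb a))) * real (k + l) ^ 2 * (\<nu> * real n) ^ (k + l - 2)"
  proof (cases "H = {}")
    case False
    then obtain a where "a \<in> H" by auto
    then have "0 \<le> \<nu>" using assms(4)[of a] dens_nonneg order_trans by blast
    then show ?thesis using cardJ by (intro mult_right_mono mult_left_mono) (auto intro!: mult_nonneg_nonneg sum_nonneg)
  qed auto
  also have "\<dots> = real (k + l) ^ 2 * \<nu> ^ (k + l - 2) * ((\<Sum>a\<in>H. dens (L - nb a)) / real n) * (real n * real n * real n * real n ^ (k + l - 2))"
    using n_pos by (simp add: power_mult_distrib)
  also have "real n * real n * real n * real n ^ (k + l - 2) = real n ^ (k + l + 1)"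
  proof -
    have "k + l + 1 = Suc (Suc (Suc (k + l - 2)))" using kl by auto
    then show ?thesis by (simp only: power_Suc mult.assoc)
  qed
  finally show ?thesis using n_pos by (simp add: pos_divide_le_eq)
qed

definition vstars :: "nat \<Rightarrow> real" where
  "vstars v = real (card {\<phi> \<in> stars. v \<in> \<phi> ` {0..k+l}}) / real n ^ (k + l)"

text \<open>Double counting: by injectivity every star covers exactly \<open>k + l + 1\<close>
  vertices.\<close>

lemma sum_vstars:
  "(\<Sum>v\<in>{0..<n}. vstars v) / real n = real (k + l + 1) * s_density k l n E"
proof -
  have "(\<Sum>v\<in>{0..<n}. card {\<phi> \<in> stars. v \<in> \<phi> ` {0..k+l}}) = (\<Sum>\<phi>\<in>stars. card {v \<in> {0..<n}. v \<in> \<phi> ` {0..k+l}})"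
    using finite_stars by (intro sum_multicount_gen[symmetric, of stars, simplified]) auto
  also have "\<dots> = (\<Sum>\<phi>\<in>stars. k + l + 1)"
  proof (rule sum.cong)
    fix \<phi> assume p: "\<phi> \<in> stars"
    have "{v \<in> {0..<n}. v \<in> \<phi> ` {0..k+l}} = \<phi> ` {0..k+l}" using stars_V[OF p] by auto
    then show "card {v \<in> {0..<n}. v \<in> \<phi> ` {0..k+l}} = k + l + 1"
      using stars_inj[OF p] by (simp add: card_image)
  qed auto
  also have "\<dots> = card stars * (k + l + 1)" by (simp only: sum_constant of_nat_id)
  finally have "(\<Sum>v\<in>{0..<n}. real (card {\<phi> \<in> stars. v \<in> \<phi> ` {0..k+l}})) = real (card stars) * real (k + l + 1)"
    by (simp only: of_nat_mult flip: of_nat_sum)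
  then show ?thesis
    by (simp add: vstars_def s_density_def stars_def[symmetric] mult.commute flip: sum_divide_distrib)
qed

lemma vstars_le:
  "vstars v \<le> cstars v {0..<n} + (\<Sum>c\<in>nb v. leafc * dens (nb c - nb v) ^ (k + l - 1)) / real n"
proof -
  let ?c = "{\<phi> \<in> stars. \<phi> 0 = v \<and> (\<forall>i\<in>{1..k+l}. \<phi> i \<in> {0..<n})}"
  let ?L = "\<lambda>c. {\<phi> \<in> stars. \<phi> 0 = c \<and> (\<forall>i\<in>{1..k+l}. \<phi> i \<in> {0..<n}) \<and> (\<exists>i\<in>{1..k+l}. \<phi> i \<in> {v})}"
  have fin: "finite ?c" "\<And>c. finite (?L c)" by (rule finite_subset[OF _ finite_stars], auto)+
  have sub: "{\<phi> \<in> stars. v \<in> \<phi> ` {0..k+l}} \<subseteq> ?c \<union> (\<Union>c\<in>nb v. ?L c)"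
  proof
    fix \<phi> assume "\<phi> \<in> {\<phi> \<in> stars. v \<in> \<phi> ` {0..k+l}}"
    then obtain i where i: "\<phi> \<in> stars" "i \<le> k + l" "\<phi> i = v" by auto
    show "\<phi> \<in> ?c \<union> (\<Union>c\<in>nb v. ?L c)"
    proof (cases "i = 0")
      case True
      then show ?thesis using i stars_V[OF i(1)] by simp
    next
      case False
      then have "\<phi> 0 \<in> nb v" "i \<in> {1..k+l}"
        using i stars_nb[OF i(1), of i] nb_sym[of "\<phi> 0" v] by auto
      then show ?thesis using i stars_V[OF i(1)] by auto
    qed
  qed
  have "card {\<phi> \<in> stars. v \<in> \<phi> ` {0..k+l}} \<le> card (?c \<union> (\<Union>c\<in>nb v. ?L c))"
    using fin by (intro card_mono sub) auto
  also have "\<dots> \<le> card ?c + card (\<Union>c\<in>nb v. ?L c)" by (rule card_Un_le)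
  finally have "card {\<phi> \<in> stars. v \<in> \<phi> ` {0..k+l}} \<le> card ?c + card (\<Union>c\<in>nb v. ?L c)" .
  moreover have "real (card (\<Union>c\<in>nb v. ?L c)) \<le>
      (\<Sum>c\<in>nb v. leafc * dens (nb c - nb v) ^ (k + l - 1) / real n * real n ^ (k + l))"
  proof (rule card_UN_real)
    fix c assume "c \<in> nb v"
    then have "v \<in> nb c" "v < n" using nb_sym nb_sub by force+
    then have e: "nb c \<inter> {v} \<inter> {0..<n} = {v}" "nb c \<inter> {0..<n} = nb c" using nb_sub by auto
    show "real (card (?L c)) \<le> leafc * dens (nb c - nb v) ^ (k + l - 1) / real n * real n ^ (k + l)"
      using card_leaf_in[of "{0..<n}" c "{v}"] n_pos unfolding e by (simp add: pos_divide_le_eq)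
  qed (use fin in auto)
  ultimately have "real (card {\<phi> \<in> stars. v \<in> \<phi> ` {0..k+l}}) \<le> real (card ?c) +
      (\<Sum>c\<in>nb v. leafc * dens (nb c - nb v) ^ (k + l - 1)) / real n * real n ^ (k + l)"
    by (simp add: sum_distrib_right sum_divide_distrib)
  then show ?thesis using n_pos by (simp add: vstars_def cstars_def field_simps)
qed

lemma s_density_split:
  assumes "H \<union> L = {0..<n}" "H \<inter> L = {}"
    and "\<And>a. a \<in> H \<Longrightarrow> dens ({0..<n} - nb a) \<le> \<nu>"
  shows "s_density k l n E \<le> (\<Sum>c\<in>{0..<n}. cstars c L) / real n + (\<Sum>c\<in>{0..<n}. cstars c H) / real n
    + real (k + l) ^ 2 * \<nu> ^ (k + l - 2) * ((\<Sum>a\<in>H. dens (L - nb a)) / real n)"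
proof -
  let ?F = "{\<phi> \<in> stars. (\<exists>i\<in>{1..k+l}. \<phi> i \<in> H) \<and> (\<exists>i\<in>{1..k+l}. \<phi> i \<in> L)}"
  let ?S = "\<lambda>Z c. {\<phi> \<in> stars. \<phi> 0 = c \<and> (\<forall>i\<in>{1..k+l}. \<phi> i \<in> Z)}"
  have fin: "finite ?F" "\<And>Z c. finite (?S Z c)" by (rule finite_subset[OF _ finite_stars], auto)+
  have "stars \<subseteq> (\<Union>c\<in>{0..<n}. ?S L c) \<union> (\<Union>c\<in>{0..<n}. ?S H c) \<union> ?F"
  proof
    fix \<phi> assume p: "\<phi> \<in> stars"
    have HL: "\<phi> i \<in> H \<or> \<phi> i \<in> L" if "i \<in> {1..k+l}" for i
      using stars_V[OF p, of i] that unfolding assms(1)[symmetric] by simp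
    have c: "\<phi> 0 \<in> {0..<n}" using stars_V[OF p] by simp
    have "\<phi> \<in> ?S L (\<phi> 0) \<or> \<phi> \<in> ?S H (\<phi> 0) \<or> \<phi> \<in> ?F" using p HL by blast
    then show "\<phi> \<in> (\<Union>c\<in>{0..<n}. ?S L c) \<union> (\<Union>c\<in>{0..<n}. ?S H c) \<union> ?F"
      using c by (elim disjE) (rule UnI1, rule UnI1, rule UN_I, assumption+, rule UnI1, rule UnI2, rule UN_I, assumption+, rule UnI2)
  qed
  then have "card stars \<le> card ((\<Union>c\<in>{0..<n}. ?S L c) \<union> (\<Union>c\<in>{0..<n}. ?S H c) \<union> ?F)"
    using fin by (intro card_mono) auto
  also have "\<dots> \<le> card (\<Union>c\<in>{0..<n}. ?S L c) + card (\<Union>c\<in>{0..<n}. ?S H c) + card ?F"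
    by (intro order_trans[OF card_Un_le] add_mono card_Un_le order_refl)
  finally have "real (card stars) \<le> real (card (\<Union>c\<in>{0..<n}. ?S L c)) + real (card (\<Union>c\<in>{0..<n}. ?S H c)) + real (card ?F)"
    by linarith
  moreover have b: "real (card (\<Union>c\<in>{0..<n}. ?S Z c)) \<le> (\<Sum>c\<in>{0..<n}. cstars c Z * real n ^ (k + l))" for Z
  proof (rule card_UN_real[OF _ order_refl])
    show "finite (?S Z c)" for c by (rule fin(2))
    show "real (card (?S Z c)) \<le> cstars c Z * real n ^ (k + l)" for c
      using n_pos by (simp add: cstars_def)
  qed simp
  ultimately have "real (card stars) \<le> (\<Sum>c\<in>{0..<n}. cstars c L) * real n ^ (k + l)
      + (\<Sum>c\<in>{0..<n}. cstars c H) * real n ^ (k + l) + real (card ?F)"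
    using b[of L] b[of H] unfolding sum_distrib_right[symmetric] by linarith
  then have "real (card stars) / real n ^ (k + l + 1) \<le> ((\<Sum>c\<in>{0..<n}. cstars c L) * real n ^ (k + l)
      + (\<Sum>c\<in>{0..<n}. cstars c H) * real n ^ (k + l) + real (card ?F)) / real n ^ (k + l + 1)"
    using n_pos by (intro divide_right_mono) auto
  also have "\<dots> = (\<Sum>c\<in>{0..<n}. cstars c L) / real n + (\<Sum>c\<in>{0..<n}. cstars c H) / real n
      + real (card ?F) / real n ^ (k + l + 1)"
    using n_pos by (simp add: field_simps)
  also have "\<dots> \<le> (\<Sum>c\<in>{0..<n}. cstars c L) / real n + (\<Sum>c\<in>{0..<n}. cstars c H) / real n
    + real (k + l) ^ 2 * \<nu> ^ (k + l - 2) * ((\<Sum>a\<in>H. dens (L - nb a)) / real n)"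
    using card_mixed[of H L \<nu>] assms by auto
  finally show ?thesis by (simp add: s_density_def stars_def)
qed

end

section \<open>The structure of rich digraphs\<close>

lemma bmax_1: "m \<ge> 1 \<Longrightarrow> bmax 1 (m - 1) = 1 / em m"
  by (simp add: bmax_def em_def)

lemma nu_add: "nu j + 7 / (5 * real (j + 1)) = 49 / (20 * real (j + 1))"
proof -
  define M where "M = real (j + 1)"
  have "M > 0" by (simp add: M_def)
  then show ?thesis unfolding nu_def M_def[symmetric] by (simp add: field_simps)
qed

lemma bmax_ge_half: "(1 / 2) ^ (p + q) \<le> bmax p q"
  using bmax_bound[of "1/2" "1/2" p q] by (simp add: power_add)

text \<open>Stretch the pair \<open>(x, y)\<close> to total \<open>\<beta>\<close> at fixed ratio.
  By Bernoulli this multiplies \<open>x^k y^l\<close> by at least 1 plus \<open>k + l\<close> times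
  the deficit; \<open>\<beta> <= 1\<close> allows the absolute deficit in place of the relative
  one.\<close>

lemma rescale:
  fixes x y \<beta> :: real
  assumes "0 \<le> x" "0 \<le> y" "0 < x + y" "x + y \<le> \<beta>" "\<beta> \<le> 1"
  obtains d where "0 \<le> d" "d \<le> 1" "y \<le> \<beta> * (1 - d)"
    "x ^ k * y ^ l * (1 + real (k + l) * (\<beta> - (x + y))) \<le> \<beta> ^ (k + l) * d ^ k * (1 - d) ^ l"
proof
  define s d where "s = x + y" and "d = x / s"
  have s: "0 < s" "s \<le> \<beta>" using assms by (auto simp: s_def)
  have xy: "x = s * d" "y = s * (1 - d)" using s by (auto simp: d_def s_def field_simps)
  show d: "0 \<le> d" "d \<le> 1" using assms s by (auto simp: d_def s_def)
  show "y \<le> \<beta> * (1 - d)" unfolding xy using s d by (intro mult_right_mono) auto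
  have "(\<beta> - s) * s \<le> \<beta> - s" using s assms(5) by (intro mult_left_le) auto
  then have "\<beta> - s \<le> (\<beta> - s) / s" using s by (simp add: pos_le_divide_eq)
  then have "s ^ (k + l) * (1 + real (k + l) * (\<beta> - s)) \<le> s ^ (k + l) * (1 + real (k + l) * ((\<beta> - s) / s))"
    using s by (intro mult_left_mono add_left_mono) auto
  also have "\<dots> \<le> s ^ (k + l) * (1 + (\<beta> - s) / s) ^ (k + l)"
    using s by (intro mult_left_mono Bernoulli_inequality) (auto intro: order_trans[of _ 0])
  also have "\<dots> = (s * (1 + (\<beta> - s) / s)) ^ (k + l)" by (rule power_mult_distrib[symmetric])
  also have "s * (1 + (\<beta> - s) / s) = \<beta>" using s by (simp add: distrib_left)
  finally have "s ^ (k + l) * (1 + real (k + l) * (\<beta> - s)) * (d ^ k * (1 - d) ^ l) \<le> \<beta> ^ (k + l) * (d ^ k * (1 - d) ^ l)"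
    using d by (intro mult_right_mono) auto
  then show "x ^ k * y ^ l * (1 + real (k + l) * (\<beta> - (x + y))) \<le> \<beta> ^ (k + l) * d ^ k * (1 - d) ^ l"
    unfolding s_def[symmetric] unfolding xy by (simp add: power_mult_distrib power_add mult_ac)
qed

context star_graph
begin

text \<open>Divided by \<open>n\<close> and not by the size of \<open>A\<close>: the constant 1 then
  averages to \<open>dens A\<close>, and double sums over pairs can be exchanged without extra
  factors.\<close>

definition avg :: "nat set \<Rightarrow> (nat \<Rightarrow> real) \<Rightarrow> real" where
  "avg A f = (\<Sum>a\<in>A. f a) / real n"

lemma avg_mono: "(\<And>a. a \<in> A \<Longrightarrow> f a \<le> g a) \<Longrightarrow> avg A f \<le> avg A g"
  unfolding avg_def by (intro divide_right_mono sum_mono) auto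

lemma avg_nonneg: "(\<And>a. a \<in> A \<Longrightarrow> 0 \<le> f a) \<Longrightarrow> 0 \<le> avg A f"
  unfolding avg_def by (intro divide_nonneg_nonneg sum_nonneg) auto

lemma avg_const: "avg A (\<lambda>_. c) = c * dens A"
  by (simp add: avg_def dens_def)

lemma avg_add: "avg A (\<lambda>a. f a + g a) = avg A f + avg A g"
  by (simp add: avg_def sum.distrib add_divide_distrib)

lemma avg_diff: "avg A (\<lambda>a. f a - g a) = avg A f - avg A g"
  by (simp add: avg_def sum_subtractf diff_divide_distrib)

lemma avg_cmult: "avg A (\<lambda>a. c * f a) = c * avg A f"
  by (simp add: avg_def sum_distrib_left)

lemma avg_Un: "finite A \<Longrightarrow> finite B \<Longrightarrow> A \<inter> B = {} \<Longrightarrow> avg (A \<union> B) f = avg A f + avg B f"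
  by (simp add: avg_def sum.union_disjoint add_divide_distrib)

lemma avg_subset: "A \<subseteq> B \<Longrightarrow> finite B \<Longrightarrow> (\<And>a. a \<in> B \<Longrightarrow> 0 \<le> f a) \<Longrightarrow> avg A f \<le> avg B f"
  unfolding avg_def by (intro divide_right_mono sum_mono2) auto

lemma avg_swap:
  assumes "finite A" "finite B"
  shows "avg A (\<lambda>a. avg {b \<in> B. R a b} (f a)) = avg B (\<lambda>b. avg {a \<in> A. R a b} (\<lambda>a. f a b))"
proof -
  have "(\<Sum>a\<in>A. \<Sum>b\<in>{b \<in> B. R a b}. f a b) = (\<Sum>b\<in>B. \<Sum>a\<in>{a \<in> A. R a b}. f a b)"
    using assms by (rule sum.swap_restrict)
  then show ?thesis by (simp add: avg_def flip: sum_divide_distrib)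
qed

lemma avg_one: "avg A (\<lambda>_. 1) = dens A"
  by (simp add: avg_const)

lemma avg_dens_swap:
  assumes "finite A" "finite B"
  shows "avg A (\<lambda>a. dens {b \<in> B. R a b}) = avg B (\<lambda>b. dens {a \<in> A. R a b})"
  using avg_swap[OF assms, where f = "\<lambda>_ _. 1"] by (simp add: avg_one)

lemma leafc_eq: "leafc = bmax k l * em (k + l)"
  using kl by (simp add: leafc_def bmax_def em_def)

lemma dens_Diff: "S \<subseteq> T \<Longrightarrow> finite T \<Longrightarrow> dens (T - S) = dens T - dens S"
  using dens_Un_disj[of S "T - S"] finite_subset[of S T] by (simp add: Un_absorb1)

lemma dens_V: "dens {0..<n} = 1"
  using n_pos by (simp add: dens_def)

lemma dens_diff_nb: "S \<subseteq> {0..<n} \<Longrightarrow> dens (S - nb v) \<le> 1 - dens (nb v)"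
  using dens_Diff[OF nb_sub[of v]] dens_mono[of "S - nb v" "{0..<n} - nb v"] by (auto simp: dens_V)

lemma cstars_split:
  assumes "finite Z"
  shows "cstars c Z \<le> cstars c (Z - P) + avg (nb c \<inter> P \<inter> Z) (\<lambda>a. leafc * dens (nb c \<inter> Z - nb a) ^ (k + l - 1))"
proof -
  let ?A = "{\<phi> \<in> stars. \<phi> 0 = c \<and> (\<forall>i\<in>{1..k+l}. \<phi> i \<in> Z)}"
  let ?B = "{\<phi> \<in> stars. \<phi> 0 = c \<and> (\<forall>i\<in>{1..k+l}. \<phi> i \<in> Z - P)}"
  let ?C = "{\<phi> \<in> stars. \<phi> 0 = c \<and> (\<forall>i\<in>{1..k+l}. \<phi> i \<in> Z) \<and> (\<exists>i\<in>{1..k+l}. \<phi> i \<in> P)}"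
  have fin: "finite ?B" "finite ?C" by (rule finite_subset[OF _ finite_stars], auto)+
  have "?A \<subseteq> ?B \<union> ?C" by blast
  then have "card ?A \<le> card (?B \<union> ?C)" using fin by (intro card_mono) auto
  also have "\<dots> \<le> card ?B + card ?C" by (rule card_Un_le)
  finally have "real (card ?A) \<le> real (card ?B) + real (card ?C)" by linarith
  then have "cstars c Z \<le> cstars c (Z - P) + real (card ?C) / real n ^ (k + l)"
    using n_pos unfolding cstars_def by (simp add: add_divide_distrib[symmetric] divide_right_mono)
  then show ?thesis using card_leaf_in[OF assms, of c P] by (simp add: avg_def)
qed

end

text \<open>The threshold is a lower bound for \<open>(k + l + 1) * OPT k l\<close> that is free of
  the maximisation inside \<open>OPT\<close>.\<close>

locale rich_star_graph = star_graph +
  assumes rich: "v < n \<Longrightarrow> bmax k l * theta (k + l) \<le> vstars v"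
begin

abbreviation m :: nat where "m \<equiv> k + l"
abbreviation \<gamma> :: real where "\<gamma> \<equiv> bmax k l"
abbreviation \<nu> :: real where "\<nu> \<equiv> nu (k + l)"

section \<open>Splitting the vertices by degree\<close>

definition High :: "nat set" where "High = {v \<in> {0..<n}. 1 / 2 \<le> dens (nb v)}"
definition Low :: "nat set" where "Low = {v \<in> {0..<n}. dens (nb v) < 1 / 2}"

lemma HL: "High \<union> Low = {0..<n}" "High \<inter> Low = {}" "High \<subseteq> {0..<n}" "Low \<subseteq> {0..<n}"
  by (auto simp: High_def Low_def)

lemma fin [simp]: "finite High" "finite Low"
  by (auto simp: High_def Low_def)

lemma m6: "6 \<le> m" using kl by simp

lemma gam_pos: "\<gamma> > 0" by (rule bmax_pos)

lemma nu01: "0 < \<nu>" "\<nu> \<le> 3 / 20" using nu_pos nu_le[OF m6] by auto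

lemma vstars_rich:
  assumes "v < n"
  shows "\<gamma> * theta m \<le> \<gamma> * dens (nb v) ^ m + avg (nb v) (\<lambda>c. leafc * dens (nb c - nb v) ^ (m - 1))"
proof -
  have "nb v \<inter> {0..<n} = nb v" using nb_sub[of v] by auto
  then show ?thesis using rich[OF assms] vstars_le[of v] cstars_le[of "{0..<n}" v] by (simp add: avg_def)
qed

text \<open>A vertex of degree \<open>\<delta> n\<close> is the centre of at most
  \<open>\<gamma> \<delta>^m\<close> stars, and as a leaf it leaves density at most
  \<open>1 - \<delta>\<close> for the other leaves. For intermediate \<open>\<delta>\<close> both
  counts together are too small.\<close>

lemma High_degree:
  assumes "a \<in> High" shows "1 - \<nu> < dens (nb a)"
proof (rule ccontr)
  assume "\<not> 1 - \<nu> < dens (nb a)"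
  then have d: "1 / 2 \<le> dens (nb a)" "dens (nb a) \<le> 1 - \<nu>" and a: "a < n" using assms by (auto simp: High_def)
  let ?d = "dens (nb a)"
  have "avg (nb a) (\<lambda>c. leafc * dens (nb c - nb a) ^ (m - 1)) \<le> avg (nb a) (\<lambda>c. leafc * (1 - ?d) ^ (m - 1))"
    using leafc_pos by (intro avg_mono mult_left_mono power_mono dens_diff_nb nb_sub) auto
  also have "\<dots> = \<gamma> * (em m * (?d * (1 - ?d) ^ (m - 1)))" by (simp add: avg_const leafc_eq)
  finally have "\<gamma> * theta m \<le> \<gamma> * (?d ^ m + em m * (?d * (1 - ?d) ^ (m - 1)))"
    using vstars_rich[OF a] by (simp add: distrib_left)
  then show False using gam_pos num_high2[OF m6 d] by simp
qed

text \<open>Every star through \<open>a\<close> of another kind has a leaf in \<open>High\<close>,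
  either \<open>a\<close> itself or a different vertex, and the neighbourhood of that leaf leaves
  density at most \<open>\<nu>\<close> for the remaining leaves. The two kinds together contribute
  at most \<open>2 \<gamma> em m \<nu>^(m - 1)\<close>.\<close>

lemma High_cstars:
  assumes "a \<in> High" shows "\<gamma> * (1 - \<nu>) ^ m < cstars a Low"
proof -
  have a: "a < n" using assms HL by auto
  have "\<gamma> * theta m \<le> cstars a {0..<n} + avg (nb a) (\<lambda>c. leafc * dens (nb c - nb a) ^ (m - 1))"
    using rich[OF a] vstars_le[of a] by (simp add: avg_def)
  also have "avg (nb a) (\<lambda>c. leafc * dens (nb c - nb a) ^ (m - 1)) \<le> avg (nb a) (\<lambda>c. leafc * \<nu> ^ (m - 1))"
  proof (intro avg_mono mult_left_mono power_mono)
    show "dens (nb c - nb a) \<le> \<nu>" for c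
      using dens_diff_nb[OF nb_sub, of c a] High_degree[OF assms] by linarith
  qed (use leafc_pos in auto)
  also have "\<dots> \<le> leafc * \<nu> ^ (m - 1)"
    using leafc_pos nu01 dens_le_1[OF nb_sub] by (simp add: avg_const mult_left_le)
  also have "cstars a {0..<n} \<le> cstars a Low + avg (nb a \<inter> High) (\<lambda>c. leafc * dens (nb a - nb c) ^ (m - 1))"
  proof -
    have "{0..<n} - High = Low" "nb a \<inter> High \<inter> {0..<n} = nb a \<inter> High" "nb a \<inter> {0..<n} = nb a"
      using HL nb_sub[of a] by auto
    then show ?thesis using cstars_split[of "{0..<n}" a High] by simp
  qed
  also have "avg (nb a \<inter> High) (\<lambda>c. leafc * dens (nb a - nb c) ^ (m - 1)) \<le> avg (nb a \<inter> High) (\<lambda>c. leafc * \<nu> ^ (m - 1))"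
  proof (intro avg_mono mult_left_mono power_mono)
    show "dens (nb a - nb c) \<le> \<nu>" if "c \<in> nb a \<inter> High" for c
      using dens_diff_nb[OF nb_sub, of a c] High_degree[of c] that by auto
  qed (use leafc_pos in auto)
  also have "\<dots> \<le> leafc * \<nu> ^ (m - 1)"
  proof -
    have "dens (nb a \<inter> High) \<le> 1" by (rule dens_le_1) (use nb_sub[of a] in auto)
    then show ?thesis using leafc_pos nu01 by (simp add: avg_const mult_left_le)
  qed
  finally have "\<gamma> * theta m \<le> cstars a Low + \<gamma> * (2 * em m * \<nu> ^ (m - 1))" by (simp add: leafc_eq)
  moreover have "\<gamma> * ((1 - \<nu>) ^ m + 2 * em m * \<nu> ^ (m - 1)) < \<gamma> * theta m"
    using num_high1[OF m6] gam_pos by simp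
  ultimately show ?thesis by (simp add: distrib_left)
qed

definition xo :: "nat \<Rightarrow> real" where "xo a = dens (Out a \<inter> Low)"
definition yi :: "nat \<Rightarrow> real" where "yi a = dens (In a \<inter> Low)"
text \<open>A 2-cycle between \<open>a\<close> and a vertex of \<open>Low\<close> counts as missing,
  since no star with centre \<open>a\<close> can use it.\<close>

definition miss :: "nat \<Rightarrow> real" where "miss a = dens (Low - (Out a \<union> In a))"

lemma xy_nonneg [simp]: "0 \<le> xo a" "0 \<le> yi a" "0 \<le> miss a"
  by (auto simp: xo_def yi_def miss_def)

lemma xy_miss: "xo a + yi a + miss a = dens Low"
proof -
  have "xo a + yi a = dens (Low \<inter> (Out a \<union> In a))"
    unfolding xo_def yi_def using Out_In_disj[of a]
    by (subst dens_Un_disj[symmetric]) (auto intro!: arg_cong[of _ _ dens])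
  moreover have "dens (Low \<inter> (Out a \<union> In a)) + miss a = dens Low"
    unfolding miss_def by (subst dens_Un_disj[symmetric]) (auto intro!: arg_cong[of _ _ dens])
  ultimately show ?thesis by simp
qed

lemma That_ge:
  assumes "a \<in> High" shows "\<gamma> * (1 - \<nu>) ^ m < xo a ^ k * yi a ^ l"
  using High_cstars[OF assms] cstars0[OF fin(2), of a] by (simp add: xo_def yi_def)

lemma xy_ge:
  assumes "a \<in> High" shows "1 - \<nu> < xo a + yi a"
proof -
  have "\<gamma> * (1 - \<nu>) ^ m < \<gamma> * (xo a + yi a) ^ m"
    using That_ge[OF assms] bmax_bound[of "xo a" "yi a" k l] by simp
  then have "(1 - \<nu>) ^ m < (xo a + yi a) ^ m" using gam_pos by simp
  then show ?thesis by (rule power_less_imp_less_base) simp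
qed

definition \<alpha> :: real where "\<alpha> = dens High"

lemma dens_Low: "dens Low = 1 - \<alpha>"
  using dens_Un_disj[OF fin HL(2)] HL(1) dens_V by (simp add: \<alpha>_def)

lemma alpha_bounds: "0 \<le> \<alpha>" "\<alpha> \<le> \<nu>"
proof -
  show "0 \<le> \<alpha>" by (simp add: \<alpha>_def)
  show "\<alpha> \<le> \<nu>"
  proof (cases "High = {}")
    case True then show ?thesis using nu01 by (simp add: \<alpha>_def dens_def)
  next
    case False
    then obtain a where "a \<in> High" by auto
    from xy_ge[OF this] xy_miss[of a] xy_nonneg(3)[of a] show ?thesis unfolding dens_Low by linarith
  qed
qed

section \<open>Degrees inside \<open>Low\<close>\<close>

definition lam :: "nat \<Rightarrow> real" where "lam b = dens (nb b \<inter> Low)"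

lemma lam_nonneg [simp]: "0 \<le> lam b" by (simp add: lam_def)

lemma dens_nb_split: "dens (nb b) = dens (nb b \<inter> High) + lam b"
proof -
  have "nb b = (nb b \<inter> High) \<union> (nb b \<inter> Low)" using nb_sub[of b] HL(1) by auto
  moreover have "dens ((nb b \<inter> High) \<union> (nb b \<inter> Low)) = dens (nb b \<inter> High) + lam b"
    unfolding lam_def using HL(2) by (intro dens_Un_disj) auto
  ultimately show ?thesis by simp
qed

text \<open>The summands belong to \<open>b\<close> as centre, as leaf of a centre in
  \<open>Low\<close>, and as leaf of a centre in \<open>High\<close>. In the last role the density
  \<open>h\<close> of the \<open>High\<close> neighbours is unknown; maximising
  \<open>h (1 - h - lam b)^(m - 1)\<close> gives the factor
  \<open>bmax 1 (m - 1) = 1 / em m\<close>, which cancels the \<open>em m\<close> in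
  \<open>leafc\<close>.\<close>

lemma Low_step:
  assumes D: "\<And>c. c \<in> Low \<Longrightarrow> dens (nb c) \<le> D" and b: "b \<in> Low"
  shows "theta m \<le> D ^ m + em m * (lam b * D ^ (m - 1)) + (1 - lam b) ^ m"
proof -
  let ?f = "\<lambda>c. leafc * dens (nb c - nb b) ^ (m - 1)"
  let ?h = "dens (nb b \<inter> High)"
  have D0: "0 \<le> D" using D[OF b] dens_nonneg order_trans by blast
  have bn: "b < n" using b HL by auto
  have le1: "?h + lam b \<le> 1" using dens_nb_split[of b] dens_le_1[OF nb_sub[of b]] by simp
  have nbs: "nb b = (nb b \<inter> Low) \<union> (nb b \<inter> High)" using nb_sub[of b] HL(1) by auto
  have "avg (nb b) ?f = avg (nb b \<inter> Low) ?f + avg (nb b \<inter> High) ?f"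
    by (subst nbs, rule avg_Un) (use HL(2) in auto)
  also have "avg (nb b \<inter> Low) ?f \<le> avg (nb b \<inter> Low) (\<lambda>c. leafc * D ^ (m - 1))"
  proof (intro avg_mono mult_left_mono power_mono)
    show "dens (nb c - nb b) \<le> D" if "c \<in> nb b \<inter> Low" for c
      using D[of c] that dens_mono[of "nb c - nb b" "nb c"] by auto
  qed (use leafc_pos in auto)
  also have "\<dots> = \<gamma> * (em m * (lam b * D ^ (m - 1)))" by (simp add: avg_const leafc_eq lam_def)
  also have "avg (nb b \<inter> High) ?f \<le> avg (nb b \<inter> High) (\<lambda>c. leafc * (1 - ?h - lam b) ^ (m - 1))"
    using leafc_pos dens_diff_nb[OF nb_sub, of _ b] by (intro avg_mono mult_left_mono power_mono) (auto simp: dens_nb_split algebra_simps)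
  also have "\<dots> = leafc * (?h ^ 1 * (1 - ?h - lam b) ^ (m - 1))" by (simp add: avg_const)
  also have "\<dots> \<le> leafc * (bmax 1 (m - 1) * (?h + (1 - ?h - lam b)) ^ (1 + (m - 1)))"
    using leafc_pos le1 by (intro mult_left_mono bmax_bound) auto
  also have "\<dots> = \<gamma> * (1 - lam b) ^ m"
  proof -
    have "em m > 0" using kl by (simp add: em_def)
    moreover have "1 + (m - 1) = m" "m \<ge> 1" using kl by auto
    ultimately show ?thesis using bmax_1[of m] by (simp add: leafc_eq)
  qed
  finally have "avg (nb b) ?f \<le> \<gamma> * (em m * (lam b * D ^ (m - 1))) + \<gamma> * (1 - lam b) ^ m" by simp
  moreover have "\<gamma> * dens (nb b) ^ m \<le> \<gamma> * D ^ m"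
    using D[OF b] gam_pos by (intro mult_left_mono power_mono) auto
  ultimately have "\<gamma> * theta m \<le> \<gamma> * (D ^ m + em m * (lam b * D ^ (m - 1)) + (1 - lam b) ^ m)"
    using vstars_rich[OF bn] by (simp add: distrib_left)
  then show ?thesis using gam_pos by simp
qed

lemma lam_le: assumes "b \<in> Low" shows "lam b \<le> \<nu>"
proof -
  have lam1: "lam c \<le> 7 / (5 * real (m + 1))" if "c \<in> Low" for c
  proof (rule ccontr)
    assume "\<not> lam c \<le> 7 / (5 * real (m + 1))"
    moreover have "lam c \<le> 1 / 2" using dens_mono[of "nb c \<inter> Low" "nb c"] that by (simp add: Low_def lam_def)
    ultimately have "(1/2) ^ m + em m * (lam c * (1/2) ^ (m - 1)) + (1 - lam c) ^ m < theta m"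
      by (intro num_low1[OF m6]) auto
    moreover have "theta m \<le> (1/2) ^ m + em m * (lam c * (1/2) ^ (m - 1)) + (1 - lam c) ^ m"
      by (rule Low_step[OF _ that]) (simp add: Low_def)
    ultimately show False by simp
  qed
  have D: "dens (nb c) \<le> 49 / (20 * real (m + 1))" if "c \<in> Low" for c
  proof -
    have "dens (nb c \<inter> High) \<le> \<alpha>" unfolding \<alpha>_def by (intro dens_mono) auto
    then have "dens (nb c) \<le> \<nu> + 7 / (5 * real (m + 1))"
      using dens_nb_split[of c] lam1[OF that] alpha_bounds by simp
    also have "\<dots> = 49 / (20 * real (m + 1))" by (rule nu_add)
    finally show ?thesis .
  qed
  show ?thesis
  proof (rule ccontr)
    assume "\<not> lam b \<le> \<nu>"
    then show False using num_low2[OF m6, of "lam b"] lam1[OF assms] Low_step[OF D assms] by simp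
  qed
qed

text \<open>Per unit of missing pairs, stretching to the full density of \<open>Low\<close> yields
  \<open>\<gamma> m / 3\<close>. Stars with leaves on both sides are charged with
  \<open>\<gamma> (m / 3 - 1/2)\<close> of it, so that \<open>\<gamma> / 2\<close> is left for the
  later estimates.\<close>

lemma s_split:
  "s_density k l n E \<le> avg High (\<lambda>a. cstars a Low) + avg Low (\<lambda>b. cstars b Low)
    + avg {0..<n} (\<lambda>c. cstars c High) + \<gamma> * (real m / 3 - 1 / 2) * avg High miss"
proof -
  have "s_density k l n E \<le> avg {0..<n} (\<lambda>c. cstars c Low) + avg {0..<n} (\<lambda>c. cstars c High)
    + real m ^ 2 * \<nu> ^ (m - 2) * avg High (\<lambda>a. dens (Low - nb a))"
    unfolding avg_def
  proof (rule s_density_split[OF HL(1,2)])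
    show "dens ({0..<n} - nb a) \<le> \<nu>" if "a \<in> High" for a
      using dens_diff_nb[of "{0..<n}" a] High_degree[OF that] by simp
  qed
  also have "avg {0..<n} (\<lambda>c. cstars c Low) = avg High (\<lambda>a. cstars a Low) + avg Low (\<lambda>b. cstars b Low)"
    unfolding HL(1)[symmetric] by (rule avg_Un) (auto simp: HL)
  also have "real m ^ 2 * \<nu> ^ (m - 2) * avg High (\<lambda>a. dens (Low - nb a)) \<le> \<gamma> * (real m / 3 - 1 / 2) * avg High miss"
  proof (rule mult_mono)
    show "avg High (\<lambda>a. dens (Low - nb a)) \<le> avg High miss"
      unfolding miss_def using Out_sub In_sub by (intro avg_mono dens_mono) auto
    have "real m ^ 2 * \<nu> ^ (m - 2) \<le> (real m / 3 - 1 / 2) * (1 / 2) ^ m" by (rule num_mixed[OF m6])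
    also have "\<dots> \<le> (real m / 3 - 1 / 2) * \<gamma>" using bmax_ge_half m6 by (intro mult_left_mono) auto
    finally show "real m ^ 2 * \<nu> ^ (m - 2) \<le> \<gamma> * (real m / 3 - 1 / 2)" by (simp add: mult.commute)
    show "0 \<le> \<gamma> * (real m / 3 - 1 / 2)" using m6 gam_pos by (intro mult_nonneg_nonneg) auto
    show "0 \<le> avg High (\<lambda>a. dens (Low - nb a))" by (rule avg_nonneg) simp
  qed
  finally show ?thesis by simp
qed

lemma That_third:
  assumes "a \<in> High" shows "\<gamma> / 3 \<le> xo a ^ k * yi a ^ l"
proof -
  have "\<gamma> * (1 / 3) \<le> \<gamma> * (1 - \<nu>) ^ m" using nu_power_ge[OF m6] gam_pos by (intro mult_left_mono) auto
  then show ?thesis using That_ge[OF assms] by simp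
qed

text \<open>Each missing pair between \<open>High\<close> and \<open>Low\<close> costs a first order term.\<close>

lemma High_rescale:
  assumes "a \<in> High"
  obtains d where "0 \<le> d" "d \<le> 1" "yi a \<le> (1 - \<alpha>) * (1 - d)"
    "xo a ^ k * yi a ^ l + \<gamma> * (real m / 3) * miss a \<le> (1 - \<alpha>) ^ m * d ^ k * (1 - d) ^ l"
proof -
  have "0 < xo a + yi a" using xy_ge[OF assms] nu01 by simp
  moreover have miss: "miss a = (1 - \<alpha>) - (xo a + yi a)" using xy_miss[of a] dens_Low by simp
  moreover from miss have "xo a + yi a \<le> 1 - \<alpha>" using xy_nonneg(3)[of a] by linarith
  ultimately obtain d where d: "0 \<le> d" "d \<le> 1" "yi a \<le> (1 - \<alpha>) * (1 - d)"
    "xo a ^ k * yi a ^ l * (1 + real m * miss a) \<le> (1 - \<alpha>) ^ m * d ^ k * (1 - d) ^ l"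
    using rescale[of "xo a" "yi a" "1 - \<alpha>" k l] alpha_bounds by auto
  have "\<gamma> / 3 * (real m * miss a) \<le> xo a ^ k * yi a ^ l * (real m * miss a)"
    using That_third[OF assms] by (intro mult_right_mono) auto
  then have "xo a ^ k * yi a ^ l + \<gamma> * (real m / 3) * miss a \<le> xo a ^ k * yi a ^ l * (1 + real m * miss a)"
    by (simp add: distrib_left mult_ac)
  then show ?thesis using d that by fastforce
qed

end

section \<open>The upper bound for rich digraphs\<close>

lemma OPT_gt_eq:
  assumes "l < k"
  shows "OPT k l = (SUP p\<in>{0..1/2::real} \<times> {0..real k / real (k + l)}.
    case p of (\<alpha>, d) \<Rightarrow> \<alpha> * (1 - \<alpha>) ^ (k + l) * d ^ k * (1 - d) ^ l
      + bmax (k - 1) l * (1 - \<alpha>) * \<alpha> ^ (k + l) * (1 - d))"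
proof -
  have "k - 1 + l = k + l - 1" using assms by simp
  then show ?thesis using assms by (simp add: OPT_def bmax_def)
qed

lemma OPT_eq_eq: "OPT k k = bmax k k * (SUP \<alpha>\<in>{0..1::real}. \<alpha> * (1 - \<alpha>) ^ (k + k) + (1 - \<alpha>) * \<alpha> ^ (k + k))"
proof -
  have "bmax k k = 1 / 2 ^ (2 * k)"
  proof (cases "k = 0")
    case False
    have "real (k + k) ^ (k + k) = 2 ^ (2 * k) * (real k ^ k * real k ^ k)"
      by (simp add: mult_2[symmetric] power_mult_distrib power_add[symmetric])
    then show ?thesis using False by (simp add: bmax_def)
  qed (simp add: bmax_def)
  then show ?thesis by (simp add: OPT_def mult_2)
qed

lemma OPT_gt_bdd:
  "bdd_above ((\<lambda>p. case p of (\<alpha>, d) \<Rightarrow> \<alpha> * (1 - \<alpha>) ^ (k + l) * d ^ k * (1 - d) ^ l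
      + bmax (k - 1) l * (1 - \<alpha>) * \<alpha> ^ (k + l) * (1 - d)) ` ({0..1/2::real} \<times> {0..real k / real (k + l)}))"
proof (rule bdd_aboveI2)
  fix p assume "p \<in> {0..1/2::real} \<times> {0..real k / real (k + l)}"
  then obtain \<alpha> d where p: "p = (\<alpha>, d)" "0 \<le> \<alpha>" "\<alpha> \<le> 1/2" "0 \<le> d" "d \<le> real k / real (k + l)" by auto
  have "real k / real (k + l) \<le> 1" by (cases "k + l = 0") auto
  then have d: "d \<le> 1" using p by simp
  have "\<alpha> * (1 - \<alpha>) ^ (k + l) * d ^ k * (1 - d) ^ l \<le> 1 * 1 * 1 * 1"
    using p d by (intro mult_mono power_le_one) auto
  moreover have "bmax (k - 1) l * (1 - \<alpha>) * \<alpha> ^ (k + l) * (1 - d) \<le> 1 * 1 * 1 * 1"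
    using p d bmax_le_1 bmax_pos[of "k - 1" l] by (intro mult_mono power_le_one mult_nonneg_nonneg) auto
  ultimately show "(case p of (\<alpha>, d) \<Rightarrow> \<alpha> * (1 - \<alpha>) ^ (k + l) * d ^ k * (1 - d) ^ l
      + bmax (k - 1) l * (1 - \<alpha>) * \<alpha> ^ (k + l) * (1 - d)) \<le> 2" by (simp add: p)
qed

text \<open>The range of \<open>d\<close> extends to 1, since beyond \<open>k / (k + l)\<close>
  neither summand exceeds its value at that point.\<close>

lemma OPT_gt_ge:
  assumes "l < k" "0 \<le> \<alpha>" "\<alpha> \<le> 1 / 2" "0 \<le> d" "d \<le> 1"
  shows "\<alpha> * (1 - \<alpha>) ^ (k + l) * d ^ k * (1 - d) ^ l + bmax (k - 1) l * (1 - \<alpha>) * \<alpha> ^ (k + l) * (1 - d) \<le> OPT k l"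
proof -
  let ?f = "\<lambda>d. \<alpha> * (1 - \<alpha>) ^ (k + l) * d ^ k * (1 - d) ^ l + bmax (k - 1) l * (1 - \<alpha>) * \<alpha> ^ (k + l) * (1 - d)"
  have sup: "?f d \<le> OPT k l" if "0 \<le> d" "d \<le> real k / real (k + l)" for d
    unfolding OPT_gt_eq[OF assms(1)]
    using cSUP_upper[OF _ OPT_gt_bdd, of "(\<alpha>, d)" k l] assms that by auto
  show ?thesis
  proof (cases "d \<le> real k / real (k + l)")
    case False
    let ?e = "real k / real (k + l)"
    have e: "0 \<le> ?e" "?e \<le> 1" "?e \<le> d" using False assms(1) by (auto simp: divide_le_eq_1)
    have e': "1 - ?e = real l / real (k + l)" using assms(1) by (simp add: field_simps)
    have "d ^ k * (1 - d) ^ l \<le> bmax k l" using bmax_bound[of d "1 - d" k l] assms by simp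
    also have "\<dots> = ?e ^ k * (1 - ?e) ^ l" unfolding e' by (simp add: bmax_def power_divide power_add)
    finally have "\<alpha> * (1 - \<alpha>) ^ (k + l) * (d ^ k * (1 - d) ^ l) \<le> \<alpha> * (1 - \<alpha>) ^ (k + l) * (?e ^ k * (1 - ?e) ^ l)"
      using assms by (intro mult_left_mono) auto
    moreover have "bmax (k - 1) l * (1 - \<alpha>) * \<alpha> ^ (k + l) * (1 - d) \<le> bmax (k - 1) l * (1 - \<alpha>) * \<alpha> ^ (k + l) * (1 - ?e)"
      using assms e bmax_pos[of "k - 1" l] by (intro mult_left_mono mult_nonneg_nonneg) auto
    ultimately have "?f d \<le> ?f ?e" by (simp add: mult.assoc)
    also have "\<dots> \<le> OPT k l" by (rule sup) auto
    finally show ?thesis .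
  qed (use sup assms in auto)
qed

lemma OPT_eq_bdd:
  "bdd_above ((\<lambda>\<alpha>. \<alpha> * (1 - \<alpha>) ^ j + (1 - \<alpha>) * \<alpha> ^ j) ` {0..1::real})"
proof (rule bdd_aboveI2)
  fix \<alpha> :: real assume a: "\<alpha> \<in> {0..1}"
  have "\<alpha> * (1 - \<alpha>) ^ j \<le> 1 * 1" by (rule mult_mono) (use a in \<open>auto intro: power_le_one\<close>)
  moreover have "(1 - \<alpha>) * \<alpha> ^ j \<le> 1 * 1" by (rule mult_mono) (use a in \<open>auto intro: power_le_one\<close>)
  ultimately show "\<alpha> * (1 - \<alpha>) ^ j + (1 - \<alpha>) * \<alpha> ^ j \<le> 2" by simp
qed

lemma OPT_eq_ge:
  assumes "0 \<le> \<alpha>" "\<alpha> \<le> 1"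
  shows "bmax k k * (\<alpha> * (1 - \<alpha>) ^ (k + k) + (1 - \<alpha>) * \<alpha> ^ (k + k)) \<le> OPT k k"
  unfolding OPT_eq_eq using assms bmax_pos[of k k]
  by (intro mult_left_mono cSUP_upper OPT_eq_bdd) auto

text \<open>Insert \<open>\<alpha> = 1 / (k + l + 1)\<close> and, for \<open>k > l\<close>,
  \<open>d = k / (k + l)\<close>; then drop the second summand.\<close>

lemma OPT_ge_theta:
  assumes "l \<le> k" "1 \<le> l"
  shows "bmax k l * theta (k + l) \<le> real (k + l + 1) * OPT k l"
proof -
  define \<alpha> where "\<alpha> = 1 / real (k + l + 1)"
  have a: "0 \<le> \<alpha>" "\<alpha> \<le> 1 / 2" "1 - \<alpha> = real (k + l) / real (k + l + 1)" "real (k + l + 1) * \<alpha> = 1"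
    using assms by (auto simp: \<alpha>_def field_simps)
  have th: "(1 - \<alpha>) ^ (k + l) = theta (k + l)" by (simp only: a(3) theta_def)
  have "\<alpha> * (1 - \<alpha>) ^ (k + l) * bmax k l \<le> OPT k l"
  proof (cases "k = l")
    case True
    have "bmax l l * (\<alpha> * (1 - \<alpha>) ^ (l + l) + 0) \<le> bmax l l * (\<alpha> * (1 - \<alpha>) ^ (l + l) + (1 - \<alpha>) * \<alpha> ^ (l + l))"
      using a bmax_pos[of l l] by (intro mult_left_mono add_left_mono) auto
    also have "\<dots> \<le> OPT l l" by (rule OPT_eq_ge) (use a in auto)
    finally show ?thesis using True by (simp add: mult_ac)
  next
    case False
    let ?e = "real k / real (k + l)"
    have e: "0 \<le> ?e" "?e \<le> 1" "1 - ?e = real l / real (k + l)" using assms by (auto simp: field_simps)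
    have "\<alpha> * (1 - \<alpha>) ^ (k + l) * bmax k l = \<alpha> * (1 - \<alpha>) ^ (k + l) * ?e ^ k * (1 - ?e) ^ l"
      unfolding e(3) by (simp add: bmax_def power_divide power_add)
    also have "\<dots> \<le> \<dots> + bmax (k - 1) l * (1 - \<alpha>) * \<alpha> ^ (k + l) * (1 - ?e)"
      using a e(2) bmax_pos[of "k - 1" l] by simp
    also have "\<dots> \<le> OPT k l" by (rule OPT_gt_ge) (use a e False assms in auto)
    finally show ?thesis .
  qed
  then have "real (k + l + 1) * (\<alpha> * (1 - \<alpha>) ^ (k + l) * bmax k l) \<le> real (k + l + 1) * OPT k l"
    by (intro mult_left_mono) auto
  also have "real (k + l + 1) * (\<alpha> * (1 - \<alpha>) ^ (k + l) * bmax k l) = real (k + l + 1) * \<alpha> * (bmax k l * theta (k + l))"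
    unfolding th by (simp only: mult_ac)
  also have "\<dots> = bmax k l * theta (k + l)" unfolding a(4) by simp
  finally show ?thesis .
qed

text \<open>If \<open>X\<close> keeps more than the share \<open>1 - \<delta>\<close> of
  \<open>x\<close>, then \<open>x + y <= 1\<close> forces \<open>Y\<close> down to at most that
  share of \<open>y\<close>. Which coordinate shrinks is unknown, so both exponents must be
  positive.\<close>

lemma power_prod_loss:
  fixes X Y x y \<delta> :: real
  assumes "0 \<le> X" "X \<le> x" "0 \<le> Y" "Y \<le> y" "x + y \<le> 1" "X + Y \<le> x + y - \<delta>" "0 \<le> \<delta>" "\<delta> \<le> 1" "1 \<le> p" "1 \<le> q"
  shows "X ^ p * Y ^ q \<le> x ^ p * y ^ q * (1 - \<delta>)"
proof -
  have pw: "(z * (1 - \<delta>)) ^ j \<le> z ^ j * (1 - \<delta>)" if "0 \<le> z" "1 \<le> j" for z :: real and j :: nat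
  proof -
    have "(1 - \<delta>) ^ j \<le> (1 - \<delta>) ^ 1" using assms that by (intro power_decreasing) auto
    then show ?thesis using that by (simp add: power_mult_distrib mult_left_mono)
  qed
  show ?thesis
  proof (cases "X \<le> x * (1 - \<delta>)")
    case True
    have "X ^ p \<le> x ^ p * (1 - \<delta>)"
      using power_mono[OF True assms(1), of p] pw[of x p] assms by linarith
    moreover have "Y ^ q \<le> y ^ q" using assms by (intro power_mono)
    ultimately have "X ^ p * Y ^ q \<le> (x ^ p * (1 - \<delta>)) * y ^ q" using assms by (intro mult_mono) auto
    then show ?thesis by (simp add: mult_ac)
  next
    case False
    have "\<delta> * y \<le> \<delta> * (1 - x)" using assms by (intro mult_left_mono) auto
    then have le: "Y \<le> y * (1 - \<delta>)" using False assms by (simp add: algebra_simps)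
    have "Y ^ q \<le> y ^ q * (1 - \<delta>)"
      using power_mono[OF le assms(3), of q] pw[of y q] assms by linarith
    moreover have "X ^ p \<le> x ^ p" using assms by (intro power_mono)
    ultimately have "X ^ p * Y ^ q \<le> x ^ p * (y ^ q * (1 - \<delta>))" using assms by (intro mult_mono) auto
    then show ?thesis by (simp add: mult_ac)
  qed
qed

text \<open>Neighbours of \<open>a\<close> inside \<open>High\<close>, of density \<open>z\<close>,
  may add \<open>z\<close> to the in-density of \<open>a\<close> but remove \<open>z\<close> from
  the choices of the other leaves. With \<open>t = z / \<alpha>\<close>, Bernoulli bounds the gain
  by \<open>(1 + t)^M\<close>, and \<open>(1 - t) (1 + t) <= 1\<close> shows that it never
  pays.\<close>

lemma shrink_gain:
  fixes y z \<alpha> :: real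
  assumes "0 \<le> z" "z \<le> \<alpha>" "\<alpha> \<le> real M * y" "1 \<le> M" "0 \<le> y"
  shows "(\<alpha> - z) ^ M * (y + z) \<le> \<alpha> ^ M * y"
proof (cases "\<alpha> = 0")
  case False
  then have a: "\<alpha> > 0" using assms by simp
  define t where "t = z / \<alpha>"
  have t: "0 \<le> t" "t \<le> 1" "z = \<alpha> * t" using assms a by (auto simp: t_def)
  have "y + z \<le> y * (1 + real M * t)"
    using mult_right_mono[OF assms(3) t(1)] unfolding t(3) by (simp add: algebra_simps)
  also have "\<dots> \<le> y * (1 + t) ^ M" using t assms by (intro mult_left_mono Bernoulli_inequality) auto
  finally have "(\<alpha> - z) ^ M * (y + z) \<le> (\<alpha> - z) ^ M * (y * (1 + t) ^ M)"
    using assms by (intro mult_left_mono) auto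
  also have "\<dots> = \<alpha> ^ M * y * ((1 - t) * (1 + t)) ^ M"
  proof -
    have "\<alpha> - z = \<alpha> * (1 - t)" by (simp add: t(3) algebra_simps)
    then show ?thesis by (simp add: power_mult_distrib mult_ac)
  qed
  also have "\<dots> \<le> \<alpha> ^ M * y * 1"
  proof (intro mult_left_mono power_le_one)
    show "(1 - t) * (1 + t) \<le> 1" using t by (simp add: algebra_simps)
  qed (use t a assms in auto)
  finally show ?thesis by simp
qed (use assms in auto)

context rich_star_graph
begin

definition lamA :: "nat \<Rightarrow> nat \<Rightarrow> real" where
  "lamA a b = dens (nb b \<inter> ((Out a \<union> In a) \<inter> Low))"

definition zz :: "nat \<Rightarrow> real" where "zz a = dens (nb a \<inter> High)"

section \<open>Lower bounds for the density of \<open>High\<close> and for the in-densities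
  \<open>yi\<close>\<close>

lemma s_ge: "\<gamma> * theta m / real (m + 1) \<le> s_density k l n E"
proof -
  have "avg {0..<n} (\<lambda>_. \<gamma> * theta m) \<le> avg {0..<n} vstars" using rich by (intro avg_mono) auto
  then have "\<gamma> * theta m \<le> real (m + 1) * s_density k l n E"
    using sum_vstars by (simp add: avg_const dens_V avg_def)
  then show ?thesis by (simp add: pos_divide_le_eq mult.commute)
qed

lemma cstars_Low_le: "cstars b Low \<le> \<gamma> * lam b ^ m"
  using cstars_le[of Low b] by (simp add: lam_def)

lemma cstars_High_le: "cstars c High \<le> \<gamma> * \<alpha> ^ m"
proof -
  have "dens (nb c \<inter> High) \<le> \<alpha>" unfolding \<alpha>_def by (intro dens_mono) auto
  then have "\<gamma> * dens (nb c \<inter> High) ^ m \<le> \<gamma> * \<alpha> ^ m" using gam_pos by (intro mult_left_mono power_mono) auto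
  then show ?thesis using cstars_le[of High c] by simp
qed

text \<open>The bonus per missing pair is what stretching to the full density of \<open>Low\<close>
  gains, so \<open>base a\<close> still obeys the bound for a complete bipartite
  orientation.\<close>

definition base :: "nat \<Rightarrow> real" where
  "base a = xo a ^ k * yi a ^ l + \<gamma> * (real m / 3) * miss a"

lemma window: "s_density k l n E \<le> avg High base + \<gamma> * (2 * \<nu> ^ m)"
proof -
  have "avg Low (\<lambda>b. cstars b Low) \<le> avg Low (\<lambda>b. \<gamma> * \<nu> ^ m)"
  proof (rule avg_mono)
    fix b assume b: "b \<in> Low"
    have "\<gamma> * lam b ^ m \<le> \<gamma> * \<nu> ^ m" using lam_le[OF b] gam_pos by (intro mult_left_mono power_mono) auto
    then show "cstars b Low \<le> \<gamma> * \<nu> ^ m" using cstars_Low_le[of b] by simp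
  qed
  also have "\<dots> \<le> \<gamma> * \<nu> ^ m"
    using gam_pos nu01 dens_le_1[OF HL(4)] by (simp add: avg_const mult_left_le)
  finally have 1: "avg Low (\<lambda>b. cstars b Low) \<le> \<gamma> * \<nu> ^ m" .
  have "avg {0..<n} (\<lambda>c. cstars c High) \<le> avg {0..<n} (\<lambda>c. \<gamma> * \<alpha> ^ m)" by (intro avg_mono cstars_High_le)
  also have "\<dots> = \<gamma> * \<alpha> ^ m" by (simp add: avg_const dens_V)
  also have "\<dots> \<le> \<gamma> * \<nu> ^ m" using alpha_bounds gam_pos by (intro mult_left_mono power_mono) auto
  finally have 2: "avg {0..<n} (\<lambda>c. cstars c High) \<le> \<gamma> * \<nu> ^ m" .
  have "avg High (\<lambda>a. cstars a Low) + \<gamma> * (real m / 3 - 1 / 2) * avg High miss \<le> avg High base"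
  proof -
    have "avg High (\<lambda>a. cstars a Low) \<le> avg High (\<lambda>a. xo a ^ k * yi a ^ l)"
      using cstars0[of Low] by (intro avg_mono) (simp add: xo_def yi_def)
    moreover have "0 \<le> \<gamma> * (1 / 2) * avg High miss" using gam_pos by (intro mult_nonneg_nonneg avg_nonneg) auto
    ultimately show ?thesis unfolding base_def avg_add avg_cmult by (simp add: algebra_simps)
  qed
  then show ?thesis using s_split 1 2 by simp
qed

lemma base_le: assumes "a \<in> High" shows "base a \<le> \<gamma> * (1 - \<alpha>) ^ m"
proof -
  obtain d where d: "0 \<le> d" "d \<le> 1" "base a \<le> (1 - \<alpha>) ^ m * d ^ k * (1 - d) ^ l"
    using High_rescale[OF assms] unfolding base_def by metis
  have "(1 - \<alpha>) ^ m * (d ^ k * (1 - d) ^ l) \<le> (1 - \<alpha>) ^ m * \<gamma>"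
    using bmax_bound[of d "1 - d" k l] d alpha_bounds nu01 by (intro mult_left_mono) auto
  then show ?thesis using d(3) by (simp add: mult_ac)
qed

lemma alpha_ge: "(1 - 1 / (3 * real m)) / real (m + 1) \<le> \<alpha>"
proof (rule ccontr)
  assume "\<not> ?thesis"
  then have "\<alpha> * (1 - \<alpha>) ^ m + 2 * \<nu> ^ m < theta m / real (m + 1)"
    using alpha_bounds by (intro num_window[OF m6]) auto
  then have "\<gamma> * (\<alpha> * (1 - \<alpha>) ^ m + 2 * \<nu> ^ m) < \<gamma> * (theta m / real (m + 1))"
    using gam_pos by (intro mult_strict_left_mono)
  moreover have "avg High base \<le> avg High (\<lambda>_. \<gamma> * (1 - \<alpha>) ^ m)" by (intro avg_mono base_le)
  then have "avg High base \<le> \<gamma> * (\<alpha> * (1 - \<alpha>) ^ m)" by (simp add: avg_const \<alpha>_def mult_ac)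
  ultimately show False using s_ge window by (simp add: distrib_left)
qed

lemma alpha_pos: "\<alpha> > 0"
proof -
  have "0 < (1 - 1 / (3 * real m)) / real (m + 1)" using m6 by (intro divide_pos_pos) (auto simp: field_simps)
  then show ?thesis using alpha_ge by linarith
qed

lemma That_pos_third: "a \<in> High \<Longrightarrow> \<gamma> / 3 < xo a ^ k * yi a ^ l"
proof -
  assume "a \<in> High"
  have "\<gamma> * (1 / 3) \<le> \<gamma> * (1 - \<nu>) ^ m" using nu_power_ge[OF m6] gam_pos by (intro mult_left_mono) auto
  then show ?thesis using That_ge[OF \<open>a \<in> High\<close>] by simp
qed

lemma xy_le: "xo a + yi a \<le> 1 - \<alpha>"
  using xy_miss[of a] xy_nonneg(3)[of a] dens_Low by linarith

text \<open>If \<open>yi a < \<alpha> / 2\<close>, then \<open>yi a\<close> is less than a third of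
  \<open>yi a + \<alpha>\<close>. Enlarging it by \<open>\<alpha>\<close> keeps the total density at
  most 1, so \<open>xo a ^ k * yi a ^ l\<close> would be at most
  \<open>\<gamma> / 3\<close>.\<close>

lemma yi_ge: assumes "a \<in> High" shows "\<alpha> / 2 \<le> yi a"
proof (rule ccontr)
  assume "\<not> \<alpha> / 2 \<le> yi a"
  then have y: "yi a \<le> (yi a + \<alpha>) * (1 / 3)" by simp
  have "xo a ^ k * yi a ^ l \<le> xo a ^ k * ((yi a + \<alpha>) * (1 / 3)) ^ l"
    using y by (intro mult_left_mono power_mono) auto
  also have "\<dots> = xo a ^ k * (yi a + \<alpha>) ^ l * (1 / 3) ^ l" by (simp only: power_mult_distrib mult.assoc)
  also have "\<dots> \<le> (\<gamma> * 1) * (1 / 3) ^ 1"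
  proof (rule mult_mono)
    have "xo a ^ k * (yi a + \<alpha>) ^ l \<le> \<gamma> * (xo a + (yi a + \<alpha>)) ^ m"
      using alpha_bounds by (intro bmax_bound) auto
    also have "\<dots> \<le> \<gamma> * 1" using xy_le[of a] alpha_bounds gam_pos by (intro mult_left_mono power_le_one) auto
    finally show "xo a ^ k * (yi a + \<alpha>) ^ l \<le> \<gamma> * 1" .
    show "(1 / 3 :: real) ^ l \<le> (1 / 3) ^ 1" using kl by (intro power_decreasing) auto
  qed (use gam_pos in auto)
  finally show False using That_pos_third[OF assms] by simp
qed

section \<open>Stars destroyed and created by edges inside \<open>Low\<close>\<close>

lemma card_minus_nb:
  "dens (Out a \<inter> Low - nb b) + dens (In a \<inter> Low - nb b) \<le> xo a + yi a - lamA a b"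
proof -
  have "dens (Out a \<inter> Low - nb b) + dens (In a \<inter> Low - nb b) = dens ((Out a \<union> In a) \<inter> Low - nb b \<inter> ((Out a \<union> In a) \<inter> Low))"
    using Out_In_disj[of a] by (subst dens_Un_disj[symmetric]) (auto intro!: arg_cong[of _ _ dens])
  also have "\<dots> = dens ((Out a \<union> In a) \<inter> Low) - lamA a b"
    unfolding lamA_def by (rule dens_Diff) auto
  also have "dens ((Out a \<union> In a) \<inter> Low) = xo a + yi a"
    unfolding xo_def yi_def using Out_In_disj[of a]
    by (subst dens_Un_disj[symmetric]) (auto intro!: arg_cong[of _ _ dens])
  finally show ?thesis by simp
qed

lemma lamA_01: "0 \<le> lamA a b" "lamA a b \<le> 1"
  unfolding lamA_def by (auto intro!: dens_le_1 dest: subsetD[OF nb_sub])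

lemma xy_le_1: "xo a + yi a \<le> 1" "xo a \<le> 1" "yi a \<le> 1"
  using xy_le[of a] alpha_bounds xy_nonneg(1,2)[of a] by linarith+

text \<open>A first out-leaf \<open>b\<close> removes density \<open>lamA a b\<close> from the
  remaining choices; \<open>power_prod_loss\<close> makes this a relative loss, and summing over
  \<open>b\<close> averages it.\<close>

lemma out_loss:
  "cstars a Low \<le> xo a ^ k * yi a ^ l - xo a ^ k * yi a ^ l * avg (Out a \<inter> Low) (lamA a)"
proof -
  have "cstars a Low \<le> avg (Out a \<inter> Low) (\<lambda>b. dens (Out a \<inter> Low - nb b) ^ (k - 1) * dens (In a \<inter> Low - nb b) ^ l)"
    using cstars_out_first[OF fin(2), of a] by (simp add: avg_def)
  also have "\<dots> \<le> avg (Out a \<inter> Low) (\<lambda>b. xo a ^ (k - 1) * yi a ^ l * (1 - lamA a b))"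
    using card_minus_nb[of a] lamA_01 xy_le_1[of a] kl
    by (intro avg_mono power_prod_loss) (auto simp: xo_def yi_def intro!: dens_mono)
  also have "\<dots> = xo a ^ (k - 1) * yi a ^ l * (xo a - avg (Out a \<inter> Low) (lamA a))"
    by (simp add: avg_cmult avg_diff avg_one xo_def)
  also have "\<dots> = xo a ^ k * yi a ^ l - xo a ^ (k - 1) * yi a ^ l * avg (Out a \<inter> Low) (lamA a)"
  proof -
    have "xo a ^ k = xo a ^ (k - 1) * xo a" using kl by (simp flip: power_Suc2)
    then show ?thesis by (simp add: algebra_simps)
  qed
  also have "\<dots> \<le> xo a ^ k * yi a ^ l - xo a ^ k * yi a ^ l * avg (Out a \<inter> Low) (lamA a)"
    using xy_le_1[of a] lamA_01
    by (intro diff_left_mono mult_right_mono power_decreasing avg_nonneg) auto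
  finally show ?thesis .
qed

text \<open>A fixed in-leaf leaves \<open>l - 1\<close> others, and \<open>power_prod_loss\<close>
  requires this exponent to be positive: the reason for \<open>2 <= l\<close>.\<close>

lemma in_loss:
  assumes "2 \<le> l"
  shows "cstars a Low \<le> xo a ^ k * yi a ^ l - xo a ^ k * yi a ^ l * avg (In a \<inter> Low) (lamA a)"
proof -
  have "cstars a Low \<le> avg (In a \<inter> Low) (\<lambda>b. dens (Out a \<inter> Low - nb b) ^ k * dens (In a \<inter> Low - nb b) ^ (l - 1))"
    using cstars_in_first[OF fin(2), of a] by (simp add: avg_def)
  also have "\<dots> \<le> avg (In a \<inter> Low) (\<lambda>b. xo a ^ k * yi a ^ (l - 1) * (1 - lamA a b))"
    using card_minus_nb[of a] lamA_01 xy_le_1[of a] kl assms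
    by (intro avg_mono power_prod_loss) (auto simp: xo_def yi_def intro!: dens_mono)
  also have "\<dots> = xo a ^ k * yi a ^ (l - 1) * (yi a - avg (In a \<inter> Low) (lamA a))"
    by (simp add: avg_cmult avg_diff avg_one yi_def)
  also have "\<dots> = xo a ^ k * yi a ^ l - xo a ^ k * yi a ^ (l - 1) * avg (In a \<inter> Low) (lamA a)"
  proof -
    have "yi a ^ l = yi a ^ (l - 1) * yi a" using kl by (simp flip: power_Suc2)
    then show ?thesis by (simp add: algebra_simps)
  qed
  also have "\<dots> \<le> xo a ^ k * yi a ^ l - xo a ^ k * yi a ^ l * avg (In a \<inter> Low) (lamA a)"
    using xy_le_1[of a] lamA_01
    by (intro diff_left_mono mult_right_mono mult_left_mono power_decreasing avg_nonneg) auto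
  finally show ?thesis .
qed

abbreviation Mis :: "nat \<Rightarrow> nat set" where "Mis a \<equiv> Low - (Out a \<union> In a)"

lemma avg_Mis: "avg (Mis a) lam \<le> \<nu> * miss a"
proof -
  have "avg (Mis a) lam \<le> avg (Mis a) (\<lambda>_. \<nu>)" by (intro avg_mono lam_le) auto
  then show ?thesis by (simp add: avg_const miss_def)
qed

text \<open>The edges overlooked by \<open>lamA a\<close> end in \<open>Mis a\<close>; counted from
  that side there are at most \<open>\<nu>\<close> per vertex, by \<open>lam_le\<close>.\<close>

lemma lamA_avg:
  assumes "S \<subseteq> Low"
  shows "avg S lam \<le> avg S (lamA a) + \<nu> * miss a"
proof -
  have "lam b \<le> lamA a b + dens {w \<in> Mis a. w \<in> nb b}" for b
  proof -
    have "lam b \<le> dens (nb b \<inter> ((Out a \<union> In a) \<inter> Low) \<union> {w \<in> Mis a. w \<in> nb b})"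
      unfolding lam_def by (intro dens_mono) auto
    also have "\<dots> = lamA a b + dens {w \<in> Mis a. w \<in> nb b}"
      unfolding lamA_def by (rule dens_Un_disj) auto
    finally show ?thesis .
  qed
  then have "avg S lam \<le> avg S (\<lambda>b. lamA a b + dens {w \<in> Mis a. w \<in> nb b})" by (intro avg_mono)
  also have "\<dots> = avg S (lamA a) + avg S (\<lambda>b. dens {w \<in> Mis a. w \<in> nb b})" by (rule avg_add)
  also have "avg S (\<lambda>b. dens {w \<in> Mis a. w \<in> nb b}) \<le> avg Low (\<lambda>b. dens {w \<in> Mis a. w \<in> nb b})"
    by (intro avg_subset assms) auto
  also have "\<dots> = avg (Mis a) (\<lambda>w. dens {b \<in> Low. w \<in> nb b})"
    by (rule avg_dens_swap) auto
  also have "\<dots> = avg (Mis a) lam"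
  proof -
    have "{b \<in> Low. w \<in> nb b} = nb w \<inter> Low" for w using nb_sym[of w] by auto
    then show ?thesis by (simp add: avg_def lam_def)
  qed
  also have "\<dots> \<le> \<nu> * miss a" by (rule avg_Mis)
  finally show ?thesis by simp
qed

lemma High_Low_loss:
  assumes "2 \<le> l"
  shows "avg High (\<lambda>a. cstars a Low) \<le> avg High (\<lambda>a. xo a ^ k * yi a ^ l)
    - \<gamma> / 6 * (\<alpha> * avg Low lam - 2 * \<nu> * avg High miss)"
proof -
  have "avg High (\<lambda>a. cstars a Low) \<le> avg High (\<lambda>a. xo a ^ k * yi a ^ l - \<gamma> / 6 * (avg Low lam - 2 * \<nu> * miss a))"
  proof (rule avg_mono)
    fix a assume a: "a \<in> High"
    let ?T = "xo a ^ k * yi a ^ l"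
    let ?N = "(Out a \<inter> Low) \<union> (In a \<inter> Low)"
    have "avg Low lam = avg (?N \<union> Mis a) lam" by (rule arg_cong[of _ _ "\<lambda>S. avg S lam"]) auto
    also have "\<dots> = avg ?N lam + avg (Mis a) lam" by (rule avg_Un) auto
    finally have "avg Low lam - 2 * \<nu> * miss a \<le> avg ?N (lamA a)"
      using lamA_avg[of ?N a] avg_Mis[of a] by simp
    also have "\<dots> = avg (Out a \<inter> Low) (lamA a) + avg (In a \<inter> Low) (lamA a)"
      by (rule avg_Un) (use Out_In_disj[of a] in auto)
    finally have 1: "\<gamma> / 6 * (avg Low lam - 2 * \<nu> * miss a) \<le> \<gamma> / 6 * (avg (Out a \<inter> Low) (lamA a) + avg (In a \<inter> Low) (lamA a))"
      using gam_pos by (intro mult_left_mono) auto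
    \<comment> \<open>The mean of the out-leaf and the in-leaf bound is taken: half of each loss is
      kept, and together they cover all vertices of \<open>Low\<close> outside
      \<open>Mis a\<close>.\<close>
    have "\<gamma> / 6 * (avg (Out a \<inter> Low) (lamA a) + avg (In a \<inter> Low) (lamA a)) \<le> ?T / 2 * (avg (Out a \<inter> Low) (lamA a) + avg (In a \<inter> Low) (lamA a))"
      using That_third[OF a] lamA_01 by (intro mult_right_mono add_nonneg_nonneg avg_nonneg) auto
    then show "cstars a Low \<le> ?T - \<gamma> / 6 * (avg Low lam - 2 * \<nu> * miss a)"
      using 1 out_loss[of a] in_loss[OF assms, of a] by (simp add: algebra_simps)
  qed
  also have "\<dots> = avg High (\<lambda>a. xo a ^ k * yi a ^ l) - \<gamma> / 6 * (\<alpha> * avg Low lam - 2 * \<nu> * avg High miss)"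
    by (simp only: avg_diff avg_cmult avg_const \<alpha>_def[symmetric]) (simp add: mult.commute)
  finally show ?thesis .
qed

lemma Low_Low_gain: "avg Low (\<lambda>b. cstars b Low) \<le> \<gamma> * \<nu> ^ (m - 1) * avg Low lam"
proof -
  have "avg Low (\<lambda>b. cstars b Low) \<le> avg Low (\<lambda>b. \<gamma> * \<nu> ^ (m - 1) * lam b)"
  proof (rule avg_mono)
    fix b assume b: "b \<in> Low"
    have "lam b ^ m = lam b ^ (m - 1) * lam b" using kl by (simp flip: power_Suc2)
    also have "\<dots> \<le> \<nu> ^ (m - 1) * lam b" using lam_le[OF b] by (intro mult_right_mono power_mono) auto
    finally have "\<gamma> * lam b ^ m \<le> \<gamma> * (\<nu> ^ (m - 1) * lam b)" using gam_pos by (intro mult_left_mono) auto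
    then show "cstars b Low \<le> \<gamma> * \<nu> ^ (m - 1) * lam b" using cstars_Low_le[of b] by (simp add: mult.assoc)
  qed
  then show ?thesis by (simp add: avg_cmult)
qed

lemma Low_balance:
  assumes "2 \<le> l"
  shows "avg High (\<lambda>a. cstars a Low) + avg Low (\<lambda>b. cstars b Low) \<le> avg High (\<lambda>a. xo a ^ k * yi a ^ l) + \<gamma> / 4 * avg High miss"
proof -
  have L: "0 \<le> avg Low lam" "0 \<le> avg High miss" by (auto intro: avg_nonneg)
  have "6 * \<nu> ^ (m - 1) \<le> \<alpha>" using num_alpha[OF m6] alpha_ge by linarith
  then have "\<gamma> * (6 * \<nu> ^ (m - 1)) * avg Low lam \<le> \<gamma> * \<alpha> * avg Low lam"
    using gam_pos L by (intro mult_right_mono mult_left_mono) auto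
  moreover have "\<gamma> / 3 * \<nu> * avg High miss \<le> \<gamma> / 3 * (3 / 4) * avg High miss"
    using gam_pos L nu01 by (intro mult_right_mono mult_left_mono) auto
  ultimately show ?thesis using High_Low_loss[OF assms] Low_Low_gain by (simp add: algebra_simps)
qed

lemma avg_miss_nonneg: "0 \<le> \<gamma> * avg High miss"
  using gam_pos by (intro mult_nonneg_nonneg avg_nonneg) auto

section \<open>Stars with all leaves in \<open>High\<close>, and the case
  \<open>2 <= l < k\<close>\<close>

lemma zz_bounds: "0 \<le> zz a" "zz a \<le> \<alpha>"
  unfolding zz_def \<alpha>_def by (auto intro: dens_mono)

lemma dens_minus_nb:
  assumes "finite Z"
  shows "dens (Out c \<inter> Z - nb a) + dens (In c \<inter> Z - nb a) \<le> dens Z - dens (nb a \<inter> Z)"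
proof -
  have "dens (Out c \<inter> Z - nb a) + dens (In c \<inter> Z - nb a) \<le> dens (nb c \<inter> Z - nb a)"
    by (rule dens_Out_In_minus)
  also have "\<dots> \<le> dens (Z - nb a \<inter> Z)" using assms by (intro dens_mono) auto
  also have "\<dots> = dens Z - dens (nb a \<inter> Z)" using assms by (intro dens_Diff) auto
  finally show ?thesis .
qed

definition C :: real where "C = bmax (k - 1) l"

lemma C_pos: "C > 0" by (simp add: C_def bmax_pos)

lemma out_first:
  assumes "finite Z"
  shows "cstars c Z \<le> avg {a \<in> Z. a \<in> Out c} (\<lambda>a. C * (dens Z - dens (nb a \<inter> Z)) ^ (m - 1))"
proof -
  have "{a \<in> Z. a \<in> Out c} = Out c \<inter> Z" by auto
  then have "cstars c Z \<le> avg {a \<in> Z. a \<in> Out c} (\<lambda>b. dens (Out c \<inter> Z - nb b) ^ (k - 1) * dens (In c \<inter> Z - nb b) ^ l)"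
    using cstars_out_first[OF assms, of c] by (simp add: avg_def)
  also have "\<dots> \<le> avg {a \<in> Z. a \<in> Out c} (\<lambda>a. C * (dens Z - dens (nb a \<inter> Z)) ^ (m - 1))"
  proof (rule avg_mono)
    fix b
    let ?x = "dens (Out c \<inter> Z - nb b)" and ?y = "dens (In c \<inter> Z - nb b)"
    have "?x ^ (k - 1) * ?y ^ l \<le> C * (?x + ?y) ^ (k - 1 + l)" unfolding C_def by (rule bmax_bound) auto
    also have "\<dots> \<le> C * (dens Z - dens (nb b \<inter> Z)) ^ (k - 1 + l)"
      using dens_minus_nb[OF assms, of c b] C_pos by (intro mult_left_mono power_mono) auto
    finally show "?x ^ (k - 1) * ?y ^ l \<le> C * (dens Z - dens (nb b \<inter> Z)) ^ (m - 1)" using kl by simp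
  qed
  finally show ?thesis .
qed

lemma High_out_first:
  "cstars c High \<le> avg {a \<in> High. a \<in> Out c} (\<lambda>a. C * (\<alpha> - zz a) ^ (m - 1))"
  using out_first[OF fin(1)] by (simp add: \<alpha>_def zz_def)

lemma dens_In_High: "dens {c \<in> High. a \<in> Out c} \<le> zz a"
  unfolding zz_def using Out_iff_In In_sub by (intro dens_mono) auto

text \<open>After exchanging the sums, a first out-leaf \<open>a\<close> has possible centres of
  density at most \<open>yi a + zz a\<close>. \<open>shrink_gain\<close> absorbs
  \<open>zz a\<close>, and its hypothesis comes from \<open>yi_ge\<close>.\<close>

lemma High_High_gain: "avg {0..<n} (\<lambda>c. cstars c High) \<le> C * \<alpha> ^ (m - 1) * avg High yi"
proof -
  have "avg {0..<n} (\<lambda>c. cstars c High) \<le> avg {0..<n} (\<lambda>c. avg {a \<in> High. a \<in> Out c} (\<lambda>a. C * (\<alpha> - zz a) ^ (m - 1)))"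
    by (intro avg_mono High_out_first)
  also have "\<dots> = avg High (\<lambda>a. avg {c \<in> {0..<n}. a \<in> Out c} (\<lambda>_. C * (\<alpha> - zz a) ^ (m - 1)))"
    by (rule avg_swap) auto
  also have "\<dots> \<le> avg High (\<lambda>a. C * \<alpha> ^ (m - 1) * yi a)"
  proof (rule avg_mono)
    fix a assume a: "a \<in> High"
    have "{c \<in> {0..<n}. a \<in> Out c} = {c \<in> High. a \<in> Out c} \<union> (In a \<inter> Low)"
      unfolding HL(1)[symmetric] using Out_iff_In[of a] by auto
    moreover have "dens ({c \<in> High. a \<in> Out c} \<union> (In a \<inter> Low)) = dens {c \<in> High. a \<in> Out c} + yi a"
      unfolding yi_def using HL(2) by (intro dens_Un_disj) auto
    ultimately have d: "dens {c \<in> {0..<n}. a \<in> Out c} \<le> yi a + zz a" using dens_In_High[of a] by simp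
    have "\<alpha> \<le> 2 * yi a" using yi_ge[OF a] by simp
    also have "\<dots> \<le> real (m - 1) * yi a" using kl by (intro mult_right_mono) auto
    finally have le: "(\<alpha> - zz a) ^ (m - 1) * (yi a + zz a) \<le> \<alpha> ^ (m - 1) * yi a"
      using zz_bounds[of a] kl by (intro shrink_gain) auto
    have "C * (\<alpha> - zz a) ^ (m - 1) * dens {c \<in> {0..<n}. a \<in> Out c} \<le> C * (\<alpha> - zz a) ^ (m - 1) * (yi a + zz a)"
      using d C_pos zz_bounds[of a] by (intro mult_left_mono) auto
    also have "\<dots> \<le> C * (\<alpha> ^ (m - 1) * yi a)" using le C_pos by (simp add: mult.assoc)
    finally show "avg {c \<in> {0..<n}. a \<in> Out c} (\<lambda>_. C * (\<alpha> - zz a) ^ (m - 1)) \<le> C * \<alpha> ^ (m - 1) * yi a"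
      by (simp add: avg_const mult.assoc)
  qed
  finally show ?thesis by (simp add: avg_cmult)
qed

lemma OPT_bound_gt:
  assumes "l < k"
  shows "avg High (\<lambda>a. base a + C * \<alpha> ^ (m - 1) * yi a) \<le> OPT k l"
proof -
  have "avg High (\<lambda>a. base a + C * \<alpha> ^ (m - 1) * yi a) \<le> avg High (\<lambda>_. OPT k l / \<alpha>)"
  proof (rule avg_mono)
    fix a assume a: "a \<in> High"
    obtain d where d: "0 \<le> d" "d \<le> 1" "yi a \<le> (1 - \<alpha>) * (1 - d)" "base a \<le> (1 - \<alpha>) ^ m * d ^ k * (1 - d) ^ l"
      using High_rescale[OF a] unfolding base_def by metis
    have "C * \<alpha> ^ (m - 1) * yi a \<le> C * \<alpha> ^ (m - 1) * ((1 - \<alpha>) * (1 - d))"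
      using d C_pos alpha_pos by (intro mult_left_mono) auto
    from add_mono[OF d(4) this]
    have "\<alpha> * (base a + C * \<alpha> ^ (m - 1) * yi a) \<le> \<alpha> * ((1 - \<alpha>) ^ m * d ^ k * (1 - d) ^ l + C * \<alpha> ^ (m - 1) * ((1 - \<alpha>) * (1 - d)))"
      by (rule mult_left_mono) (use alpha_pos in simp)
    also have "\<dots> = \<alpha> * (1 - \<alpha>) ^ m * d ^ k * (1 - d) ^ l + C * (1 - \<alpha>) * \<alpha> ^ m * (1 - d)"
    proof -
      have "\<alpha> ^ m = \<alpha> * \<alpha> ^ (m - 1)" using kl by (simp flip: power_Suc)
      then show ?thesis by (simp add: algebra_simps)
    qed
    also have "\<dots> \<le> OPT k l"
      unfolding C_def by (rule OPT_gt_ge) (use assms alpha_bounds nu01 d in auto)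
    finally show "base a + C * \<alpha> ^ (m - 1) * yi a \<le> OPT k l / \<alpha>"
      using alpha_pos by (simp add: pos_le_divide_eq mult.commute)
  qed
  then show ?thesis using alpha_pos by (simp add: avg_const \<alpha>_def[symmetric])
qed

lemma avg_base: "avg High base = avg High (\<lambda>a. xo a ^ k * yi a ^ l) + \<gamma> * (real m / 3) * avg High miss"
  unfolding base_def by (simp only: avg_add avg_cmult)

lemma main_gt2:
  assumes "l < k" "2 \<le> l"
  shows "s_density k l n E \<le> OPT k l"
proof -
  have "s_density k l n E \<le> avg High (\<lambda>a. base a + C * \<alpha> ^ (m - 1) * yi a)"
    using s_split Low_balance[OF assms(2)] High_High_gain avg_miss_nonneg
    unfolding avg_add avg_cmult avg_base by (simp add: algebra_simps)
  then show ?thesis using OPT_bound_gt[OF assms(1)] by simp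
qed

end

section \<open>The balanced case \<open>k = l\<close>\<close>

lemma balanced_amgm:
  fixes p q X Y \<alpha> \<zeta> :: real
  assumes "3 \<le> k" "0 \<le> p" "0 \<le> X" "0 \<le> Y" "Y \<le> q" "p + q \<le> \<alpha>" "X + Y \<le> \<alpha> - \<zeta>" "0 \<le> \<zeta>" "\<zeta> \<le> \<alpha>"
  shows "p * X ^ (k - 1) * Y ^ k \<le> bmax k k * (\<alpha> ^ (k + k - 1) * (\<alpha> - 2 / 3 * \<zeta>))"
proof -
  \<comment> \<open>\<open>A\<close> is the mean of the factor \<open>p\<close> and the
    \<open>k - 1\<close> factors \<open>X\<close>. The restriction by \<open>\<zeta>\<close> affects
    all but one of these \<open>k\<close> factors, so the bound for \<open>A + Y\<close> drops by
    \<open>(1 - 1/k) \<zeta>\<close>, which is at least \<open>2/3 \<zeta>\<close> as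
    \<open>k >= 3\<close>.\<close>
  define A where "A = (p + real (k - 1) * X) / real k"
  have k: "1 + (k - 1) = k" using assms by simp
  have A0: "0 \<le> A" using assms by (simp add: A_def)
  have "p ^ 1 * X ^ (k - 1) \<le> A ^ k"
    using weighted_amgm[of p X 1 "k - 1"] assms unfolding k A_def by simp
  then have "p * X ^ (k - 1) * Y ^ k \<le> A ^ k * Y ^ k" using assms by (intro mult_right_mono) auto
  also have "\<dots> \<le> bmax k k * (A + Y) ^ (k + k)" using A0 assms by (intro bmax_bound)
  also have "(A + Y) ^ (k + k) = (A + Y) ^ (k + k - 1) * (A + Y)" using assms by (simp flip: power_Suc2)
  also have "bmax k k * \<dots> \<le> bmax k k * (\<alpha> ^ (k + k - 1) * (\<alpha> - 2 / 3 * \<zeta>))"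
  proof -
    have "real k * A = p + real (k - 1) * X" using assms by (simp add: A_def)
    then have "real k * (A + Y) = (p + Y) + (real k - 1) * (X + Y)"
      using assms by (simp add: of_nat_diff algebra_simps)
    also have "\<dots> \<le> \<alpha> + (real k - 1) * (\<alpha> - \<zeta>)" using assms by (intro add_mono mult_left_mono) auto
    also have "\<dots> \<le> real k * (\<alpha> - 2 / 3 * \<zeta>)"
    proof -
      have "3 * \<zeta> \<le> real k * \<zeta>" using assms by (intro mult_right_mono) auto
      then show ?thesis by (simp add: algebra_simps)
    qed
    finally have 1: "A + Y \<le> \<alpha> - 2 / 3 * \<zeta>" using assms by simp
    then have 2: "A + Y \<le> \<alpha>" using assms by simp
    show ?thesis
      using 1 2 A0 assms bmax_pos[of k k] by (intro mult_left_mono mult_mono power_mono) auto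
  qed
  finally show ?thesis .
qed

context rich_star_graph
begin

text \<open>Classifying by the first out-leaf charges the edges in \<open>High\<close> at vertices
  of \<open>Out b\<close>, classifying by the first in-leaf those at vertices of
  \<open>In b\<close>. The mean of both bounds charges all of \<open>High\<close> except the
  vertices counted in the correction term.\<close>

lemma cstars_High_balanced:
  assumes kl_eq: "k = l" and b: "b \<in> Low"
  shows "cstars b High \<le> \<gamma> * \<alpha> ^ m
    - \<gamma> / 3 * \<alpha> ^ (m - 2) * (avg High zz - \<alpha> * dens {a \<in> High. b \<notin> Out a \<union> In a})"
proof -
  let ?X = "Out b \<inter> High" and ?Y = "In b \<inter> High"
  let ?M = "{a \<in> High. b \<notin> Out a \<union> In a}"
  let ?f = "\<lambda>a. \<gamma> * (\<alpha> ^ (m - 1) * (\<alpha> - 2 / 3 * zz a))"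
  have k3: "3 \<le> k" using kl kl_eq by simp
  have am: "\<alpha> ^ m = \<alpha> ^ (m - 1) * \<alpha>" "\<alpha> ^ (m - 1) = \<alpha> ^ (m - 2) * \<alpha>"
  proof -
    show "\<alpha> ^ m = \<alpha> ^ (m - 1) * \<alpha>" using kl by (simp flip: power_Suc2)
    have "m - 1 = Suc (m - 2)" using kl by simp
    then show "\<alpha> ^ (m - 1) = \<alpha> ^ (m - 2) * \<alpha>" by (metis power_Suc2)
  qed
  have Zsplit: "avg High zz \<le> avg ?X zz + avg ?Y zz + \<alpha> * dens ?M"
  proof -
    have "High = (?X \<union> ?Y) \<union> ?M" using Out_iff_In[of b] Out_iff_In[of _ b] by auto
    then have "avg High zz = avg ((?X \<union> ?Y) \<union> ?M) zz" by metis
    also have "\<dots> = avg (?X \<union> ?Y) zz + avg ?M zz"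
      by (rule avg_Un) (use Out_iff_In[of b] Out_iff_In[of _ b] in auto)
    also have "avg (?X \<union> ?Y) zz = avg ?X zz + avg ?Y zz"
      by (rule avg_Un) (use Out_In_disj[of b] in auto)
    also have "avg ?M zz \<le> avg ?M (\<lambda>_. \<alpha>)" using zz_bounds by (intro avg_mono) auto
    finally show ?thesis by (simp add: avg_const)
  qed
  have pq: "dens ?X + dens ?Y \<le> \<alpha>" using dens_Out_In_minus[of b High "{}"] dens_mono[of "nb b \<inter> High" High] by (simp add: \<alpha>_def)
  have le_a: "dens ?X \<le> \<alpha>" "dens ?Y \<le> \<alpha>" unfolding \<alpha>_def by (auto intro!: dens_mono)
  show ?thesis
  proof (cases "dens ?X = 0 \<or> dens ?Y = 0")
    case True
    then have "cstars b High \<le> 0" using cstars0[OF fin(1), of b] kl by (auto simp: power_0_left)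
    moreover have "0 \<le> \<gamma> * \<alpha> ^ m - \<gamma> / 3 * \<alpha> ^ (m - 2) * (avg High zz - \<alpha> * dens ?M)"
    proof -
      have "avg High zz \<le> avg High (\<lambda>_. \<alpha>)" using zz_bounds by (intro avg_mono) auto
      then have "avg High zz \<le> \<alpha> * \<alpha>" by (simp add: avg_const \<alpha>_def)
      moreover have "0 \<le> \<alpha> * dens ?M" using alpha_bounds by simp
      ultimately have "avg High zz - \<alpha> * dens ?M \<le> 3 * (\<alpha> * \<alpha>)" using alpha_pos by (smt (verit) mult_pos_pos)
      then have "\<gamma> / 3 * \<alpha> ^ (m - 2) * (avg High zz - \<alpha> * dens ?M) \<le> \<gamma> / 3 * \<alpha> ^ (m - 2) * (3 * (\<alpha> * \<alpha>))"
        using gam_pos alpha_pos by (intro mult_left_mono) auto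
      then show ?thesis unfolding am by (simp add: mult_ac)
    qed
    ultimately show ?thesis by linarith
  next
    case False
    then have pos: "0 < dens ?X" "0 < dens ?Y" using dens_nonneg by (auto simp: less_le)
    have avgf: "avg S ?f = \<gamma> * (\<alpha> ^ (m - 1) * (\<alpha> * dens S - 2 / 3 * avg S zz))" for S
      by (simp only: avg_cmult avg_diff avg_const)
    have step: "c \<le> \<gamma> * \<alpha> ^ m - 2 / 3 * \<gamma> * \<alpha> ^ (m - 2) * avg S zz"
      if "0 < dens S" "dens S \<le> \<alpha>" "dens S * c \<le> avg S ?f" for S c
    proof -
      have z0: "0 \<le> avg S zz" using zz_bounds by (intro avg_nonneg) auto
      have "dens S * (2 / 3 * \<gamma> * \<alpha> ^ (m - 2) * avg S zz) \<le> \<alpha> * (2 / 3 * \<gamma> * \<alpha> ^ (m - 2) * avg S zz)"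
        using that z0 gam_pos alpha_pos by (intro mult_right_mono mult_nonneg_nonneg) auto
      moreover have "dens S * c \<le> \<gamma> * (\<alpha> ^ (m - 1) * (\<alpha> * dens S - 2 / 3 * avg S zz))"
        using that(3) unfolding avgf .
      ultimately have "dens S * c \<le> dens S * (\<gamma> * \<alpha> ^ m - 2 / 3 * \<gamma> * \<alpha> ^ (m - 2) * avg S zz)"
        unfolding am by (simp add: algebra_simps)
      then show ?thesis using that(1) by simp
    qed
    have dm: "dens (?X - nb a) \<le> dens ?X" "dens (?Y - nb a) \<le> dens ?Y" for a by (auto intro!: dens_mono)
    \<comment> \<open>The extra factor \<open>dens ?X\<close> supplies the k-th factor for the mean
      in \<open>balanced_amgm\<close>; \<open>step\<close> divides it out again.\<close>
    have "dens ?X * cstars b High \<le> avg ?X ?f"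
    proof -
      have "dens ?X * cstars b High \<le> dens ?X * avg ?X (\<lambda>a. dens (?X - nb a) ^ (k - 1) * dens (?Y - nb a) ^ l)"
        using cstars_out_first[OF fin(1), of b] by (intro mult_left_mono) (auto simp: avg_def)
      also have "\<dots> = avg ?X (\<lambda>a. dens ?X * dens (?X - nb a) ^ (k - 1) * dens (?Y - nb a) ^ k)"
        by (simp add: avg_cmult kl_eq mult.assoc)
      also have "\<dots> \<le> avg ?X ?f"
      proof (rule avg_mono)
        fix a
        show "dens ?X * dens (?X - nb a) ^ (k - 1) * dens (?Y - nb a) ^ k \<le> ?f a"
          using balanced_amgm[of k "dens ?X" "dens (?X - nb a)" "dens (?Y - nb a)" "dens ?Y" \<alpha> "zz a"]
            k3 pq dens_minus_nb[OF fin(1), of b a] zz_bounds[of a] dm[of a]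
          by (simp add: kl_eq \<alpha>_def zz_def)
      qed
      finally show ?thesis .
    qed
    from step[OF pos(1) le_a(1) this]
    have 1: "cstars b High \<le> \<gamma> * \<alpha> ^ m - 2 / 3 * \<gamma> * \<alpha> ^ (m - 2) * avg ?X zz" .
    have "dens ?Y * cstars b High \<le> avg ?Y ?f"
    proof -
      have "dens ?Y * cstars b High \<le> dens ?Y * avg ?Y (\<lambda>a. dens (?X - nb a) ^ k * dens (?Y - nb a) ^ (l - 1))"
        using cstars_in_first[OF fin(1), of b] by (intro mult_left_mono) (auto simp: avg_def)
      also have "\<dots> = avg ?Y (\<lambda>a. dens ?Y * dens (?Y - nb a) ^ (k - 1) * dens (?X - nb a) ^ k)"
        by (simp add: avg_cmult kl_eq mult_ac)
      also have "\<dots> \<le> avg ?Y ?f"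
      proof (rule avg_mono)
        fix a
        show "dens ?Y * dens (?Y - nb a) ^ (k - 1) * dens (?X - nb a) ^ k \<le> ?f a"
          using balanced_amgm[of k "dens ?Y" "dens (?Y - nb a)" "dens (?X - nb a)" "dens ?X" \<alpha> "zz a"]
            k3 pq dens_minus_nb[OF fin(1), of b a] zz_bounds[of a] dm[of a]
          by (simp add: kl_eq \<alpha>_def zz_def add.commute)
      qed
      finally show ?thesis .
    qed
    from step[OF pos(2) le_a(2) this]
    have 2: "cstars b High \<le> \<gamma> * \<alpha> ^ m - 2 / 3 * \<gamma> * \<alpha> ^ (m - 2) * avg ?Y zz" .
    have "\<gamma> / 3 * \<alpha> ^ (m - 2) * (avg High zz - \<alpha> * dens ?M) \<le> \<gamma> / 3 * \<alpha> ^ (m - 2) * (avg ?X zz + avg ?Y zz)"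
      using Zsplit gam_pos alpha_pos by (intro mult_left_mono) auto
    then show ?thesis using 1 2 by (simp add: distrib_left)
  qed
qed

text \<open>With \<open>Z\<close> the average of \<open>zz\<close> over \<open>High\<close>, edges
  in \<open>High\<close> create at most \<open>\<gamma> \<alpha>^(m - 1) Z\<close> stars with centre
  in \<open>High\<close>, but up to a term in \<open>miss\<close> they cost
  \<open>\<gamma> / 3 \<alpha>^(m - 2) (1 - \<alpha>) Z\<close> of those with centre in
  \<open>Low\<close>. The loss prevails since \<open>\<alpha> <= (1 - \<alpha>) / 3\<close>.\<close>

lemma High_gain_balanced:
  assumes "k = l"
  shows "avg {0..<n} (\<lambda>c. cstars c High) \<le> \<gamma> * ((1 - \<alpha>) * \<alpha> ^ m) + \<gamma> / 4 * avg High miss"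
proof -
  let ?Z = "avg High zz"
  let ?M = "\<lambda>b. dens {a \<in> High. b \<notin> Out a \<union> In a}"
  have Z0: "0 \<le> ?Z" using zz_bounds by (intro avg_nonneg) auto
  have miss0: "0 \<le> avg High miss" by (intro avg_nonneg) auto
  have am: "\<alpha> ^ (m - 1) = \<alpha> ^ (m - 2) * \<alpha>"
  proof -
    have "m - 1 = Suc (m - 2)" using kl by simp
    then show ?thesis by (metis power_Suc2)
  qed
  have swap: "avg Low ?M = avg High miss"
  proof -
    have "avg Low ?M = avg High (\<lambda>a. dens {b \<in> Low. b \<notin> Out a \<union> In a})"
      by (rule avg_dens_swap) auto
    moreover have "{b \<in> Low. b \<notin> Out a \<union> In a} = Mis a" for a by auto
    ultimately show ?thesis by (simp add: miss_def avg_def)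
  qed
  have "avg Low (\<lambda>c. cstars c High) \<le> avg Low (\<lambda>b. \<gamma> * \<alpha> ^ m - \<gamma> / 3 * \<alpha> ^ (m - 2) * (?Z - \<alpha> * ?M b))"
    using cstars_High_balanced[OF assms] by (intro avg_mono)
  also have "\<dots> = \<gamma> * \<alpha> ^ m * (1 - \<alpha>) - \<gamma> / 3 * \<alpha> ^ (m - 2) * (?Z * (1 - \<alpha>) - \<alpha> * avg High miss)"
    by (simp only: avg_diff avg_cmult avg_const dens_Low swap)
  finally have 1: "avg Low (\<lambda>c. cstars c High) \<le> \<dots>" .
  have "avg High (\<lambda>c. cstars c High) \<le> avg High (\<lambda>c. \<gamma> * \<alpha> ^ (m - 1) * zz c)"
  proof (rule avg_mono)
    fix c
    have "zz c ^ m = zz c ^ (m - 1) * zz c" using kl by (simp flip: power_Suc2)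
    also have "\<dots> \<le> \<alpha> ^ (m - 1) * zz c" using zz_bounds[of c] by (intro mult_right_mono power_mono) auto
    finally have "\<gamma> * zz c ^ m \<le> \<gamma> * (\<alpha> ^ (m - 1) * zz c)" using gam_pos by (intro mult_left_mono) auto
    then show "cstars c High \<le> \<gamma> * \<alpha> ^ (m - 1) * zz c" using cstars_le[OF fin(1), of c] by (simp add: zz_def mult.assoc)
  qed
  then have 2: "avg High (\<lambda>c. cstars c High) \<le> \<gamma> * \<alpha> ^ (m - 2) * \<alpha> * ?Z" by (simp only: avg_cmult am mult.assoc)
  have 3: "avg {0..<n} (\<lambda>c. cstars c High) = avg High (\<lambda>c. cstars c High) + avg Low (\<lambda>c. cstars c High)"
    unfolding HL(1)[symmetric] by (rule avg_Un) (auto simp: HL)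
  have 4: "\<gamma> * \<alpha> ^ (m - 2) * ?Z * \<alpha> \<le> \<gamma> * \<alpha> ^ (m - 2) * ?Z * ((1 - \<alpha>) / 3)"
    using gam_pos alpha_bounds nu01 Z0 by (intro mult_left_mono) auto
  have "\<alpha> ^ (m - 1) \<le> \<alpha> ^ 1" using alpha_bounds nu01 kl by (intro power_decreasing) auto
  then have "\<alpha> ^ (m - 1) \<le> 3 / 4" using alpha_bounds nu01 by simp
  then have 5: "\<gamma> / 3 * avg High miss * \<alpha> ^ (m - 1) \<le> \<gamma> / 3 * avg High miss * (3 / 4)"
    using gam_pos miss0 by (intro mult_left_mono) auto
  show ?thesis using 1 2 3 4 5 unfolding am by (simp add: algebra_simps)
qed

lemma main_eq:
  assumes "k = l"
  shows "s_density k l n E \<le> OPT k l"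
proof -
  have l2: "2 \<le> l" using kl assms by simp
  have "avg High base \<le> avg High (\<lambda>_. \<gamma> * (1 - \<alpha>) ^ m)" by (intro avg_mono base_le)
  then have "avg High base \<le> \<gamma> * (\<alpha> * (1 - \<alpha>) ^ m)" by (simp add: avg_const \<alpha>_def mult_ac)
  then have "s_density k l n E \<le> \<gamma> * (\<alpha> * (1 - \<alpha>) ^ m + (1 - \<alpha>) * \<alpha> ^ m)"
    using s_split Low_balance[OF l2] High_gain_balanced[OF assms]
    unfolding avg_base by (simp add: algebra_simps)
  also have "\<dots> \<le> OPT k l"
    using OPT_eq_ge[of \<alpha> l] alpha_bounds nu01 by (simp add: assms)
  finally show ?thesis .
qed

end

section \<open>The case \<open>l = 1\<close>\<close>

context rich_star_graph
begin

text \<open>A tolerance small enough that a centre in \<open>W\<close> has few stars with leaves in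
  \<open>High\<close>, at most \<open>q0 \<alpha>^m\<close>, and large enough that the loss caused
  by edges outside \<open>W\<close> beats a gain of order \<open>\<nu>^(m - 1)\<close>.\<close>

definition q0 :: real where "q0 = 1 / (6 * real m)"

lemma q0_pos: "0 < q0" "q0 \<le> 1 / 36"
  using m6 by (auto simp: q0_def)

text \<open>For a single in-leaf, edges between vertices that send arcs to almost all of \<open>High\<close>
  destroy almost no star with centre in \<open>High\<close>; these vertices need a separate treatment.\<close>

definition W :: "nat set" where
  "W = {b \<in> Low. dens {a \<in> High. b \<notin> In a} \<le> q0 * \<alpha>}"

lemma W_sub: "W \<subseteq> Low" by (auto simp: W_def)

lemma fin_W [simp]: "finite W" using finite_subset[OF W_sub] by simp

definition yW :: "nat \<Rightarrow> real" where "yW a = dens (In a \<inter> W)"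

text \<open>Only the loss at out-leaves is available. After exchanging the sums, a vertex of
  \<open>Low\<close> outside \<open>W\<close> fails to be an in-neighbour for more than density
  \<open>q0 \<alpha>\<close> of \<open>High\<close>; for these it is an out-neighbour or missing,
  and its degree in \<open>Low\<close> is charged.\<close>

lemma High_Low_loss1:
  "avg High (\<lambda>a. cstars a Low) \<le> avg High (\<lambda>a. xo a ^ k * yi a ^ l)
    - \<gamma> * (1 - \<nu>) ^ m * (q0 * \<alpha> * avg (Low - W) lam - 2 * \<nu> * avg High miss)"
proof -
  let ?\<tau> = "\<gamma> * (1 - \<nu>) ^ m"
  have tau: "0 \<le> ?\<tau>" using gam_pos nu01 by simp
  have "avg High (\<lambda>a. cstars a Low) \<le> avg High (\<lambda>a. xo a ^ k * yi a ^ l - ?\<tau> * (avg {b \<in> Low. b \<notin> In a} lam - 2 * \<nu> * miss a))"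
  proof (rule avg_mono)
    fix a assume a: "a \<in> High"
    let ?T = "xo a ^ k * yi a ^ l"
    have "{b \<in> Low. b \<notin> In a} = (Out a \<inter> Low) \<union> Mis a" using Out_In_disj[of a] by auto
    then have "avg {b \<in> Low. b \<notin> In a} lam = avg (Out a \<inter> Low) lam + avg (Mis a) lam"
      by (simp only:) (rule avg_Un, auto)
    then have "avg {b \<in> Low. b \<notin> In a} lam - 2 * \<nu> * miss a \<le> avg (Out a \<inter> Low) (lamA a)"
      using lamA_avg[of "Out a \<inter> Low" a] avg_Mis[of a] by simp
    then have "?\<tau> * (avg {b \<in> Low. b \<notin> In a} lam - 2 * \<nu> * miss a) \<le> ?\<tau> * avg (Out a \<inter> Low) (lamA a)"
      using tau by (rule mult_left_mono)
    also have "\<dots> \<le> ?T * avg (Out a \<inter> Low) (lamA a)"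
      using That_ge[OF a] lamA_01 by (intro mult_right_mono avg_nonneg) auto
    finally show "cstars a Low \<le> ?T - ?\<tau> * (avg {b \<in> Low. b \<notin> In a} lam - 2 * \<nu> * miss a)"
      using out_loss[of a] by simp
  qed
  also have "\<dots> = avg High (\<lambda>a. xo a ^ k * yi a ^ l)
      - ?\<tau> * (avg High (\<lambda>a. avg {b \<in> Low. b \<notin> In a} lam) - 2 * \<nu> * avg High miss)"
    by (simp only: avg_diff avg_cmult)
  also have "\<dots> \<le> avg High (\<lambda>a. xo a ^ k * yi a ^ l) - ?\<tau> * (q0 * \<alpha> * avg (Low - W) lam - 2 * \<nu> * avg High miss)"
  proof -
    have "q0 * \<alpha> * avg (Low - W) lam = avg (Low - W) (\<lambda>b. q0 * \<alpha> * lam b)" by (simp add: avg_cmult)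
    also have "\<dots> \<le> avg (Low - W) (\<lambda>b. avg {a \<in> High. b \<notin> In a} (\<lambda>_. lam b))"
    proof (rule avg_mono)
      fix b assume "b \<in> Low - W"
      then have "q0 * \<alpha> \<le> dens {a \<in> High. b \<notin> In a}" by (auto simp: W_def)
      then have "q0 * \<alpha> * lam b \<le> dens {a \<in> High. b \<notin> In a} * lam b" by (intro mult_right_mono) auto
      then show "q0 * \<alpha> * lam b \<le> avg {a \<in> High. b \<notin> In a} (\<lambda>_. lam b)" by (simp add: avg_const mult.commute)
    qed
    also have "\<dots> \<le> avg Low (\<lambda>b. avg {a \<in> High. b \<notin> In a} (\<lambda>_. lam b))"
      by (intro avg_subset avg_nonneg) auto
    also have "\<dots> = avg High (\<lambda>a. avg {b \<in> Low. b \<notin> In a} lam)"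
      by (rule avg_swap[symmetric]) auto
    finally show ?thesis using tau by (intro diff_left_mono mult_left_mono) auto
  qed
  finally show ?thesis .
qed

lemma gam_em: "l = 1 \<Longrightarrow> \<gamma> = 1 / em m"
  using bmax_1[of m] bmax_commute[of k 1] kl by simp

lemma leafc_1: assumes "l = 1" shows "leafc = 1"
  unfolding leafc_def using assms kl by simp

lemma em_pos: "0 < em m"
proof -
  have "0 < 2 * real m" using kl by simp
  also have "\<dots> \<le> em m" by (rule em_ge) (use kl in simp)
  finally show ?thesis .
qed

text \<open>A star inside \<open>Low\<close> has its centre outside \<open>W\<close>, or a leaf
  outside \<open>W\<close>, or lies within \<open>W\<close>. The first two kinds are charged to the
  degrees of vertices outside \<open>W\<close>.\<close>

lemma Low_Low_gain1:
  assumes "l = 1"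
  shows "avg Low (\<lambda>b. cstars b Low) \<le> avg W (\<lambda>c. cstars c W) + (1 + 1 / em m) * \<nu> ^ (m - 1) * avg (Low - W) lam"
proof -
  have "avg Low (\<lambda>b. cstars b Low) = avg (W \<union> (Low - W)) (\<lambda>b. cstars b Low)"
    using W_sub by (intro arg_cong[of _ _ "\<lambda>S. avg S _"]) auto
  also have "\<dots> = avg W (\<lambda>b. cstars b Low) + avg (Low - W) (\<lambda>b. cstars b Low)" by (rule avg_Un) auto
  also have "avg (Low - W) (\<lambda>b. cstars b Low) \<le> avg (Low - W) (\<lambda>b. 1 / em m * \<nu> ^ (m - 1) * lam b)"
  proof (rule avg_mono)
    fix b assume b: "b \<in> Low - W"
    have "lam b ^ m = lam b ^ (m - 1) * lam b" using kl by (simp flip: power_Suc2)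
    also have "\<dots> \<le> \<nu> ^ (m - 1) * lam b" using lam_le[of b] b by (intro mult_right_mono power_mono) auto
    finally have "\<gamma> * lam b ^ m \<le> \<gamma> * (\<nu> ^ (m - 1) * lam b)" using gam_pos by (intro mult_left_mono) auto
    then show "cstars b Low \<le> 1 / em m * \<nu> ^ (m - 1) * lam b"
      using cstars_Low_le[of b] unfolding gam_em[OF assms] by (simp add: mult.assoc)
  qed
  also have "avg W (\<lambda>b. cstars b Low) \<le> avg W (\<lambda>c. cstars c W + \<nu> ^ (m - 1) * dens {b \<in> Low - W. b \<in> nb c})"
  proof (rule avg_mono)
    fix c assume c: "c \<in> W"
    have "Low - (Low - W) = W" using W_sub by auto
    moreover have "nb c \<inter> (Low - W) \<inter> Low = {b \<in> Low - W. b \<in> nb c}" by auto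
    ultimately have "cstars c Low \<le> cstars c W + avg {b \<in> Low - W. b \<in> nb c} (\<lambda>a. dens (nb c \<inter> Low - nb a) ^ (m - 1))"
      using cstars_split[OF fin(2), of c "Low - W"] by (simp add: leafc_1[OF assms])
    also have "avg {b \<in> Low - W. b \<in> nb c} (\<lambda>a. dens (nb c \<inter> Low - nb a) ^ (m - 1)) \<le> avg {b \<in> Low - W. b \<in> nb c} (\<lambda>_. \<nu> ^ (m - 1))"
    proof (intro avg_mono power_mono)
      show "dens (nb c \<inter> Low - nb a) \<le> \<nu>" for a
      proof -
        have "c \<in> Low" using c W_sub by auto
        moreover have "dens (nb c \<inter> Low - nb a) \<le> lam c" unfolding lam_def by (intro dens_mono) auto
        ultimately show ?thesis using lam_le[of c] by simp
      qed
    qed simp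
    finally show "cstars c Low \<le> cstars c W + \<nu> ^ (m - 1) * dens {b \<in> Low - W. b \<in> nb c}" by (simp add: avg_const)
  qed
  also have "\<dots> = avg W (\<lambda>c. cstars c W) + \<nu> ^ (m - 1) * avg W (\<lambda>c. dens {b \<in> Low - W. b \<in> nb c})"
    by (simp only: avg_add avg_cmult)
  also have "avg W (\<lambda>c. dens {b \<in> Low - W. b \<in> nb c}) \<le> avg Low (\<lambda>c. dens {b \<in> Low - W. b \<in> nb c})"
    by (intro avg_subset W_sub) auto
  also have "\<dots> = avg (Low - W) (\<lambda>b. dens {c \<in> Low. b \<in> nb c})" by (rule avg_dens_swap) auto
  also have "\<dots> = avg (Low - W) lam"
  proof -
    have "{c \<in> Low. b \<in> nb c} = nb b \<inter> Low" for b using nb_sym[of b] by auto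
    then show ?thesis by (simp add: avg_def lam_def)
  qed
  finally show ?thesis using nu01 unfolding avg_cmult by (simp add: algebra_simps)
qed

text \<open>Given the first out-leaf \<open>b\<close>, the centre is a neighbour of \<open>b\<close>
  and the other leaves are not. With \<open>z\<close> the degree of \<open>b\<close> in
  \<open>W\<close>, this bounds the count by \<open>z (dens W - z)^(m - 1)\<close>, whose maximum is
  \<open>dens W ^ m / em m\<close>.\<close>

lemma W_gain: "avg W (\<lambda>c. cstars c W) \<le> dens W * (C * dens W ^ m / em m)"
proof -
  let ?z = "\<lambda>b. dens (nb b \<inter> W)"
  have "avg W (\<lambda>c. cstars c W) \<le> avg W (\<lambda>c. avg {b \<in> W. b \<in> Out c} (\<lambda>b. C * (dens W - ?z b) ^ (m - 1)))"
    by (intro avg_mono out_first) simp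
  also have "\<dots> = avg W (\<lambda>b. avg {c \<in> W. b \<in> Out c} (\<lambda>_. C * (dens W - ?z b) ^ (m - 1)))"
    by (rule avg_swap) auto
  also have "\<dots> \<le> avg W (\<lambda>b. C * dens W ^ m / em m)"
  proof (rule avg_mono)
    fix b
    have z: "?z b \<le> dens W" by (intro dens_mono) auto
    have "dens {c \<in> W. b \<in> Out c} \<le> ?z b"
      using Out_iff_In In_sub by (intro dens_mono) auto
    then have "C * (dens W - ?z b) ^ (m - 1) * dens {c \<in> W. b \<in> Out c} \<le> C * (dens W - ?z b) ^ (m - 1) * ?z b"
      using C_pos z by (intro mult_left_mono) auto
    also have "\<dots> = C * (?z b ^ 1 * (dens W - ?z b) ^ (m - 1))" by simp
    also have "\<dots> \<le> C * (bmax 1 (m - 1) * (?z b + (dens W - ?z b)) ^ (1 + (m - 1)))"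
      using C_pos z by (intro mult_left_mono bmax_bound) auto
    also have "\<dots> = C * dens W ^ m / em m" using bmax_1[of m] kl by simp
    finally show "avg {c \<in> W. b \<in> Out c} (\<lambda>_. C * (dens W - ?z b) ^ (m - 1)) \<le> C * dens W ^ m / em m"
      by (simp add: avg_const)
  qed
  finally show ?thesis by (simp add: avg_const mult.commute)
qed

lemma avg_yW: "dens W * (\<alpha> * (1 - q0)) \<le> avg High yW"
proof -
  have "avg W (\<lambda>_. \<alpha> * (1 - q0)) \<le> avg W (\<lambda>b. dens {a \<in> High. b \<in> In a})"
  proof (rule avg_mono)
    fix b assume b: "b \<in> W"
    have "High - {a \<in> High. b \<in> In a} = {a \<in> High. b \<notin> In a}" by auto
    then have "dens {a \<in> High. b \<notin> In a} = \<alpha> - dens {a \<in> High. b \<in> In a}"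
      using dens_Diff[of "{a \<in> High. b \<in> In a}" High] by (simp add: \<alpha>_def)
    then show "\<alpha> * (1 - q0) \<le> dens {a \<in> High. b \<in> In a}" using b by (simp add: W_def algebra_simps)
  qed
  also have "\<dots> = avg High (\<lambda>a. dens {b \<in> W. b \<in> In a})" by (rule avg_dens_swap) auto
  also have "\<dots> = avg High yW"
  proof -
    have "{b \<in> W. b \<in> In a} = In a \<inter> W" for a by auto
    then show ?thesis by (simp add: avg_def yW_def)
  qed
  finally show ?thesis by (simp add: avg_const mult.commute)
qed

text \<open>A centre in \<open>W\<close> has in-density at most \<open>q0 \<alpha>\<close> from
  \<open>High\<close>. For such centres the mean of the resulting bound and of the first-out-leaf
  bound is used: removing only half of \<open>yW a\<close> keeps
  \<open>yi a - yW a / 2 >= \<alpha> / 4\<close>, so that \<open>shrink_gain\<close> still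
  applies.\<close>

lemma High_High_gain1:
  assumes "l = 1"
  shows "avg {0..<n} (\<lambda>c. cstars c High) \<le> C * \<alpha> ^ (m - 1) * avg High yi
    - 1 / 2 * \<alpha> ^ m * dens W * (C * (1 - q0) - q0)"
proof -
  let ?f = "\<lambda>a. C * (\<alpha> - zz a) ^ (m - 1)"
  have km: "\<alpha> ^ k = \<alpha> ^ (m - 1)" using assms by simp
  have am: "\<alpha> ^ m = \<alpha> ^ (m - 1) * \<alpha>" using kl by (simp flip: power_Suc2)
  have VW: "{0..<n} = ({0..<n} - W) \<union> W" using W_sub HL by auto
  let ?A = "avg High (\<lambda>a. avg {c \<in> {0..<n} - W. a \<in> Out c} (\<lambda>_. ?f a))"
  let ?B = "avg High (\<lambda>a. avg {c \<in> W. a \<in> Out c} (\<lambda>_. ?f a))"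
  have split: "avg {0..<n} (\<lambda>c. cstars c High) = avg ({0..<n} - W) (\<lambda>c. cstars c High) + avg W (\<lambda>c. cstars c High)"
    by (subst VW, rule avg_Un) auto
  have "avg ({0..<n} - W) (\<lambda>c. cstars c High) \<le> avg ({0..<n} - W) (\<lambda>c. avg {a \<in> High. a \<in> Out c} ?f)"
    by (intro avg_mono High_out_first)
  moreover have "avg ({0..<n} - W) (\<lambda>c. avg {a \<in> High. a \<in> Out c} ?f) = ?A"
    by (rule avg_swap) auto
  ultimately have A: "avg ({0..<n} - W) (\<lambda>c. cstars c High) \<le> ?A" by linarith
  have "avg W (\<lambda>c. cstars c High) \<le> avg W (\<lambda>c. 1 / 2 * (q0 * \<alpha> ^ m) + 1 / 2 * avg {a \<in> High. a \<in> Out c} ?f)"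
  proof (rule avg_mono)
    fix c assume c: "c \<in> W"
    have "In c \<inter> High \<subseteq> {a \<in> High. c \<notin> In a}" using Out_iff_In Out_In_disj by blast
    then have "dens (In c \<inter> High) \<le> dens {a \<in> High. c \<notin> In a}" by (rule dens_mono) simp
    then have i: "dens (In c \<inter> High) \<le> q0 * \<alpha>" using c by (simp add: W_def)
    have o: "dens (Out c \<inter> High) \<le> \<alpha>" unfolding \<alpha>_def by (intro dens_mono) auto
    have "cstars c High \<le> dens (Out c \<inter> High) ^ k * dens (In c \<inter> High)" using cstars0[OF fin(1), of c] assms by simp
    also have "\<dots> \<le> \<alpha> ^ k * (q0 * \<alpha>)" using i o alpha_pos by (intro mult_mono power_mono) auto
    also have "\<dots> = q0 * \<alpha> ^ m" unfolding am km by (simp add: mult_ac)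
    finally show "cstars c High \<le> 1 / 2 * (q0 * \<alpha> ^ m) + 1 / 2 * avg {a \<in> High. a \<in> Out c} ?f"
      using High_out_first[of c] by simp
  qed
  moreover have "avg W (\<lambda>c. 1 / 2 * (q0 * \<alpha> ^ m) + 1 / 2 * avg {a \<in> High. a \<in> Out c} ?f)
      = 1 / 2 * (q0 * \<alpha> ^ m) * dens W + 1 / 2 * avg W (\<lambda>c. avg {a \<in> High. a \<in> Out c} ?f)"
    by (simp only: avg_add avg_cmult avg_const)
  moreover have "avg W (\<lambda>c. avg {a \<in> High. a \<in> Out c} ?f) = ?B"
    by (rule avg_swap) auto
  ultimately have "avg W (\<lambda>c. cstars c High) \<le> 1 / 2 * (q0 * \<alpha> ^ m) * dens W + 1 / 2 * ?B" by linarith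
  moreover have "avg High (\<lambda>a. avg {c \<in> {0..<n} - W. a \<in> Out c} (\<lambda>_. ?f a) + 1 / 2 * avg {c \<in> W. a \<in> Out c} (\<lambda>_. ?f a))
      = ?A + avg High (\<lambda>a. 1 / 2 * avg {c \<in> W. a \<in> Out c} (\<lambda>_. ?f a))"
    by (rule avg_add)
  moreover have "avg High (\<lambda>a. 1 / 2 * avg {c \<in> W. a \<in> Out c} (\<lambda>_. ?f a)) = 1 / 2 * ?B" by (rule avg_cmult)
  ultimately have 1: "avg {0..<n} (\<lambda>c. cstars c High) \<le>
      avg High (\<lambda>a. avg {c \<in> {0..<n} - W. a \<in> Out c} (\<lambda>_. ?f a) + 1 / 2 * avg {c \<in> W. a \<in> Out c} (\<lambda>_. ?f a))
      + 1 / 2 * (q0 * \<alpha> ^ m) * dens W"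
    using A split by linarith
  have "avg High (\<lambda>a. avg {c \<in> {0..<n} - W. a \<in> Out c} (\<lambda>_. ?f a) + 1 / 2 * avg {c \<in> W. a \<in> Out c} (\<lambda>_. ?f a))
      \<le> avg High (\<lambda>a. C * \<alpha> ^ (m - 1) * (yi a - 1 / 2 * yW a))"
  proof (rule avg_mono)
    fix a assume a: "a \<in> High"
    have e1: "{c \<in> W. a \<in> Out c} = In a \<inter> W" using Out_iff_In by auto
    have "{c \<in> {0..<n} - W. a \<in> Out c} = {c \<in> High. a \<in> Out c} \<union> (In a \<inter> Low - In a \<inter> W)"
      using Out_iff_In[of a] W_sub HL by blast
    also have "dens \<dots> = dens {c \<in> High. a \<in> Out c} + dens (In a \<inter> Low - In a \<inter> W)"
      using HL(2) by (intro dens_Un_disj) auto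
    also have "dens (In a \<inter> Low - In a \<inter> W) = yi a - yW a"
      unfolding yi_def yW_def using W_sub by (intro dens_Diff) auto
    finally have e2: "dens {c \<in> {0..<n} - W. a \<in> Out c} \<le> zz a + (yi a - yW a)" using dens_In_High[of a] by simp
    have yW: "yW a \<le> yi a" unfolding yi_def yW_def using W_sub by (intro dens_mono) auto
    have yW0: "0 \<le> yW a" by (simp add: yW_def)
    have "\<alpha> \<le> 4 * (yi a - 1 / 2 * yW a)" using yi_ge[OF a] yW by simp
    also have "\<dots> \<le> real (m - 1) * (yi a - 1 / 2 * yW a)" using kl yW yW0 by (intro mult_right_mono) auto
    finally have g: "(\<alpha> - zz a) ^ (m - 1) * ((yi a - 1 / 2 * yW a) + zz a) \<le> \<alpha> ^ (m - 1) * (yi a - 1 / 2 * yW a)"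
      using zz_bounds[of a] kl yW yW0 by (intro shrink_gain) auto
    have "avg {c \<in> {0..<n} - W. a \<in> Out c} (\<lambda>_. ?f a) + 1 / 2 * avg {c \<in> W. a \<in> Out c} (\<lambda>_. ?f a)
        = ?f a * (dens {c \<in> {0..<n} - W. a \<in> Out c} + 1 / 2 * yW a)"
      by (simp add: avg_const e1 yW_def distrib_left)
    also have "\<dots> \<le> ?f a * ((yi a - 1 / 2 * yW a) + zz a)"
      using e2 C_pos zz_bounds[of a] by (intro mult_left_mono) auto
    also have "\<dots> \<le> C * (\<alpha> ^ (m - 1) * (yi a - 1 / 2 * yW a))"
      using mult_left_mono[OF g, of C] C_pos by (simp add: mult.assoc)
    finally show "avg {c \<in> {0..<n} - W. a \<in> Out c} (\<lambda>_. ?f a) + 1 / 2 * avg {c \<in> W. a \<in> Out c} (\<lambda>_. ?f a)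
        \<le> C * \<alpha> ^ (m - 1) * (yi a - 1 / 2 * yW a)" by (simp add: mult.assoc)
  qed
  also have "\<dots> = C * \<alpha> ^ (m - 1) * (avg High yi - 1 / 2 * avg High yW)"
    by (simp only: avg_cmult avg_diff)
  also have "\<dots> \<le> C * \<alpha> ^ (m - 1) * (avg High yi - 1 / 2 * (dens W * (\<alpha> * (1 - q0))))"
    using avg_yW C_pos alpha_pos by (intro mult_left_mono) auto
  finally have "avg {0..<n} (\<lambda>c. cstars c High) \<le> C * \<alpha> ^ (m - 1) * (avg High yi - 1 / 2 * (dens W * (\<alpha> * (1 - q0))))
      + 1 / 2 * (q0 * \<alpha> ^ m) * dens W"
    using 1 by linarith
  then show ?thesis unfolding am by (simp add: algebra_simps diff_divide_distrib add_divide_distrib)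
qed

lemma theta_bmax: "\<alpha> * (1 - \<alpha>) ^ m \<le> theta m / real (m + 1)"
proof -
  have "\<alpha> ^ 1 * (1 - \<alpha>) ^ m \<le> bmax 1 m * (\<alpha> + (1 - \<alpha>)) ^ (1 + m)"
    using alpha_bounds nu01 by (intro bmax_bound) auto
  also have "bmax 1 m = theta m / real (m + 1)"
    by (simp add: bmax_def theta_def power_divide mult.commute)
  finally show ?thesis by simp
qed

text \<open>By \<open>window\<close> and \<open>s_ge\<close>, \<open>base\<close> is on average
  close to its maximum, which for \<open>l = 1\<close> belongs to \<open>d = k / m\<close>, that is
  to \<open>w = m (1 - d) = 1\<close>. \<open>num_spread_exp\<close> turns the average defect into a
  bound for the mean of \<open>w\<close>, hence of \<open>yi\<close>.\<close>

lemma avg_yi_le: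
  assumes l1: "l = 1"
  shows "avg High yi \<le> (1 - \<alpha>) / real m * (\<alpha> * (1 + 1 / (2 * real m)))"
proof -
  let ?\<beta> = "1 - \<alpha>"
  let ?h = "\<lambda>a. base a / (\<gamma> * ?\<beta> ^ m)"
  have m: "real m \<ge> 6" using m6 by linarith
  have b: "0 < ?\<beta>" "0 < ?\<beta> ^ m" using alpha_bounds nu01 by auto
  have b3: "1 / 3 \<le> ?\<beta> ^ m"
  proof -
    have "(1 - \<nu>) ^ m \<le> ?\<beta> ^ m" using alpha_bounds nu01 by (intro power_mono) auto
    then show ?thesis using nu_power_ge[OF m6] by simp
  qed
  have "avg High yi \<le> avg High (\<lambda>a. ?\<beta> / real m * (1 + 1 / (6 * real m) + 9 * real m * (1 - ?h a)))"
  proof (rule avg_mono)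
    fix a assume a: "a \<in> High"
    obtain d where d: "0 \<le> d" "d \<le> 1" "yi a \<le> ?\<beta> * (1 - d)" "base a \<le> ?\<beta> ^ m * d ^ k * (1 - d) ^ l"
      using High_rescale[OF a] unfolding base_def by metis
    define w where "w = real m * (1 - d)"
    have w: "0 \<le> w" "w \<le> real m" using d m by (auto simp: w_def mult_left_le)
    have "d ^ k * (1 - d) ^ l \<le> \<gamma> * (w * exp (1 - w))"
    proof -
      have k: "real k = real m - 1" "0 < real k" "m - 1 = k" using l1 kl by auto
      \<comment> \<open>Expressing \<open>d\<close> relative to the maximiser \<open>k / m\<close>
        makes the estimate \<open>(1 + x)^k <= exp (k x)\<close> exact at
        \<open>w = 1\<close>.\<close>
      have "d = K / M * (1 + (1 - M * (1 - d)) / K)" if "0 < K" "K = M - 1" for K M :: real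
      proof -
        have "1 + (1 - M * (1 - d)) / K = (K + (1 - M * (1 - d))) / K" using that(1) by (simp add: add_divide_distrib)
        also have "K + (1 - M * (1 - d)) = M * d" using that(2) by (simp add: algebra_simps)
        finally show ?thesis using that by simp
      qed
      from this[OF k(2,1)] have "d = real k / real m * (1 + (1 - w) / real k)"
        unfolding w_def .
      then have "d ^ k = (real k / real m * (1 + (1 - w) / real k)) ^ k" by (rule arg_cong)
      also have "\<dots> = (real k / real m) ^ k * (1 + (1 - w) / real k) ^ k" by (rule power_mult_distrib)
      also have "\<dots> \<le> (real k / real m) ^ k * exp (real k * ((1 - w) / real k))"
      proof (intro mult_left_mono one_plus_power_le_exp)
        have "- 1 * real k \<le> 1 - w" using w(2) k(1) by linarith
        then have "- 1 \<le> (1 - w) / real k" by (simp only: pos_le_divide_eq[OF k(2)])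
        then show "0 \<le> 1 + (1 - w) / real k" by linarith
      qed simp
      also have "real k * ((1 - w) / real k) = 1 - w" using k by simp
      finally have "d ^ k * (1 - d) ^ l \<le> (real k / real m) ^ k * exp (1 - w) * (1 - d) ^ l"
        using d by (intro mult_right_mono) auto
      also have "\<dots> = \<gamma> * (w * exp (1 - w))"
      proof -
        have "(1 - d) ^ l = w / real m" using l1 m by (simp add: w_def)
        moreover have "\<gamma> = (real k / real m) ^ k / real m" using l1 by (simp add: bmax_def power_divide mult_ac)
        ultimately show ?thesis by simp
      qed
      finally show ?thesis .
    qed
    then have "?\<beta> ^ m * (d ^ k * (1 - d) ^ l) \<le> ?\<beta> ^ m * (\<gamma> * (w * exp (1 - w)))"
      using b by (intro mult_left_mono) auto
    then have "base a \<le> w * exp (1 - w) * (\<gamma> * ?\<beta> ^ m)" using d(4) by (simp add: mult_ac)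
    then have h: "?h a \<le> w * exp (1 - w)" using b gam_pos by (simp add: pos_divide_le_eq)
    have "w \<le> 1 + 1 / (6 * real m) + 9 * real m * (1 - w * exp (1 - w))"
      using w m by (intro num_spread_exp) auto
    also have "\<dots> \<le> 1 + 1 / (6 * real m) + 9 * real m * (1 - ?h a)" using h m by (intro add_left_mono mult_left_mono) auto
    finally have "?\<beta> / real m * w \<le> ?\<beta> / real m * (1 + 1 / (6 * real m) + 9 * real m * (1 - ?h a))"
      using b by (intro mult_left_mono) auto
    moreover have "?\<beta> / real m * w = ?\<beta> * (1 - d)" using m by (simp add: w_def)
    ultimately show "yi a \<le> ?\<beta> / real m * (1 + 1 / (6 * real m) + 9 * real m * (1 - ?h a))" using d(3) by linarith
  qed
  also have "\<dots> = ?\<beta> / real m * ((1 + 1 / (6 * real m)) * \<alpha> + 9 * real m * (\<alpha> - avg High base / (\<gamma> * ?\<beta> ^ m)))"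
  proof -
    have "avg High ?h = avg High base / (\<gamma> * ?\<beta> ^ m)" by (simp add: avg_def sum_divide_distrib mult_ac)
    moreover have "avg High (\<lambda>a. 1 + 1 / (6 * real m) + 9 * real m * (1 - ?h a)) = (1 + 1 / (6 * real m)) * \<alpha> + 9 * real m * (\<alpha> - avg High ?h)"
      by (simp only: avg_cmult avg_add avg_diff avg_const \<alpha>_def[symmetric] mult_1_left distrib_right)
    ultimately show ?thesis by (simp only: avg_cmult)
  qed
  also have "\<dots> \<le> ?\<beta> / real m * ((1 + 1 / (6 * real m)) * \<alpha> + \<alpha> / (3 * real m))"
  proof -
    have "\<gamma> * (\<alpha> * ?\<beta> ^ m) \<le> \<gamma> * (theta m / real (m + 1))" using theta_bmax gam_pos by (intro mult_left_mono) auto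
    then have "\<gamma> * (\<alpha> * ?\<beta> ^ m) \<le> avg High base + \<gamma> * (2 * \<nu> ^ m)" using s_ge window by simp
    also have "\<gamma> * (2 * \<nu> ^ m) \<le> \<gamma> * (6 * \<nu> ^ m * ?\<beta> ^ m)"
      using gam_pos mult_left_mono[OF b3, of "6 * \<nu> ^ m"] nu01 by (intro mult_left_mono) auto
    finally have "\<alpha> * (\<gamma> * ?\<beta> ^ m) - 6 * \<nu> ^ m * (\<gamma> * ?\<beta> ^ m) \<le> avg High base" by (simp add: mult_ac)
    then have "\<alpha> - 6 * \<nu> ^ m \<le> avg High base / (\<gamma> * ?\<beta> ^ m)"
      using b gam_pos by (simp add: pos_le_divide_eq left_diff_distrib)
    then have "9 * real m * (\<alpha> - avg High base / (\<gamma> * ?\<beta> ^ m)) \<le> 9 * real m * (6 * \<nu> ^ m)"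
      using m by (intro mult_left_mono) auto
    also have "\<dots> = (54 * real m ^ 2 * \<nu> ^ m) / real m" using m by (simp add: power2_eq_square)
    also have "\<dots> \<le> (\<alpha> / 3) / real m"
    proof (rule divide_right_mono)
      show "54 * real m ^ 2 * \<nu> ^ m \<le> \<alpha> / 3" by (rule order_trans[OF num_spread[OF m6] divide_right_mono[OF alpha_ge]]) simp
    qed simp
    finally show ?thesis using b m by (intro mult_left_mono add_left_mono) auto
  qed
  also have "(1 + 1 / (6 * real m)) * \<alpha> + \<alpha> / (3 * real m) = \<alpha> * (1 + 1 / (2 * real m))"
  proof -
    have "(1 + 1 / (6 * x)) * a + a / (3 * x) = a * (1 + 1 / (2 * x))" if "0 < x" for x a :: real
      using that by (simp add: field_simps)
    from this[of "real m" \<alpha>] show ?thesis using m by linarith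
  qed
  finally show ?thesis .
qed

text \<open>Vertices of \<open>W\<close> are in-neighbours of almost all of \<open>High\<close>, so
  the mean of \<open>yi\<close> limits \<open>dens W\<close> to about
  \<open>(1 - \<alpha>) / m\<close>. The lower bound \<open>alpha_ge\<close> turns this into a
  multiple of \<open>\<alpha>\<close> close to 1.\<close>

lemma W_le:
  assumes l1: "l = 1"
  shows "dens W \<le> (1 + 7 / (6 * real m)) * \<alpha>"
proof -
  let ?\<beta> = "1 - \<alpha>"
  let ?M = "real (m + 1)"
  have m: "real m \<ge> 6" using m6 by linarith
  have M: "?M > 0" by simp
  have "avg High yW \<le> avg High yi"
    unfolding yi_def yW_def using W_sub by (intro avg_mono dens_mono) auto
  then have "dens W * (\<alpha> * (1 - q0)) \<le> ?\<beta> / real m * (\<alpha> * (1 + 1 / (2 * real m)))"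
    using avg_yW avg_yi_le[OF l1] by linarith
  then have "\<alpha> * (dens W * (1 - q0)) \<le> \<alpha> * (?\<beta> / real m * (1 + 1 / (2 * real m)))" by (simp only: mult_ac)
  then have 1: "dens W * (1 - q0) \<le> ?\<beta> / real m * (1 + 1 / (2 * real m))" by (simp only: mult_le_cancel_left_pos[OF alpha_pos])
  have "?\<beta> \<le> 1 - (1 - 1 / (3 * real m)) / ?M" using alpha_ge by simp
  also have "\<dots> = (?M - (1 - 1 / (3 * real m))) / ?M" by (subst diff_divide_distrib) simp
  also have "?M - (1 - 1 / (3 * real m)) = real m * (1 + 1 / (3 * real m ^ 2))"
  proof -
    have "x + 1 - (1 - 1 / (3 * x)) = x * (1 + 1 / (3 * x ^ 2))" if "0 < x" for x :: real
      using that by (simp add: field_simps power2_eq_square)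
    from this[of "real m"] show ?thesis using m by simp
  qed
  finally have "?\<beta> / real m \<le> (1 + 1 / (3 * real m ^ 2)) / ?M" using m M by (simp add: divide_le_eq mult_ac)
  then have "?\<beta> / real m * (1 + 1 / (2 * real m)) \<le> (1 + 1 / (3 * real m ^ 2)) / ?M * (1 + 1 / (2 * real m))"
    by (intro mult_right_mono) auto
  also have "\<dots> = ((1 + 1 / (3 * real m ^ 2)) * (1 + 1 / (2 * real m))) / ?M" by simp
  also have "\<dots> \<le> ((1 + 7 / (6 * real m)) * (1 - 1 / (6 * real m)) * (1 - 1 / (3 * real m))) / ?M"
    by (intro divide_right_mono num_ratio[OF m6]) auto
  also have "\<dots> = (1 + 7 / (6 * real m)) * (1 - q0) * ((1 - 1 / (3 * real m)) / ?M)" by (simp add: q0_def)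
  also have "\<dots> \<le> (1 + 7 / (6 * real m)) * (1 - q0) * \<alpha>"
    using alpha_ge q0_pos by (intro mult_left_mono) auto
  finally have "dens W * (1 - q0) \<le> (1 + 7 / (6 * real m)) * \<alpha> * (1 - q0)" using 1 by (simp add: mult_ac)
  then show ?thesis using q0_pos by (simp add: mult_le_cancel_right)
qed

text \<open>For \<open>l = 1\<close> the reciprocal of \<open>C\<close> is
  \<open>em (m - 1)\<close>. By \<open>W_le\<close> both sides are comparable to
  \<open>C \<alpha>^m dens W\<close>, and the factor \<open>1 / em m\<close> on the left decides;
  \<open>num_W\<close> is the resulting inequality.\<close>

lemma W_balance:
  assumes l1: "l = 1"
  shows "avg W (\<lambda>c. cstars c W) \<le> 1 / 2 * \<alpha> ^ m * dens W * (C * (1 - q0) - q0)"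
proof -
  have em0: "0 < em m" by (rule em_pos)
  have Cem: "C * em (m - 1) = 1"
  proof -
    have "real (m - 1) ^ (m - 1) > 0" "real (m - 2) ^ (m - 2) > 0" using kl by auto
    moreover obtain j where "k = Suc (Suc j)" using kl l1 by (cases k; cases "k - 1") auto
    ultimately show ?thesis unfolding C_def bmax_def em_def using l1 by simp
  qed
  have "C * dens W ^ m / em m \<le> C * ((1 + 7 / (6 * real m)) * \<alpha>) ^ m / em m"
    using W_le[OF l1] C_pos em0 by (intro divide_right_mono mult_left_mono power_mono) auto
  also have "\<dots> = C * \<alpha> ^ m * ((1 + 7 / (6 * real m)) ^ m / em m)" by (simp only: power_mult_distrib) simp
  also have "\<dots> \<le> C * \<alpha> ^ m * (1 / 2 * (1 - (1 + em (m - 1)) / (6 * real m)))"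
    using C_pos alpha_pos by (intro mult_left_mono num_W[OF m6]) auto
  also have "(1 + em (m - 1)) / (6 * real m) = q0 * (1 + em (m - 1))" by (simp add: q0_def)
  also have "C * \<alpha> ^ m * (1 / 2 * (1 - q0 * (1 + em (m - 1)))) = 1 / 2 * \<alpha> ^ m * (C - q0 * C - q0 * (C * em (m - 1)))"
    by (simp add: algebra_simps)
  finally have "C * dens W ^ m / em m \<le> 1 / 2 * \<alpha> ^ m * (C * (1 - q0) - q0)"
    unfolding Cem by (simp add: algebra_simps)
  then have "dens W * (C * dens W ^ m / em m) \<le> dens W * (1 / 2 * \<alpha> ^ m * (C * (1 - q0) - q0))"
    by (intro mult_left_mono) auto
  also have "\<dots> = 1 / 2 * \<alpha> ^ m * dens W * (C * (1 - q0) - q0)" by simp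
  finally show ?thesis using W_gain by linarith
qed

lemma main_1:
  assumes l1: "l = 1"
  shows "s_density k l n E \<le> OPT k l"
proof -
  let ?\<tau> = "\<gamma> * (1 - \<nu>) ^ m"
  let ?\<Lambda> = "avg (Low - W) lam"
  have L0: "0 \<le> ?\<Lambda>" "0 \<le> avg High miss" by (auto intro: avg_nonneg)
  have "(1 + 1 / em m) * \<nu> ^ (m - 1) \<le> (1 - \<nu>) ^ m * \<gamma> * ((1 - 1 / (3 * real m)) / real (m + 1)) * q0"
    using num_outside_W[OF m6] unfolding gam_em[OF l1] q0_def .
  also have "\<dots> \<le> (1 - \<nu>) ^ m * \<gamma> * \<alpha> * q0"
    using alpha_ge q0_pos gam_pos nu01 by (intro mult_right_mono mult_left_mono) auto
  finally have "(1 + 1 / em m) * \<nu> ^ (m - 1) * ?\<Lambda> \<le> (1 - \<nu>) ^ m * \<gamma> * \<alpha> * q0 * ?\<Lambda>"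
    using L0 by (intro mult_right_mono) auto
  then have 1: "(1 + 1 / em m) * \<nu> ^ (m - 1) * ?\<Lambda> \<le> ?\<tau> * (q0 * \<alpha> * ?\<Lambda>)" by (simp only: mult_ac)
  have "?\<tau> * (2 * \<nu>) \<le> (\<gamma> * 1) * (1 / 2)"
    using gam_pos nu01 by (intro mult_mono mult_left_mono power_le_one) auto
  then have 2: "?\<tau> * (2 * \<nu> * avg High miss) \<le> \<gamma> / 2 * avg High miss"
    using L0(2) mult_right_mono[of "?\<tau> * (2 * \<nu>)" "\<gamma> / 2" "avg High miss"] by (simp add: mult.assoc)
  have "s_density k l n E \<le> avg High (\<lambda>a. base a + C * \<alpha> ^ (m - 1) * yi a)"
  proof -
    have "avg High (\<lambda>a. base a + C * \<alpha> ^ (m - 1) * yi a) = avg High (\<lambda>a. xo a ^ k * yi a ^ l)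
        + \<gamma> * (real m / 3) * avg High miss + C * \<alpha> ^ (m - 1) * avg High yi"
      by (simp only: avg_add avg_cmult avg_base)
    moreover have "\<gamma> * (real m / 3 - 1 / 2) * avg High miss = \<gamma> * (real m / 3) * avg High miss - \<gamma> / 2 * avg High miss"
      by (simp add: algebra_simps)
    moreover have "?\<tau> * (q0 * \<alpha> * ?\<Lambda> - 2 * \<nu> * avg High miss) = ?\<tau> * (q0 * \<alpha> * ?\<Lambda>) - ?\<tau> * (2 * \<nu> * avg High miss)"
      by (rule right_diff_distrib)
    ultimately show ?thesis
      using s_split High_Low_loss1 Low_Low_gain1[OF l1] W_balance[OF l1] High_High_gain1[OF l1] 1 2
      by linarith
  qed
  also have "\<dots> \<le> OPT k l" by (rule OPT_bound_gt) (use kl l1 in auto)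
  finally show ?thesis .
qed

theorem density_le_OPT: "s_density k l n E \<le> OPT k l"
proof -
  consider "k = l" | "l < k" "2 \<le> l" | "l = 1" using kl by linarith
  then show ?thesis using main_eq main_gt2 main_1 by cases auto
qed

end

section \<open>Reduction to rich digraphs\<close>

lemma digraphs_iff:
  assumes "l \<le> k" "1 \<le> l" "6 \<le> k + l"
  shows "G \<in> digraphs \<longleftrightarrow> star_graph k l (fst G) (snd G)"
  using assms by (cases G) (auto simp: digraphs_def star_graph_def)

context star_graph
begin

lemma s_density_eq: "s_density k l n E = real (card stars) / real n ^ (k + l + 1)"
  by (simp add: s_density_def stars_def)

text \<open>Every vertex becomes an independent class of \<open>t\<close> twins, coded by its
  residue modulo \<open>n\<close> and a label. Each star lifts to \<open>t^(k + l + 1)\<close>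
  stars, so the density does not drop.\<close>

lemma blow_up:
  assumes "1 \<le> t"
  obtains E' where "star_graph k l (n * t) E'" "s_density k l n E \<le> s_density k l (n * t) E'"
proof
  define E' where "E' = {(u, v). u < n * t \<and> v < n * t \<and> (u mod n, v mod n) \<in> E}"
  show sg: "star_graph k l (n * t) E'"
    using kl n_pos loopless assms by unfold_locales (auto simp: E'_def)
  interpret B: star_graph k l "n * t" E' by (rule sg)
  let ?T = "{0..k+l} \<rightarrow>\<^sub>E {0..<t}"
  define F where "F = (\<lambda>(\<phi>, \<tau>). restrict (\<lambda>i. \<phi> i + n * \<tau> i :: nat) {0..k+l})"
  have F_app: "F (\<phi>, \<tau>) i = \<phi> i + n * \<tau> i" if "i \<le> k + l" for \<phi> \<tau> i using that by (simp add: F_def)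
  have inj: "inj_on F (stars \<times> ?T)"
  proof (rule inj_onI, clarify)
    fix \<phi> \<tau> \<phi>' \<tau>'
    assume *: "\<phi> \<in> stars" "\<phi>' \<in> stars" "\<tau> \<in> ?T" "\<tau>' \<in> ?T" "F (\<phi>, \<tau>) = F (\<phi>', \<tau>')"
    have e: "\<phi> i = \<phi>' i \<and> \<tau> i = \<tau>' i" if i: "i \<le> k + l" for i
    proof -
      have eq: "\<phi> i + n * \<tau> i = \<phi>' i + n * \<tau>' i" using *(5) F_app[OF i] by metis
      have lt: "\<phi> i < n" "\<phi>' i < n" using stars_V[OF *(1) i] stars_V[OF *(2) i] by auto
      have "(\<phi> i + n * \<tau> i) mod n = (\<phi>' i + n * \<tau>' i) mod n" using eq by simp
      then have "\<phi> i = \<phi>' i" using lt by simp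
      then show ?thesis using eq n_pos by simp
    qed
    have "\<phi> = \<phi>'" using stars_PiE[OF *(1)] stars_PiE[OF *(2)] e by (intro PiE_ext) auto
    moreover have "\<tau> = \<tau>'" using *(3,4) e by (intro PiE_ext) auto
    ultimately show "\<phi> = \<phi>' \<and> \<tau> = \<tau>'" by simp
  qed
  have sub: "F ` (stars \<times> ?T) \<subseteq> B.stars"
  proof
    fix \<psi> assume "\<psi> \<in> F ` (stars \<times> ?T)"
    then obtain \<phi> \<tau> where *: "\<phi> \<in> stars" "\<tau> \<in> ?T" "\<psi> = F (\<phi>, \<tau>)" by auto
    have app: "\<psi> i = \<phi> i + n * \<tau> i" if "i \<le> k + l" for i using F_app[OF that] *(3) by simp
    have lt: "\<phi> i < n" "\<tau> i < t" if "i \<le> k + l" for i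
      using stars_V[OF *(1) that] *(2) that by (auto simp: PiE_iff)
    have bd: "\<psi> i < n * t" if "i \<le> k + l" for i
    proof -
      have "\<psi> i < n + n * \<tau> i" using app lt that by simp
      also have "\<dots> = n * Suc (\<tau> i)" by simp
      also have "\<dots> \<le> n * t" using lt(2)[OF that] by (intro mult_le_mono2) simp
      finally show ?thesis .
    qed
    have md: "\<psi> i mod n = \<phi> i" if "i \<le> k + l" for i using app lt that by simp
    have "\<psi> \<in> star_verts k l \<rightarrow>\<^sub>E {0..<n * t}"
      using bd *(3) by (auto simp: star_verts_def F_def)
    moreover have "inj_on \<psi> (star_verts k l)"
    proof (rule inj_onI)
      fix i j assume "i \<in> star_verts k l" "j \<in> star_verts k l" "\<psi> i = \<psi> j"
      then have "i \<le> k + l" "j \<le> k + l" "\<phi> i = \<phi> j" using md[of i] md[of j] by (auto simp: star_verts_def)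
      then show "i = j" using stars_inj[OF *(1)] by (auto simp: inj_on_def)
    qed
    moreover have "(\<psi> u, \<psi> v) \<in> E' \<longleftrightarrow> star_arc k l u v" if "u \<le> k + l" "v \<le> k + l" for u v
      using stars_arc[OF *(1) that] bd that md by (simp add: E'_def)
    ultimately show "\<psi> \<in> B.stars" by (auto simp: B.stars_def star_iso_def star_verts_def)
  qed
  have "card stars * t ^ (k + l + 1) = card (stars \<times> ?T)" by (simp add: card_cartesian_product card_PiE)
  also have "\<dots> = card (F ` (stars \<times> ?T))" by (rule card_image[symmetric, OF inj])
  also have "\<dots> \<le> card B.stars" by (rule card_mono[OF B.finite_stars sub])
  finally have "real (card stars * t ^ (k + l + 1)) \<le> real (card B.stars)" by (rule of_nat_mono)
  then have c: "real (card stars) * real t ^ (k + l + 1) \<le> real (card B.stars)" by simp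
  have tp: "real t ^ (k + l + 1) > 0" using assms by simp
  have "real (card stars) / real n ^ (k + l + 1) = real (card stars) * real t ^ (k + l + 1) / (real n ^ (k + l + 1) * real t ^ (k + l + 1))"
    using tp by (intro mult_divide_mult_cancel_right[symmetric]) linarith
  also have "\<dots> \<le> real (card B.stars) / (real n ^ (k + l + 1) * real t ^ (k + l + 1))"
    using c by (intro divide_right_mono) auto
  also have "\<dots> = real (card B.stars) / real (n * t) ^ (k + l + 1)" by (simp add: power_mult_distrib)
  finally show "s_density k l n E \<le> s_density k l (n * t) E'" unfolding s_density_eq B.s_density_eq .
qed

lemma card_two_fixed:
  assumes "u \<noteq> v"
  shows "real (card {\<phi> \<in> stars. u \<in> \<phi> ` {0..k+l} \<and> v \<in> \<phi> ` {0..k+l}}) \<le> real (k + l + 1) ^ 2 * real n ^ (k + l - 1)"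
    (is "real (card ?F) \<le> _")
proof -
  let ?I = "{0..k+l} \<times> {0..k+l}"
  let ?G = "\<lambda>(i, j). {\<phi> \<in> stars. \<phi> i = u \<and> \<phi> j = v}"
  have "real (card ?F) \<le> (\<Sum>t\<in>?I. real n ^ (k + l - 1))"
  proof (rule card_UN_real)
    show "?F \<subseteq> (\<Union>t\<in>?I. ?G t)" by auto
    show "finite (?G t)" for t by (rule finite_subset[OF _ finite_stars]) auto
    fix t assume "t \<in> ?I"
    then obtain i j where t: "t = (i, j)" "i \<le> k + l" "j \<le> k + l" by auto
    show "real (card (?G t)) \<le> real n ^ (k + l - 1)"
    proof (cases "i = j")
      case True
      then have "?G t = {}" using assms t by auto
      then show ?thesis by (simp only: card.empty) simp
    next
      case False
      define A where "A r = (if r = i then {u} else if r = j then {v} else {0..<n})" for r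
      have "real (card (?G t)) \<le> (\<Prod>r\<in>{0..k+l}. real (card (A r)))"
      proof (rule card_le_prod)
        fix \<phi> r assume "\<phi> \<in> ?G t" "r \<le> k + l"
        then show "\<phi> r \<in> A r" using t stars_V[of \<phi> r] by (auto simp: A_def)
      qed (auto simp: t A_def)
      also have "{0..k+l} = insert i (insert j ({0..k+l} - {i, j}))" using t by auto
      also have "(\<Prod>r\<in>\<dots>. real (card (A r))) = (\<Prod>r\<in>{0..k+l} - {i, j}. real (card (A r)))"
        using False by (simp add: A_def)
      also have "\<dots> = real n ^ card ({0..k+l} - {i, j})" by (simp add: A_def)
      also have "card ({0..k+l} - {i, j}) = k + l - 1" using t False by (simp add: card_Diff_subset)
      finally show ?thesis .
    qed
  qed simp
  also have "\<dots> = real (k + l + 1) ^ 2 * real n ^ (k + l - 1)"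
    by (simp add: card_cartesian_product power2_eq_square algebra_simps)
  finally show ?thesis .
qed

text \<open>\<open>u\<close> is turned into a twin of \<open>v\<close>, not adjacent to
  \<open>v\<close>. Stars avoiding \<open>u\<close> survive, and those of them through
  \<open>v\<close> get a second copy through \<open>u\<close>. Stars of the old digraph through both
  vertices form the error, at most \<open>(k + l + 1)^2 n^(k + l - 1)\<close> by
  \<open>card_two_fixed\<close>.\<close>

lemma clone:
  assumes "u < n" "v < n" "u \<noteq> v"
  obtains E' where "star_graph k l n E'"
    "vstars v - vstars u - real (k + l + 1) ^ 2 / real n \<le> real n * (s_density k l n E' - s_density k l n E)"
proof
  define r where "r x = (if x = u then v else x)" for x
  define E' where "E' = {(x, y). x < n \<and> y < n \<and> (r x, r y) \<in> E}"
  show sg: "star_graph k l n E'"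
    using kl n_pos loopless by unfold_locales (auto simp: E'_def)
  interpret B: star_graph k l n E' by (rule sg)
  let ?R = "\<lambda>\<phi>. \<phi> ` {0..k+l}"
  let ?S = "{\<phi> \<in> stars. u \<notin> ?R \<phi>}"
  let ?T = "{\<phi> \<in> stars. v \<in> ?R \<phi> \<and> u \<notin> ?R \<phi>}"
  define F where "F \<phi> = restrict (\<lambda>i. if \<phi> i = v then u else \<phi> i) {0..k+l}" for \<phi> :: "nat \<Rightarrow> nat"
  have star: "\<psi> \<in> B.stars"
    if "\<phi> \<in> stars" "\<psi> \<in> {0..k+l} \<rightarrow>\<^sub>E {0..<n}" "\<And>i. i \<le> k + l \<Longrightarrow> r (\<psi> i) = \<phi> i" for \<phi> \<psi>
  proof -
    have "inj_on \<psi> {0..k+l}"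
    proof (rule inj_onI)
      fix i j assume "i \<in> {0..k+l}" "j \<in> {0..k+l}" "\<psi> i = \<psi> j"
      then have "i \<in> {0..k+l}" "j \<in> {0..k+l}" "\<phi> i = \<phi> j" using that(3)[of i] that(3)[of j] by auto
      then show "i = j" using inj_onD[OF stars_inj[OF that(1)]] by blast
    qed
    moreover have "(\<psi> i, \<psi> j) \<in> E' \<longleftrightarrow> star_arc k l i j" if "i \<le> k + l" "j \<le> k + l" for i j
    proof -
      have "\<psi> i < n" "\<psi> j < n" using \<open>\<psi> \<in> _\<close> that by (auto simp: PiE_iff)
      moreover have "r (\<psi> i) = \<phi> i" "r (\<psi> j) = \<phi> j"
        using \<open>\<And>i. i \<le> k + l \<Longrightarrow> r (\<psi> i) = \<phi> i\<close> that by auto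
      ultimately show ?thesis using stars_arc[OF \<open>\<phi> \<in> stars\<close> that] by (simp add: E'_def)
    qed
    ultimately show ?thesis using that(2) by (auto simp: B.stars_def star_iso_def star_verts_def)
  qed
  have S: "?S \<subseteq> B.stars"
  proof
    fix \<phi> assume p: "\<phi> \<in> ?S"
    then show "\<phi> \<in> B.stars" using stars_PiE by (intro star[of \<phi>]) (auto simp: r_def)
  qed
  have T: "F ` ?T \<subseteq> B.stars"
  proof clarify
    fix \<phi> assume p: "\<phi> \<in> stars" "u \<notin> ?R \<phi>"
    show "F \<phi> \<in> B.stars"
    proof (rule star[OF p(1)])
      show "F \<phi> \<in> {0..k+l} \<rightarrow>\<^sub>E {0..<n}" using stars_V[OF p(1)] assms by (auto simp: F_def)
      show "r (F \<phi> i) = \<phi> i" if "i \<le> k + l" for i using that p(2) by (auto simp: F_def r_def)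
    qed
  qed
  have disj: "?S \<inter> F ` ?T = {}"
  proof -
    have "u \<in> ?R (F \<phi>)" if "v \<in> ?R \<phi>" for \<phi> using that by (force simp: F_def)
    then show ?thesis by auto
  qed
  have inj: "inj_on F ?T"
  proof (rule inj_onI)
    fix \<phi> \<phi>' assume *: "\<phi> \<in> ?T" "\<phi>' \<in> ?T" "F \<phi> = F \<phi>'"
    have "\<phi> i = \<phi>' i" if "i \<le> k + l" for i
    proof -
      have "F \<phi> i = F \<phi>' i" using *(3) by simp
      moreover have "\<phi> i \<noteq> u" "\<phi>' i \<noteq> u" using * that by auto
      ultimately show ?thesis using that by (auto simp: F_def split: if_splits)
    qed
    then show "\<phi> = \<phi>'" using * stars_PiE by (intro PiE_ext[of \<phi> "{0..k+l}" _ \<phi>']) auto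
  qed
  have fin: "finite ?S" "finite ?T" by (rule finite_subset[OF _ finite_stars], auto)+
  have "card ?S + card ?T = card ?S + card (F ` ?T)" by (simp add: card_image[OF inj])
  also have "\<dots> = card (?S \<union> F ` ?T)" using fin disj by (intro card_Un_disjoint[symmetric]) auto
  also have "\<dots> \<le> card B.stars" using S T by (intro card_mono B.finite_stars) auto
  finally have 1: "real (card ?S) + real (card ?T) \<le> real (card B.stars)" by linarith
  let ?U = "\<lambda>w. {\<phi> \<in> stars. w \<in> ?R \<phi>}"
  have "card stars = card (?S \<union> ?U u)" by (rule arg_cong[of _ _ card]) auto
  also have "\<dots> = card ?S + card (?U u)" using finite_stars by (intro card_Un_disjoint) auto
  finally have 2: "real (card stars) = real (card ?S) + real (card (?U u))" by simp
  have "card (?U v) = card (?T \<union> {\<phi> \<in> stars. u \<in> ?R \<phi> \<and> v \<in> ?R \<phi>})" by (rule arg_cong[of _ _ card]) auto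
  also have "\<dots> \<le> card ?T + card {\<phi> \<in> stars. u \<in> ?R \<phi> \<and> v \<in> ?R \<phi>}" by (rule card_Un_le)
  finally have 3: "real (card (?U v)) \<le> real (card ?T) + real (k + l + 1) ^ 2 * real n ^ (k + l - 1)"
    using card_two_fixed[OF assms(3)] by linarith
  have np: "real n > 0" using n_pos by simp
  have "real (card (?U v)) - real (card (?U u)) - real (k + l + 1) ^ 2 * real n ^ (k + l - 1)
      \<le> real (card B.stars) - real (card stars)"
    using 1 2 3 by linarith
  then have "(real (card (?U v)) - real (card (?U u)) - real (k + l + 1) ^ 2 * real n ^ (k + l - 1)) / real n ^ (k + l)
      \<le> (real (card B.stars) - real (card stars)) / real n ^ (k + l)"
    using np by (intro divide_right_mono) auto
  also have "\<dots> = real n * (s_density k l n E' - s_density k l n E)"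
    using np unfolding B.s_density_eq s_density_eq by (simp add: field_simps)
  also have "(real (card (?U v)) - real (card (?U u)) - real (k + l + 1) ^ 2 * real n ^ (k + l - 1)) / real n ^ (k + l)
      = vstars v - vstars u - real (k + l + 1) ^ 2 / real n"
    using np unfolding vstars_def diff_divide_distrib by (simp add: n_pow)
  finally show "vstars v - vstars u - real (k + l + 1) ^ 2 / real n \<le> real n * (s_density k l n E' - s_density k l n E)" .
qed

text \<open>At a maximum no twinning gains, so the values \<open>vstars\<close> agree up to the
  twinning error, and their mean is known from \<open>sum_vstars\<close>.\<close>

lemma vstars_ge_of_max:
  assumes max: "\<And>E'. star_graph k l n E' \<Longrightarrow> s_density k l n E' \<le> s_density k l n E" and u: "u < n"
  shows "real (k + l + 1) * s_density k l n E - real (k + l + 1) ^ 2 / real n \<le> vstars u"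
proof -
  have np: "real n > 0" using n_pos by simp
  have le: "vstars v \<le> vstars u + real (k + l + 1) ^ 2 / real n" if "v < n" for v
  proof (cases "v = u")
    case False
    from False obtain E' where E': "star_graph k l n E'"
      "vstars v - vstars u - real (k + l + 1) ^ 2 / real n \<le> real n * (s_density k l n E' - s_density k l n E)"
      by (metis clone[OF u \<open>v < n\<close>])
    have "real n * (s_density k l n E' - s_density k l n E) \<le> 0"
      using max[OF E'(1)] np by (simp add: mult_nonneg_nonpos)
    then show ?thesis using E'(2) by linarith
  qed simp
  have "real (k + l + 1) * s_density k l n E = (\<Sum>v\<in>{0..<n}. vstars v) / real n" by (rule sum_vstars[symmetric])
  also have "\<dots> \<le> (\<Sum>v\<in>{0..<n}. vstars u + real (k + l + 1) ^ 2 / real n) / real n"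
    using le by (intro divide_right_mono sum_mono) auto
  also have "\<dots> = vstars u + real (k + l + 1) ^ 2 / real n" using np by simp
  finally show ?thesis by simp
qed

theorem s_density_le_OPT: "s_density k l n E \<le> OPT k l"
proof (rule ccontr)
  assume "\<not> ?thesis"
  then have gap: "0 < s_density k l n E - OPT k l" by simp
  \<comment> \<open>With this blow-up factor the twinning error \<open>(k + l + 1)^2 / N\<close> is
    less than \<open>k + l + 1\<close> times the gap.\<close>
  obtain t where t: "real (k + l + 1) / (s_density k l n E - OPT k l) < real t" using reals_Archimedean2 by blast
  moreover have "0 < real (k + l + 1) / (s_density k l n E - OPT k l)" using gap by simp
  ultimately have t0: "0 < real t" by linarith
  then have t1: "1 \<le> t" by simp
  define N where "N = n * t"
  obtain E0 where E0: "star_graph k l N E0" "s_density k l n E \<le> s_density k l N E0"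
    using blow_up[OF t1] unfolding N_def by metis
  let ?D = "{E'. star_graph k l N E'}"
  have "?D \<subseteq> Pow ({0..<N} \<times> {0..<N})" by (auto dest: star_graph.E_sub)
  then have finD: "finite ?D" by (rule finite_subset) auto
  have "Max (s_density k l N ` ?D) \<in> s_density k l N ` ?D" using finD E0 by (intro Max_in) auto
  then obtain E1 where E1: "star_graph k l N E1" "s_density k l N E1 = Max (s_density k l N ` ?D)" by auto
  have max: "s_density k l N E' \<le> s_density k l N E1" if "star_graph k l N E'" for E'
    unfolding E1(2) using finD that by (intro Max_ge) auto
  interpret M: star_graph k l N E1 by (rule E1(1))
  have s: "s_density k l n E \<le> s_density k l N E1" using E0 max by force
  have "real (k + l + 1) / real N \<le> real (k + l + 1) / real t"
    using t0 n_pos by (intro divide_left_mono) (auto simp: N_def)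
  also have "\<dots> < s_density k l n E - OPT k l" using t gap t0 by (simp add: field_simps)
  finally have "real (k + l + 1) * (real (k + l + 1) / real N) \<le> real (k + l + 1) * (s_density k l n E - OPT k l)"
    by (intro mult_left_mono) auto
  then have "real (k + l + 1) * OPT k l \<le> real (k + l + 1) * s_density k l n E - real (k + l + 1) ^ 2 / real N"
    by (simp add: power2_eq_square right_diff_distrib)
  also have "\<dots> \<le> real (k + l + 1) * s_density k l N E1 - real (k + l + 1) ^ 2 / real N"
    using s by (intro diff_right_mono mult_left_mono) auto
  finally have "bmax k l * theta (k + l) \<le> M.vstars u" if "u < N" for u
    using M.vstars_ge_of_max[OF max that] OPT_ge_theta[OF kl(1,2)] by linarith
  then interpret R: rich_star_graph k l N E1 by unfold_locales
  show False using R.density_le_OPT s gap by linarith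
qed

end

section \<open>The lower bound\<close>

text \<open>Each of the \<open>p\<close> blocks of \<open>h\<close> consecutive numbers meets every
  residue exactly once.\<close>

lemma card_residue:
  assumes "0 < h" "\<kappa> \<le> h"
  shows "card {x \<in> {s..<s + h * p}. (c + x) mod h < \<kappa>} = \<kappa> * p"
proof (induction p)
  case (Suc p)
  let ?s = "s + h * p"
  let ?f = "\<lambda>x. (c + x) mod h"
  have inj: "inj_on ?f {?s..<?s + h}"
  proof (rule linorder_inj_onI)
    fix x y assume xy: "x < y" "x \<in> {?s..<?s + h}" "y \<in> {?s..<?s + h}"
    show "?f x \<noteq> ?f y"
    proof
      assume "?f x = ?f y"
      then have "h dvd (c + y) - (c + x)" using xy(1) by (subst mod_eq_dvd_iff_nat[symmetric]) auto
      then have "h \<le> y - x" using xy(1) by (intro dvd_imp_le) auto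
      then show False using xy by auto
    qed
  qed auto
  have "?f ` {?s..<?s + h} = {0..<h}"
    by (rule card_subset_eq) (use assms in \<open>auto simp: card_image[OF inj]\<close>)
  moreover have "?f ` {x \<in> {?s..<?s + h}. ?f x < \<kappa>} = {z \<in> ?f ` {?s..<?s + h}. z < \<kappa>}" by blast
  moreover have "{z \<in> {0..<h}. z < \<kappa>} = {0..<\<kappa>}" using assms(2) by auto
  ultimately have img: "?f ` {x \<in> {?s..<?s + h}. ?f x < \<kappa>} = {0..<\<kappa>}" by (simp only:)
  have "inj_on ?f {x \<in> {?s..<?s + h}. ?f x < \<kappa>}" using inj by (rule inj_on_subset) auto
  from card_image[OF this] have 1: "card {x \<in> {?s..<?s + h}. ?f x < \<kappa>} = \<kappa>" unfolding img by simp
  have "{x \<in> {s..<s + h * Suc p}. ?f x < \<kappa>} = {x \<in> {s..<?s}. ?f x < \<kappa>} \<union> {x \<in> {?s..<?s + h}. ?f x < \<kappa>}" by auto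
  also have "card \<dots> = \<kappa> * p + \<kappa>" using Suc 1 by (subst card_Un_disjoint) auto
  finally show ?case by simp
qed simp

lemma card_not_inj:
  fixes n j :: nat
  shows "card {\<phi> \<in> {0..j} \<rightarrow>\<^sub>E {0..<n}. \<not> inj_on \<phi> {0..j}} \<le> (j + 1) ^ 2 * n ^ j"
proof -
  let ?P = "{0..j} \<rightarrow>\<^sub>E {0..<n}"
  let ?I = "{(u, v). u \<in> {0..j} \<and> v \<in> {0..j} \<and> u \<noteq> v}"
  let ?G = "\<lambda>(u, v). {\<phi> \<in> ?P. \<phi> u = \<phi> v}"
  have finP: "finite ?P" by (intro finite_PiE) auto
  have finI: "finite ?I" by (rule finite_subset[of _ "{0..j} \<times> {0..j}"]) auto
  have G: "card (?G t) \<le> n ^ j" if t: "t \<in> ?I" for t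
  proof -
    obtain u v where uv: "t = (u, v)" "u \<le> j" "v \<le> j" "u \<noteq> v" using t by auto
    let ?r = "\<lambda>\<phi>. restrict \<phi> ({0..j} - {v})"
    have "inj_on ?r (?G t)"
    proof (rule inj_onI)
      fix \<phi> \<psi> assume *: "\<phi> \<in> ?G t" "\<psi> \<in> ?G t" "?r \<phi> = ?r \<psi>"
      have e: "\<phi> x = \<psi> x" if "x \<in> {0..j} - {v}" for x using fun_cong[OF *(3), of x] that by simp
      have "\<phi> v = \<psi> v" using e[of u] * uv by auto
      then have "\<phi> x = \<psi> x" if "x \<in> {0..j}" for x using e[of x] that by (cases "x = v") auto
      then show "\<phi> = \<psi>" using * uv by (intro PiE_ext[of \<phi> "{0..j}" _ \<psi>]) auto
    qed
    then have "card (?G t) = card (?r ` ?G t)" by (rule card_image[symmetric])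
    also have "\<dots> \<le> card (({0..j} - {v}) \<rightarrow>\<^sub>E {0..<n})"
    proof (rule card_mono)
      show "?r ` ?G t \<subseteq> ({0..j} - {v}) \<rightarrow>\<^sub>E {0..<n}" by (intro image_subsetI) (auto simp: uv restrict_PiE_iff PiE_iff)
    qed (intro finite_PiE, auto)
    also have "\<dots> = n ^ j" using uv by (simp add: card_PiE)
    finally show ?thesis .
  qed
  have "{\<phi> \<in> ?P. \<not> inj_on \<phi> {0..j}} \<subseteq> (\<Union>t\<in>?I. ?G t)"
  proof
    fix \<phi> assume p: "\<phi> \<in> {\<phi> \<in> ?P. \<not> inj_on \<phi> {0..j}}"
    then obtain u v where "u \<in> {0..j}" "v \<in> {0..j}" "\<phi> u = \<phi> v" "u \<noteq> v" by (auto simp: inj_on_def)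
    then have "(u, v) \<in> ?I" "\<phi> \<in> ?G (u, v)" using p by auto
    then show "\<phi> \<in> (\<Union>t\<in>?I. ?G t)" by (rule UN_I)
  qed
  then have "card {\<phi> \<in> ?P. \<not> inj_on \<phi> {0..j}} \<le> card (\<Union>t\<in>?I. ?G t)"
    using finI finP by (intro card_mono) auto
  also have "\<dots> \<le> (\<Sum>t\<in>?I. card (?G t))" by (rule card_UN_le[OF finI])
  also have "\<dots> \<le> (\<Sum>t\<in>?I. n ^ j)" by (rule sum_mono) (rule G)
  also have "\<dots> = card ?I * n ^ j" by simp
  also have "card ?I \<le> card ({0..j} \<times> {0..j})" by (rule card_mono) auto
  also have "card ({0..j} \<times> {0..j}) = (j + 1) ^ 2" by (simp add: power2_eq_square)
  finally show ?thesis by simp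
qed

text \<open>The extremal construction: the vertices below \<open>h p\<close> and the others form independent sets;
  a fraction \<open>\<kappa> / h\<close> of the arcs between the first part and each vertex of the middle block of
  \<open>h q\<close> vertices points to the first part, all other arcs point away from it.\<close>

lemma construction_density:
  fixes h \<kappa> p q r k l :: nat
  assumes h: "0 < h" "\<kappa> \<le> h" and n: "n = h * p + h * q + r" "1 \<le> n"
  obtains E where "(n, E) \<in> digraphs"
    "(real (h * p) * real (r + (h - \<kappa>) * q) ^ k * real (\<kappa> * q) ^ l
      + real (h * q) * real (\<kappa> * p) ^ k * real ((h - \<kappa>) * p) ^ l) / real n ^ (k + l + 1)
      - real (k + l + 1) ^ 2 / real n \<le> s_density k l n E"
proof
  let ?a = "h * p" and ?b = "h * p + h * q"
  \<comment> \<open>The circulant pattern has the same exact fraction \<open>\<kappa> / h\<close> in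
    each row and each column, so all centres in the first part have equal degrees, and so have all
    centres in the middle block.\<close>
  define R where "R x y \<longleftrightarrow> y < ?b \<and> (x + y) mod h < \<kappa>" for x y
  define E where "E = {(x, y). (x < ?a \<and> ?a \<le> y \<and> y < n \<and> \<not> R x y) \<or> (y < ?a \<and> ?a \<le> x \<and> x < n \<and> R y x)}"
  show "(n, E) \<in> digraphs" using n by (auto simp: digraphs_def E_def)
  define Oc where "Oc c = (if c < ?a then {b \<in> {?a..<n}. \<not> R c b} else {x \<in> {0..<?a}. R x c})" for c
  define Ic where "Ic c = (if c < ?a then {b \<in> {?a..<n}. R c b} else {x \<in> {0..<?a}. \<not> R x c})" for c
  define A where "A c i = (if i = 0 then {c} else if i \<le> k then Oc c else Ic c)" for c and i :: nat
  let ?m = "k + l"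
  let ?H = "\<lambda>c. Pi\<^sub>E {0..?m} (A c)"
  have fin: "finite (Oc c)" "finite (Ic c)" for c by (auto simp: Oc_def Ic_def)
  have finH: "finite (?H c)" for c by (intro finite_PiE) (auto simp: A_def fin)
  have cH: "real (card (?H c)) = real (card (Oc c)) ^ k * real (card (Ic c)) ^ l" for c
    by (simp add: card_PiE prod_split) (simp add: A_def)
  have cOA: "card (Oc c) = r + (h - \<kappa>) * q \<and> card (Ic c) = \<kappa> * q" if "c < ?a" for c
  proof -
    have "Ic c = {b \<in> {?a..<?a + h * q}. (c + b) mod h < \<kappa>}" using that n by (auto simp: Ic_def R_def)
    then have i: "card (Ic c) = \<kappa> * q" using card_residue[OF h] by simp
    have "card (Oc c \<union> Ic c) = card (Oc c) + card (Ic c)"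
      using fin that by (intro card_Un_disjoint) (auto simp: Oc_def Ic_def)
    moreover have "Oc c \<union> Ic c = {?a..<n}" using that by (auto simp: Oc_def Ic_def)
    ultimately have "card (Oc c) + \<kappa> * q = h * q + r" using i n by simp
    moreover have "h * q = \<kappa> * q + (h - \<kappa>) * q" using h by (simp flip: add_mult_distrib)
    ultimately show ?thesis using i by simp
  qed
  have cOB: "card (Oc c) = \<kappa> * p \<and> card (Ic c) = (h - \<kappa>) * p" if "?a \<le> c" "c < ?b" for c
  proof -
    have "Oc c = {x \<in> {0..<0 + h * p}. (c + x) mod h < \<kappa>}" using that by (auto simp: Oc_def R_def add.commute)
    then have o: "card (Oc c) = \<kappa> * p" using card_residue[OF h, of 0 p c] by simp
    have "card (Oc c \<union> Ic c) = card (Oc c) + card (Ic c)"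
      using fin that by (intro card_Un_disjoint) (auto simp: Oc_def Ic_def)
    moreover have "Oc c \<union> Ic c = {0..<?a}" using that by (auto simp: Oc_def Ic_def)
    ultimately have "card (Ic c) + \<kappa> * p = h * p" using o by simp
    moreover have "h * p = \<kappa> * p + (h - \<kappa>) * p" using h by (simp flip: add_mult_distrib)
    ultimately show ?thesis using o by simp
  qed
  have cA: "real (card (?H c)) = real (r + (h - \<kappa>) * q) ^ k * real (\<kappa> * q) ^ l" if "c \<in> {0..<?a}" for c
    using cOA[of c] that unfolding cH by simp
  have cB: "real (card (?H c)) = real (\<kappa> * p) ^ k * real ((h - \<kappa>) * p) ^ l" if "c \<in> {?a..<?b}" for c
    using cOB[of c] that unfolding cH by simp
  let ?F = "\<Union>c\<in>{0..<?b}. ?H c"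
  have "card ?F = (\<Sum>c\<in>{0..<?b}. card (?H c))"
  proof (rule card_UN_disjoint)
    show "\<forall>c\<in>{0..<?b}. \<forall>c'\<in>{0..<?b}. c \<noteq> c' \<longrightarrow> ?H c \<inter> ?H c' = {}"
    proof (intro ballI impI equals0I)
      fix c c' \<phi> assume "c \<noteq> c'" "\<phi> \<in> ?H c \<inter> ?H c'"
      then have "\<phi> 0 \<in> A c 0" "\<phi> 0 \<in> A c' 0" by (auto simp: PiE_iff)
      then show False using \<open>c \<noteq> c'\<close> by (simp add: A_def)
    qed
  qed (use finH in auto)
  also have "\<dots> = (\<Sum>c\<in>{0..<?a}. card (?H c)) + (\<Sum>c\<in>{?a..<?b}. card (?H c))"
    by (rule sum.atLeastLessThan_concat[symmetric]) auto
  finally have "real (card ?F) = (\<Sum>c\<in>{0..<?a}. real (card (?H c))) + (\<Sum>c\<in>{?a..<?b}. real (card (?H c)))"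
    by (simp only: of_nat_add of_nat_sum)
  then have F: "real (card ?F) = real (h * p) * (real (r + (h - \<kappa>) * q) ^ k * real (\<kappa> * q) ^ l)
      + real (h * q) * (real (\<kappa> * p) ^ k * real ((h - \<kappa>) * p) ^ l)"
    using cA cB by simp
  let ?P = "{0..?m} \<rightarrow>\<^sub>E {0..<n}"
  let ?S = "{\<phi> \<in> star_verts k l \<rightarrow>\<^sub>E {0..<n}. star_iso k l E \<phi>}"
  let ?N = "{\<phi> \<in> ?P. \<not> inj_on \<phi> {0..?m}}"
  have finP: "finite ?P" by (intro finite_PiE) auto
  \<comment> \<open>Leaves of one centre lie in a common independent part, so any choice with the
    right orientation gives an induced star unless two leaves coincide.\<close>
  have sub: "?F \<subseteq> ?S \<union> ?N"
  proof
    fix \<phi> assume "\<phi> \<in> ?F"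
    then obtain c where c: "c < ?b" "\<phi> \<in> ?H c" by auto
    have cn: "c < n" using c(1) n by simp
    have AV: "A c i \<subseteq> {0..<n}" for i using cn n by (auto simp: A_def Oc_def Ic_def)
    have mem: "\<phi> i \<in> A c i" if "i \<le> ?m" for i using c(2) that by (auto simp: PiE_iff)
    have "\<phi> i \<in> {0..<n}" if "i \<le> ?m" for i using subsetD[OF AV mem[OF that]] .
    then have P: "\<phi> \<in> ?P" using c(2) by (auto simp: PiE_iff)
    have arc: "(\<phi> u, \<phi> v) \<in> E \<longleftrightarrow> star_arc k l u v" if "u \<le> ?m" "v \<le> ?m" for u v
      using mem[OF that(1)] mem[OF that(2)] that cn
      by (cases "c < ?a"; cases "u = 0"; cases "v = 0"; cases "u \<le> k"; cases "v \<le> k")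
        (auto simp: A_def Oc_def Ic_def E_def star_arc_def)
    show "\<phi> \<in> ?S \<union> ?N"
      using P arc by (cases "inj_on \<phi> {0..?m}") (auto simp: star_iso_def star_verts_def)
  qed
  have "card ?F \<le> card (?S \<union> ?N)"
    by (rule card_mono[OF _ sub]) (use finP in \<open>auto simp: star_verts_def\<close>)
  also have "\<dots> \<le> card ?S + card ?N" by (rule card_Un_le)
  also have "card ?N \<le> (?m + 1) ^ 2 * n ^ ?m" by (rule card_not_inj)
  finally have "real (card ?F) \<le> real (card ?S + (?m + 1) ^ 2 * n ^ ?m)" by (simp only: of_nat_le_iff add_left_mono)
  then have "real (card ?F) - real (?m + 1) ^ 2 * real n ^ ?m \<le> real (card ?S)" by simp
  then have "(real (card ?F) - real (?m + 1) ^ 2 * real n ^ ?m) / real n ^ (?m + 1) \<le> s_density k l n E"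
    unfolding s_density_def by (intro divide_right_mono) auto
  moreover have "(real (card ?F) - real (?m + 1) ^ 2 * real n ^ ?m) / real n ^ (?m + 1)
      = real (card ?F) / real n ^ (?m + 1) - real (?m + 1) ^ 2 / real n"
    using n(2) by (simp add: diff_divide_distrib)
  ultimately show "(real (h * p) * real (r + (h - \<kappa>) * q) ^ k * real (\<kappa> * q) ^ l
      + real (h * q) * real (\<kappa> * p) ^ k * real ((h - \<kappa>) * p) ^ l) / real n ^ (k + l + 1)
      - real (k + l + 1) ^ 2 / real n \<le> s_density k l n E"
    unfolding F by (simp only: mult.assoc)
qed

lemma tendsto_nat_floor:
  fixes c :: real assumes "0 \<le> c"
  shows "(\<lambda>t. real (nat \<lfloor>c * real t\<rfloor>) / real t) \<longlonglongrightarrow> c"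
proof (rule tendsto_sandwich)
  show "\<forall>\<^sub>F t in sequentially. c - 1 / real t \<le> real (nat \<lfloor>c * real t\<rfloor>) / real t"
    using eventually_gt_at_top[of 0]
  proof eventually_elim
    case (elim t)
    have "c * real t - 1 \<le> real (nat \<lfloor>c * real t\<rfloor>)" using assms by linarith
    then have "(c * real t - 1) / real t \<le> real (nat \<lfloor>c * real t\<rfloor>) / real t" by (rule divide_right_mono) simp
    then show ?case using elim by (simp add: diff_divide_distrib)
  qed
  show "\<forall>\<^sub>F t in sequentially. real (nat \<lfloor>c * real t\<rfloor>) / real t \<le> c"
    using eventually_gt_at_top[of 0]
  proof eventually_elim
    case (elim t)
    have "real (nat \<lfloor>c * real t\<rfloor>) \<le> c * real t" using assms by simp
    then show ?case using elim by (simp add: field_simps)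
  qed
  show "(\<lambda>t. c - 1 / real t) \<longlonglongrightarrow> c"
    using tendsto_diff[OF tendsto_const lim_1_over_n, of c] by simp
qed simp

lemma homogeneous:
  fixes s :: real
  shows "s * a * (s * b) ^ k * (s * c) ^ l + s * d * (s * e) ^ k * (s * f) ^ l
    = s ^ (k + l + 1) * (a * b ^ k * c ^ l + d * e ^ k * f ^ l)"
  by (simp add: power_mult_distrib power_add distrib_left mult_ac)

text \<open>\<open>y\<close> is the share of the middle block in the second part. Part sizes are
  rounded multiples of \<open>t\<close>; numerator and denominator are homogeneous of degree
  \<open>k + l + 1\<close>, so \<open>t\<close> cancels and the bound passes to the limit.\<close>

lemma construction_limit:
  fixes \<alpha> y S :: real and h \<kappa> k l :: nat
  assumes h: "0 < h" "\<kappa> \<le> h" and \<alpha>: "0 \<le> \<alpha>" "\<alpha> \<le> 1" and y: "0 \<le> y" "y \<le> 1"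
    and S: "\<And>n E. (n, E) \<in> digraphs \<Longrightarrow> s_density k l n E \<le> S"
  defines "\<beta> \<equiv> 1 - \<alpha>"
  shows "\<alpha> * ((1 - y) * \<beta> + real (h - \<kappa>) * (y * \<beta> / real h)) ^ k * (real \<kappa> * (y * \<beta> / real h)) ^ l
    + y * \<beta> * (real \<kappa> * (\<alpha> / real h)) ^ k * (real (h - \<kappa>) * (\<alpha> / real h)) ^ l \<le> S"
proof -
  let ?m = "k + l"
  let ?g = "h - \<kappa>"
  define p q r where "p t = nat \<lfloor>\<alpha> / real h * real t\<rfloor>" and "q t = nat \<lfloor>y * \<beta> / real h * real t\<rfloor>"
    and "r t = nat \<lfloor>(1 - y) * \<beta> * real t\<rfloor>" for t :: nat
  define P Q R where "P t = real (p t) / real t" and "Q t = real (q t) / real t"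
    and "R t = real (r t) / real t" for t :: nat
  have \<beta>0: "0 \<le> \<beta>" using \<alpha> by (simp add: \<beta>_def)
  have lim: "P \<longlonglongrightarrow> \<alpha> / real h" "Q \<longlonglongrightarrow> y * \<beta> / real h" "R \<longlonglongrightarrow> (1 - y) * \<beta>"
    unfolding P_def Q_def R_def p_def q_def r_def
    by (intro tendsto_nat_floor; use \<alpha> y \<beta>0 in simp)+
  define N where "N t = real h * P t + real h * Q t + R t" for t
  define X where "X t = real h * P t * (R t + real ?g * Q t) ^ k * (real \<kappa> * Q t) ^ l
    + real h * Q t * (real \<kappa> * P t) ^ k * (real ?g * P t) ^ l" for t
  have "N \<longlonglongrightarrow> real h * (\<alpha> / real h) + real h * (y * \<beta> / real h) + (1 - y) * \<beta>"
    unfolding N_def by (intro tendsto_intros lim)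
  moreover have "real h * (\<alpha> / real h) + real h * (y * \<beta> / real h) + (1 - y) * \<beta> = 1"
  proof -
    have "real h * (\<alpha> / real h) = \<alpha>" "real h * (y * \<beta> / real h) = y * \<beta>" using h by auto
    then show ?thesis by (simp only:) (simp add: \<beta>_def algebra_simps)
  qed
  ultimately have N: "N \<longlonglongrightarrow> 1" by simp
  have X: "X \<longlonglongrightarrow> real h * (\<alpha> / real h) * ((1 - y) * \<beta> + real ?g * (y * \<beta> / real h)) ^ k * (real \<kappa> * (y * \<beta> / real h)) ^ l
    + real h * (y * \<beta> / real h) * (real \<kappa> * (\<alpha> / real h)) ^ k * (real ?g * (\<alpha> / real h)) ^ l"
    unfolding X_def by (intro tendsto_intros lim)
  have L: "(\<lambda>t. X t / N t ^ (?m + 1) - real (?m + 1) ^ 2 * (1 / real t) * (1 / N t)) \<longlonglongrightarrow>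
    (real h * (\<alpha> / real h) * ((1 - y) * \<beta> + real ?g * (y * \<beta> / real h)) ^ k * (real \<kappa> * (y * \<beta> / real h)) ^ l
    + real h * (y * \<beta> / real h) * (real \<kappa> * (\<alpha> / real h)) ^ k * (real ?g * (\<alpha> / real h)) ^ l) / 1 ^ (?m + 1)
    - real (?m + 1) ^ 2 * 0 * (1 / 1)"
    by (intro tendsto_intros X N lim_1_over_n) auto
  have "\<forall>\<^sub>F t in sequentially. 0 < N t" using order_tendstoD(1)[OF N, of 0] by simp
  moreover have "\<forall>\<^sub>F t in sequentially. 0 < (t::nat)" by (rule eventually_gt_at_top)
  ultimately have ev: "\<forall>\<^sub>F t in sequentially. X t / N t ^ (?m + 1) - real (?m + 1) ^ 2 * (1 / real t) * (1 / N t) \<le> S"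
  proof eventually_elim
    case (elim t)
    define n where "n = h * p t + h * q t + r t"
    have tp: "real t > 0" using elim by simp
    have pqr: "real (p t) = real t * P t" "real (q t) = real t * Q t" "real (r t) = real t * R t"
      using tp by (simp_all add: P_def Q_def R_def)
    have nN: "real n = real t * N t" by (simp add: n_def N_def pqr algebra_simps)
    have n1: "1 \<le> n"
    proof (rule ccontr)
      assume "\<not> 1 \<le> n"
      then have "real n = 0" by simp
      then have "real t * N t = 0" using nN by simp
      then show False using tp elim by simp
    qed
    obtain E where E: "(n, E) \<in> digraphs"
      "(real (h * p t) * real (r t + ?g * q t) ^ k * real (\<kappa> * q t) ^ l
      + real (h * q t) * real (\<kappa> * p t) ^ k * real (?g * p t) ^ l) / real n ^ (?m + 1)
      - real (?m + 1) ^ 2 / real n \<le> s_density k l n E"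
      using construction_density[OF h n_def n1] by blast
    have "real (h * p t) = real t * (real h * P t)" "real (h * q t) = real t * (real h * Q t)"
      "real (r t + ?g * q t) = real t * (R t + real ?g * Q t)" "real (\<kappa> * q t) = real t * (real \<kappa> * Q t)"
      "real (\<kappa> * p t) = real t * (real \<kappa> * P t)" "real (?g * p t) = real t * (real ?g * P t)"
      by (simp_all add: pqr distrib_left mult_ac del: of_nat_diff)
    then have "real (h * p t) * real (r t + ?g * q t) ^ k * real (\<kappa> * q t) ^ l
      + real (h * q t) * real (\<kappa> * p t) ^ k * real (?g * p t) ^ l = real t ^ (?m + 1) * X t"
      by (simp only: X_def homogeneous)
    then have "real t ^ (?m + 1) * X t / (real t ^ (?m + 1) * N t ^ (?m + 1)) - real (?m + 1) ^ 2 / (real t * N t) \<le> S"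
      using E(2) S[OF E(1)] unfolding nN power_mult_distrib by simp
    moreover have "real t ^ (?m + 1) * X t / (real t ^ (?m + 1) * N t ^ (?m + 1)) = X t / N t ^ (?m + 1)"
      using tp by (intro mult_divide_mult_cancel_left) simp
    ultimately show ?case by simp
  qed
  have "(real h * (\<alpha> / real h) * ((1 - y) * \<beta> + real ?g * (y * \<beta> / real h)) ^ k * (real \<kappa> * (y * \<beta> / real h)) ^ l
    + real h * (y * \<beta> / real h) * (real \<kappa> * (\<alpha> / real h)) ^ k * (real ?g * (\<alpha> / real h)) ^ l) / 1 ^ (?m + 1)
    - real (?m + 1) ^ 2 * 0 * (1 / 1) \<le> S"
    by (rule tendsto_upperbound[OF L ev]) simp
  then show ?thesis using h by simp
qed

theorem theorem2p1:
  fixes k l :: nat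
  assumes "k \<ge> l" and "l \<ge> 1" and "k + l \<ge> 6"
  shows "(SUP G\<in>digraphs. s_density k l (fst G) (snd G)) = OPT k l"
proof (rule antisym)
  have upper: "s_density k l (fst G) (snd G) \<le> OPT k l" if "G \<in> digraphs" for G
    using that star_graph.s_density_le_OPT unfolding digraphs_iff[OF assms] by blast
  have ne: "digraphs \<noteq> {}"
    by (rule ex_in_conv[THEN iffD1], rule exI[of _ "(1, {})"]) (simp add: digraphs_def)
  show "(SUP G\<in>digraphs. s_density k l (fst G) (snd G)) \<le> OPT k l"
    using ne upper by (rule cSUP_least)
  let ?S = "SUP G\<in>digraphs. s_density k l (fst G) (snd G)"
  have bdd: "bdd_above ((\<lambda>G. s_density k l (fst G) (snd G)) ` digraphs)"
    using upper by (rule bdd_aboveI2)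
  have S: "s_density k l n E \<le> ?S" if "(n, E) \<in> digraphs" for n E
    using cSUP_upper[OF that bdd] by simp
  show "OPT k l \<le> ?S"
  proof (cases "k = l")
    case True
    have "bmax k k * (\<alpha> * (1 - \<alpha>) ^ (k + k) + (1 - \<alpha>) * \<alpha> ^ (k + k)) \<le> ?S" if "0 \<le> \<alpha>" "\<alpha> \<le> 1" for \<alpha>
    proof -
      have half: "bmax k k = (1 / 2) ^ k * (1 / 2) ^ k"
      proof -
        have "real (k + k) ^ (k + k) = 2 ^ k * 2 ^ k * (real k ^ k * real k ^ k)"
        proof -
          have e: "real (k + k) = 2 * real k" by simp
          show ?thesis unfolding e power_add power_mult_distrib by (simp only: mult_ac)
        qed
        moreover have "0 < real k ^ k" using assms by simp
        ultimately show ?thesis by (simp add: bmax_def power_divide)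
      qed
      \<comment> \<open>The middle block is the whole second part, and half of the arcs point each
        way.\<close>
      have "\<alpha> * ((1 - \<alpha>) / 2) ^ k * ((1 - \<alpha>) / 2) ^ k + (1 - \<alpha>) * (\<alpha> / 2) ^ k * (\<alpha> / 2) ^ k \<le> ?S"
        using construction_limit[of 2 1 \<alpha> 1 k l ?S] S that True by simp
      then show ?thesis unfolding half by (simp add: power_divide power_add distrib_left mult_ac)
    qed
    then have "(SUP \<alpha>\<in>{0..1::real}. \<alpha> * (1 - \<alpha>) ^ (k + k) + (1 - \<alpha>) * \<alpha> ^ (k + k)) \<le> ?S / bmax k k"
      using bmax_pos[of k k] by (intro cSUP_least) (auto simp: pos_le_divide_eq mult.commute)
    then have "bmax k k * (SUP \<alpha>\<in>{0..1::real}. \<alpha> * (1 - \<alpha>) ^ (k + k) + (1 - \<alpha>) * \<alpha> ^ (k + k)) \<le> ?S"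
      using bmax_pos[of k k] by (simp add: pos_le_divide_eq mult.commute)
    then show ?thesis using OPT_eq_eq[of k] True by simp
  next
    case False
    then have lk: "l < k" "2 \<le> k" using assms by auto
    let ?m = "k + l"
    let ?h = "k + l - 1"
    let ?f = "\<lambda>\<alpha> d. \<alpha> * (1 - \<alpha>) ^ ?m * d ^ k * (1 - d) ^ l + bmax (k - 1) l * (1 - \<alpha>) * \<alpha> ^ ?m * (1 - d)"
    \<comment> \<open>The contact point of the tangent line, used as out-density of middle-block
      centres towards the first part. It is realised exactly by \<open>\<kappa> = k - 1\<close> and
      \<open>h = k + l - 1\<close>.\<close>
    define d0 where "d0 = real (k - 1) / real ?h"
    have hk: "?h = (k - 1) + l" "?h - (k - 1) = l" "real ?h > 0" "real (k - 1) > 0" using lk assms by auto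
    have d0: "0 \<le> d0" "d0 \<le> 1" "1 - d0 = real l / real ?h" "1 - d0 \<le> d0"
    proof -
      have e: "real ?h = real (k - 1) + real l" unfolding hk(1) by simp
      show "0 \<le> d0" by (simp add: d0_def)
      show "1 - d0 = real l / real ?h" using hk(3) unfolding d0_def e by (simp add: field_simps)
      then show "d0 \<le> 1" using hk(3) by (simp add: d0_def e)
      show "1 - d0 \<le> d0" unfolding \<open>1 - d0 = _\<close> using lk hk(3) unfolding d0_def by (intro divide_right_mono) auto
    qed
    have bm: "bmax (k - 1) l = d0 ^ (k - 1) * (1 - d0) ^ l"
      unfolding d0(3) unfolding d0_def bmax_def hk(1) power_divide power_add by (rule times_divide_times_eq[symmetric])
    have right: "?f \<alpha> d \<le> ?S" if "0 \<le> \<alpha>" "\<alpha> \<le> 1" "d0 \<le> d" "d \<le> 1" for \<alpha> d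
    proof -
      \<comment> \<open>A vertex of the first part must receive the share \<open>1 - d\<close> of
        its arcs, and each middle vertex sends the share \<open>d0\<close>; this fixes the size of
        the middle block. It fits for \<open>d >= d0\<close> because \<open>1 - d0 <= d0\<close>,
        which rests on \<open>l < k\<close>.\<close>
      define y where "y = (1 - d) / d0"
      have d0p: "0 < d0" using hk by (simp add: d0_def)
      have y: "0 \<le> y" "y \<le> 1" "y * d0 = 1 - d" using d0 d0p that by (auto simp: y_def)
      let ?\<beta> = "1 - \<alpha>"
      have "\<alpha> * ((1 - y) * ?\<beta> + real l * (y * ?\<beta> / real ?h)) ^ k * (real (k - 1) * (y * ?\<beta> / real ?h)) ^ l
        + y * ?\<beta> * (real (k - 1) * (\<alpha> / real ?h)) ^ k * (real l * (\<alpha> / real ?h)) ^ l \<le> ?S"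
        using construction_limit[of ?h "k - 1" \<alpha> y k l ?S] hk that y(1,2) S by (simp del: of_nat_diff)
      moreover have "real (k - 1) * (y * ?\<beta> / real ?h) = ?\<beta> * (1 - d)"
        unfolding y(3)[symmetric] d0_def by simp
      moreover have "(1 - y) * ?\<beta> + real l * (y * ?\<beta> / real ?h) = ?\<beta> * d"
      proof -
        have "real l * (y * ?\<beta> / real ?h) = y * ?\<beta> * (1 - d0)" unfolding d0(3) by simp
        then have "(1 - y) * ?\<beta> + real l * (y * ?\<beta> / real ?h) = ?\<beta> * (1 - y * d0)" by (simp add: algebra_simps)
        then show ?thesis unfolding y(3) by simp
      qed
      moreover have "real (k - 1) * (\<alpha> / real ?h) = \<alpha> * d0" unfolding d0_def by simp
      moreover have "real l * (\<alpha> / real ?h) = \<alpha> * (1 - d0)" unfolding d0(3) by simp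
      ultimately have "\<alpha> * (?\<beta> * d) ^ k * (?\<beta> * (1 - d)) ^ l + y * ?\<beta> * (\<alpha> * d0) ^ k * (\<alpha> * (1 - d0)) ^ l \<le> ?S"
        by simp
      moreover have "y * ?\<beta> * (\<alpha> * d0) ^ k * (\<alpha> * (1 - d0)) ^ l = bmax (k - 1) l * ?\<beta> * \<alpha> ^ ?m * (1 - d)"
      proof -
        have "d0 ^ k = d0 * d0 ^ (k - 1)" using lk by (simp flip: power_Suc)
        then have "y * ?\<beta> * (\<alpha> * d0) ^ k * (\<alpha> * (1 - d0)) ^ l = (d0 ^ (k - 1) * (1 - d0) ^ l) * ?\<beta> * \<alpha> ^ ?m * (y * d0)"
          by (simp add: power_mult_distrib power_add mult_ac)
        then show ?thesis unfolding bm y(3) .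
      qed
      moreover have "\<alpha> * (?\<beta> * d) ^ k * (?\<beta> * (1 - d)) ^ l = \<alpha> * ?\<beta> ^ ?m * d ^ k * (1 - d) ^ l"
        by (simp add: power_mult_distrib power_add mult_ac)
      ultimately show ?thesis by simp
    qed
    \<comment> \<open>Values below \<open>d0\<close> reduce to \<open>d0\<close>: the bound
      \<open>d^(k - 1) (1 - d)^l <= c\<close> puts the expression below a function linear in
      \<open>d\<close>, which is nondecreasing because \<open>QQ <= PP\<close> for
      \<open>\<alpha> <= 1/2\<close>, and which is attained at \<open>d0\<close>.\<close>
    have left: "?f \<alpha> d \<le> ?f \<alpha> d0" if "0 \<le> \<alpha>" "\<alpha> \<le> 1 / 2" "0 \<le> d" "d \<le> d0" for \<alpha> d
    proof -
      define PP QQ c where "PP = \<alpha> * (1 - \<alpha>) ^ ?m" and "QQ = (1 - \<alpha>) * \<alpha> ^ ?m" and "c = bmax (k - 1) l"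
      have PQ: "0 \<le> QQ" "QQ \<le> PP"
      proof -
        show "0 \<le> QQ" using that by (simp add: QQ_def)
        have "\<alpha> ^ (?m - 1) \<le> (1 - \<alpha>) ^ (?m - 1)" using that by (intro power_mono) auto
        then have "\<alpha> * (1 - \<alpha>) * \<alpha> ^ (?m - 1) \<le> \<alpha> * (1 - \<alpha>) * (1 - \<alpha>) ^ (?m - 1)"
          using that by (intro mult_left_mono) auto
        moreover have "z ^ ?m = z * z ^ (?m - 1)" for z :: real using lk by (simp flip: power_Suc)
        ultimately show "QQ \<le> PP" unfolding PP_def QQ_def by (simp add: mult_ac)
      qed
      have c0: "0 < c" by (simp add: c_def bmax_pos)
      have kk: "z ^ k = z * z ^ (k - 1)" for z :: real using lk by (simp flip: power_Suc)
      have "d ^ (k - 1) * (1 - d) ^ l \<le> c"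
        using bmax_bound[of d "1 - d" "k - 1" l] that d0 by (simp add: c_def)
      then have "PP * d * (d ^ (k - 1) * (1 - d) ^ l) \<le> PP * d * c" using that PQ by (intro mult_left_mono) auto
      then have "?f \<alpha> d \<le> PP * d * c + c * QQ * (1 - d)"
        by (simp add: PP_def QQ_def c_def kk mult_ac)
      also have "\<dots> = c * QQ + c * (PP - QQ) * d" by (simp add: algebra_simps)
      also have "\<dots> \<le> c * QQ + c * (PP - QQ) * d0" using PQ c0 that by (intro add_left_mono mult_left_mono) auto
      also have "\<dots> = PP * d0 * c + c * QQ * (1 - d0)" by (simp add: algebra_simps)
      also have "PP * d0 * c = \<alpha> * (1 - \<alpha>) ^ ?m * d0 ^ k * (1 - d0) ^ l"
        unfolding c_def bm kk[of d0] by (simp add: PP_def mult_ac)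
      also have "\<dots> + c * QQ * (1 - d0) = ?f \<alpha> d0" by (simp add: QQ_def c_def mult_ac)
      finally show ?thesis .
    qed
    have "?f \<alpha> d \<le> ?S" if a: "0 \<le> \<alpha>" "\<alpha> \<le> 1 / 2" and d: "0 \<le> d" "d \<le> 1" for \<alpha> d
    proof (cases "d0 \<le> d")
      case True then show ?thesis using right[of \<alpha> d] a d by simp
    next
      case False
      then have "?f \<alpha> d \<le> ?f \<alpha> d0" using a d by (intro left) auto
      also have "\<dots> \<le> ?S" using right[of \<alpha> d0] a d0 by simp
      finally show ?thesis .
    qed
    moreover have "real k / real ?m \<le> 1" using lk by simp
    ultimately show ?thesis unfolding OPT_gt_eq[OF lk(1)] by (intro cSUP_least) auto
  qed
qed

end
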